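(* Let $\mathfrak S=([0,1]^{\mathbb N},\mathcal B,\mathrm{Leb}^{\otimes\mathbb N},S)$ be the measure-preserving dynamical system where $\mathrm{Leb}^{\otimes\mathbb N}$ is the product of Lebesgue measures on $[0,1]$, $\mathcal B$ is the product $\sigma$-algebra, and $S(x_1,x_2,\ldots)=(x_2,x_3,\ldots)$ is the one-sided shift. Let $\mathfrak J=(\Omega,\mathcal F,\mathsf P,J)$ be the jeu de taquin dynamical system on infinite Young tableaux with the Plancherel measure $\mathsf P$. Then the ($\mathrm{Leb}^{\otimes\mathbb N}$-almost everywhere defined) mapping $\mathrm{RSK}:[0,1]^{\mathbb N}\to\Omega$ is an isomorphism between the measure-preserving dynamical systems $\mathfrak J$ and $\mathfrak S$.
   Context: A box $(i,j)\in\mathbb N^2$ ($\mathbb N=\{1,2,\ldots\}$) lies in column $i$ and row $j$. A Young diagram $\lambda$ of size $n$ is a partition $\lambda(1)\ge\cdots\ge\lambda(k)>0$ of $n$, identified with the set of boxes $\{(i,j):1\le j\le k,\ 1\le i\le\lambda(j)\}$. Write $\lambda\nearrow\nu$ if $\nu$ is obtained from $\lambda$ by adding one box. $f^\lambda$ is the number of standard Young tableaux of shape $\lambda$. An infinite Young tableau is an array $t=(t_{i,j})_{i,j=1}^\infty$ of natural numbers in which each natural number appears exactly once and which is increasing in $i$ and in $j$. $\Omega$ is the set of all of them, with $\mathcal F$ the smallest $\sigma$-algebra making all coordinate functions $t\mapsto t_{i,j}$ measurable. An infinite path $\varnothing=\lambda_0\nearrow\lambda_1\nearrow\cdots$ that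 eventually includes every box of $\mathbb N^2$ corresponds bijectively to an infinite tableau $t$ (its recording tableau), via $\lambda_n=\{(i,j):t_{i,j}\le n\}$. The Plancherel growth process is the Markov chain $\varnothing=\Lambda_0\nearrow\Lambda_1\nearrow\cdots$ with transition probabilities $\mathrm{Prob}(\Lambda_{n+1}=\nu\mid\Lambda_n=\lambda)=\frac{f^\nu}{(n+1)f^\lambda}$ if $\lambda\nearrow\nu$ (and $0$ otherwise), $\lambda$ of size $n$. It almost surely eventually includes every box, and the Plancherel measure $\mathsf P$ on $(\Omega,\mathcal F)$ is the law of its recording tableau. The jeu de taquin path of $t\in\Omega$ is defined by $\mathbf p_1=(1,1)$ and, if $\mathbf p_{k-1}=(i,j)$, then $\mathbf p_k=(i+1,j)$ if $t_{i+1,j}<t_{i,j+1}$ and $\mathbf p_k=(i,j+1)$ if $t_{i+1,j}>t_{i,j+1}$. The jeu de taquin map $J:\Omega\to\Omega$ sends $t$ to $s=J(t)$ given by $s_{i,j}=t_{\mathbf p_{k+1}}-1$ if $(i,j)=\mathbf p_k$ for some $k$, and $s_{i,j}=t_{i,j}-1$ otherwise. Infinite RSK: for distinct reals $x_1,x_2,\ldots$, apply the row-insertion algorithm successively. Starting with the empty tableau $P_0$, the tableau $P_n$ is obtained from $P_{n-1}$ by inserting $x_n$ into the first row: if $x_n$ exceeds all entries of the row it is appended at the end of the row; otherwise it replaces the smallest entry larger than $x_n$, and the replaced entry is inserted in the same way into the next row, and so on until some entry is appended at the end of a (possibly empty) row. Let $\lambda_n$ be the shape of $P_n$ (the RSK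 shape of $(x_1,\ldots,x_n)$), so $\varnothing=\lambda_0\nearrow\lambda_1\nearrow\cdots$. If this path eventually includes every box of $\mathbb N^2$, define $\mathrm{RSK}(x_1,x_2,\ldots)\in\Omega$ to be its recording tableau. This is defined on a set of full $\mathrm{Leb}^{\otimes\mathbb N}$-measure. An isomorphism of measure-preserving systems is a measurable, measure-preserving map which intertwines the transformations almost everywhere and is invertible (with measurable inverse) between subsets of full measure. *)

theory Defs
  imports "HOL-Probability.Probability"
begin

text \<open>
  Indexing: boxes, sequences and paths are indexed from 0, so the box \<open>(i, j)\<close> (column \<open>i\<close>,
  row \<open>j\<close>) is the box \<open>(i + 1, j + 1)\<close> of the convention in which \<open>\<nat>\<close> starts at 1, and
  \<open>x n\<close> is the usual \<open>x\<^sub>n\<^sub>+\<^sub>1\<close>.  Tableau entries are the positive natural numbers, and the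
  \<open>n\<close>-th diagram of a growth path has \<open>n\<close> boxes.
\<close>

section \<open>Young diagrams and tableaux\<close>

type_synonym box = "nat \<times> nat"
type_synonym diagram = "box set"
type_synonym tableau = "box \<Rightarrow> nat"

definition diagram_of :: "nat list \<Rightarrow> diagram" where
  "diagram_of l = {(i, j). j < length l \<and> i < l ! j}"

definition young_diagram :: "diagram \<Rightarrow> bool" where
  "young_diagram d \<longleftrightarrow> (\<exists>l. sorted_wrt (\<ge>) l \<and> 0 \<notin> set l \<and> d = diagram_of l)"

definition add_box :: "diagram \<Rightarrow> diagram \<Rightarrow> bool" (infix \<open>\<hookrightarrow>\<close> 50) where
  "d \<hookrightarrow> e \<longleftrightarrow> young_diagram d \<and> young_diagram e \<and> (\<exists>b. b \<notin> d \<and> e = insert b d)"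

definition standard_tableaux :: "diagram \<Rightarrow> tableau set" where
  "standard_tableaux d = {t \<in> extensional d. bij_betw t d {1..card d} \<and>
     (\<forall>i j. (Suc i, j) \<in> d \<longrightarrow> t (i, j) < t (Suc i, j)) \<and>
     (\<forall>i j. (i, Suc j) \<in> d \<longrightarrow> t (i, j) < t (i, Suc j))}"

definition num_syt :: "diagram \<Rightarrow> nat" where
  "num_syt d = card (standard_tableaux d)"

lemma down_closed_nat_eq:
  fixes A :: "nat set"
  assumes "finite A" "\<And>i i'. i \<in> A \<Longrightarrow> i' \<le> i \<Longrightarrow> i' \<in> A"
  shows "A = {..<card A}"
proof (cases "A = {}")
  case False
  then have "A = {..Max A}"
    using assms(1) assms(2)[OF Max_in[OF assms(1)]] by (auto intro: Max_ge)
  then show ?thesis by (metis card_atMost lessThan_Suc_atMost)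
qed simp

lemma young_diagram_iff:
  "young_diagram d \<longleftrightarrow> finite d \<and>
     (\<forall>i j i' j'. (i, j) \<in> d \<longrightarrow> i' \<le> i \<longrightarrow> j' \<le> j \<longrightarrow> (i', j') \<in> d)"
proof
  assume "young_diagram d"
  then obtain l where l: "sorted_wrt (\<ge>) l" "d = diagram_of l"
    by (auto simp: young_diagram_def)
  have "d \<subseteq> (\<Union>j<length l. {..<l ! j} \<times> {j})"
    by (auto simp: l diagram_of_def)
  then have "finite d"
    by (rule finite_subset) auto
  moreover have "(i', j') \<in> d" if "(i, j) \<in> d" "i' \<le> i" "j' \<le> j" for i j i' j'
  proof -
    have "l ! j \<le> l ! j'"
      using that l(1) by (cases "j = j'") (auto simp: l(2) diagram_of_def sorted_wrt_iff_nth_less)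
    then show ?thesis using that by (auto simp: l(2) diagram_of_def)
  qed
  ultimately show "finite d \<and> (\<forall>i j i' j'. (i, j) \<in> d \<longrightarrow> i' \<le> i \<longrightarrow> j' \<le> j \<longrightarrow> (i', j') \<in> d)"
    by blast
next
  assume *: "finite d \<and> (\<forall>i j i' j'. (i, j) \<in> d \<longrightarrow> i' \<le> i \<longrightarrow> j' \<le> j \<longrightarrow> (i', j') \<in> d)"
  then have dc: "(i', j') \<in> d" if "(i, j) \<in> d" "i' \<le> i" "j' \<le> j" for i j i' j'
    using that by blast
  define r where "r j = card {i. (i, j) \<in> d}" for j
  define m where "m = card {j. (0, j) \<in> d}"
  have fin: "finite {i. (i, j) \<in> d}" for j
    using conjunct1[OF *] by (rule finite_subset[of _ "fst ` d", rotated, OF finite_imageI]) force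
  have "finite {j. (0, j) \<in> d}"
    using conjunct1[OF *] by (rule finite_subset[of _ "snd ` d", rotated, OF finite_imageI]) force
  then have m: "{j. (0, j) \<in> d} = {..<m}"
    unfolding m_def by (rule down_closed_nat_eq) (simp, rule dc, auto)
  have r: "{i. (i, j) \<in> d} = {..<r j}" for j
    unfolding r_def using fin by (rule down_closed_nat_eq) (simp, rule dc, auto)
  have rd: "(i, j) \<in> d \<longleftrightarrow> i < r j" for i j
    using arg_cong[OF r[of j], of "\<lambda>A. i \<in> A"] by simp
  have md: "0 < r j \<longleftrightarrow> j < m" for j
    using arg_cong[OF m, of "\<lambda>A. j \<in> A"] by (simp add: rd)
  have anti: "r j \<le> r j'" if "j' \<le> j" for j j'
    unfolding r_def using fin that dc[OF _ order_refl that] by (intro card_mono) auto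
  have "d = diagram_of (map r [0..<m])"
  proof (intro set_eqI, clarify)
    fix i j
    show "(i, j) \<in> d \<longleftrightarrow> (i, j) \<in> diagram_of (map r [0..<m])"
      using md[of j] by (cases "j < m") (auto simp: diagram_of_def rd)
  qed
  moreover have "sorted_wrt (\<ge>) (map r [0..<m])"
    by (auto simp: sorted_wrt_iff_nth_less intro: anti)
  moreover have "0 \<notin> set (map r [0..<m])"
    using md by (auto simp: image_iff)
  ultimately show "young_diagram d"
    unfolding young_diagram_def by blast
qed

lemma young_diagramD:
  assumes "young_diagram d"
  shows "finite d" "(i, j) \<in> d \<Longrightarrow> i' \<le> i \<Longrightarrow> j' \<le> j \<Longrightarrow> (i', j') \<in> d"
  using assms by (auto simp: young_diagram_iff)

lemma young_diagram_Int: "young_diagram d \<Longrightarrow> young_diagram e \<Longrightarrow> young_diagram (d \<inter> e)"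
  unfolding young_diagram_iff by blast

lemma young_diagram_Un: "young_diagram d \<Longrightarrow> young_diagram e \<Longrightarrow> young_diagram (d \<union> e)"
  unfolding young_diagram_iff by blast

lemma add_box_card: "d \<hookrightarrow> e \<Longrightarrow> card e = Suc (card d)"
  by (auto simp: add_box_def young_diagram_iff)

text \<open>A box can be added in the first row and below every row with a removable box.\<close>

lemma card_add_box:
  assumes d: "young_diagram d"
  shows "finite {e. d \<hookrightarrow> e}" "finite {c. c \<hookrightarrow> d}" "card {e. d \<hookrightarrow> e} = Suc (card {c. c \<hookrightarrow> d})"
proof -
  define r where "r j = card {i. (i, j) \<in> d}" for j
  have fin: "finite {i. (i, j) \<in> d}" for j
    using young_diagramD(1)[OF d]
    by (rule finite_subset[of _ "fst ` d", rotated, OF finite_imageI]) force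
  have r: "{i. (i, j) \<in> d} = {..<r j}" for j
    unfolding r_def using fin
    by (rule down_closed_nat_eq) (simp, rule young_diagramD(2)[OF d], auto)
  have rd: "(i, j) \<in> d \<longleftrightarrow> i < r j" for i j
    using arg_cong[OF r[of j], of "\<lambda>A. i \<in> A"] by simp
  have anti: "r j \<le> r j'" if "j' \<le> j" for j j'
    unfolding r_def using fin that
    young_diagramD(2)[OF d _ order_refl that]
    by (intro card_mono) auto
  define R where "R = {j. r (Suc j) < r j}"
  define A where "A = insert 0 (Suc ` R)"
  have "R \<subseteq> snd ` d"
  proof
    fix j assume "j \<in> R"
    then have "(0, j) \<in> d" by (auto simp: R_def rd)
    then show "j \<in> snd ` d" by force
  qed
  then have finR: "finite R" using young_diagramD(1)[OF d] by (blast intro: finite_subset)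
  have U: "{e. d \<hookrightarrow> e} = (\<lambda>j. insert (r j, j) d) ` A"
  proof (intro equalityI subsetI)
    fix e assume "e \<in> {e. d \<hookrightarrow> e}"
    then obtain i j where e: "young_diagram e" "(i, j) \<notin> d" "e = insert (i, j) d"
      by (auto simp: add_box_def)
    have "i = r j"
    proof (rule ccontr)
      assume "i \<noteq> r j"
      then have "r j < i" using e(2) rd by auto
      then have "(r j, j) \<in> e" using young_diagramD(2)[OF e(1), of i j "r j" j] e(3) by auto
      then show False using \<open>r j < i\<close> by (auto simp: e(3) rd)
    qed
    moreover have "j \<in> A"
    proof (cases j)
      case (Suc k)
      have "(r j, k) \<in> e" using young_diagramD(2)[OF e(1), of i j "r j" k] e(3) \<open>i = r j\<close> Suc by auto
      then show ?thesis by (auto simp: e(3) rd A_def R_def Suc)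
    qed (simp add: A_def)
    ultimately show "e \<in> (\<lambda>j. insert (r j, j) d) ` A" using e(3) by blast
  next
    fix e assume "e \<in> (\<lambda>j. insert (r j, j) d) ` A"
    then obtain j where j: "j \<in> A" "e = insert (r j, j) d" by blast
    have lt: "r j < r k" if "k < j" for k
    proof (cases j)
      case (Suc l)
      then have "r j < r l" using j(1) by (auto simp: A_def R_def)
      also have "r l \<le> r k" using that Suc by (intro anti) auto
      finally show ?thesis .
    qed (use that in auto)
    have "young_diagram e"
      unfolding young_diagram_iff
    proof (intro conjI allI impI)
      show "finite e" using young_diagramD(1)[OF d] j by simp
      fix a b a' b' assume *: "(a, b) \<in> e" "a' \<le> a" "b' \<le> b"
      show "(a', b') \<in> e"
      proof (cases "(a, b) \<in> d")
        case True then show ?thesis using young_diagramD(2)[OF d True *(2,3)] j by simp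
      next
        case False
        then have "a = r j" "b = j" using * j by auto
        then show ?thesis using * lt[of b'] by (cases "b' = j") (auto simp: j(2) rd)
      qed
    qed
    then show "e \<in> {e. d \<hookrightarrow> e}" using d j by (auto simp: add_box_def rd)
  qed
  have D: "{c. c \<hookrightarrow> d} = (\<lambda>j. d - {(r j - 1, j)}) ` R"
  proof (intro equalityI subsetI)
    fix c assume "c \<in> {c. c \<hookrightarrow> d}"
    then obtain i j where c: "young_diagram c" "(i, j) \<notin> c" "d = insert (i, j) c"
      by (auto simp: add_box_def)
    have 1: "i < r j" using c(3) rd by auto
    have "\<not> (k, l) \<in> c" if "i \<le> k" "j \<le> l" for k l
      using young_diagramD(2)[OF c(1), of k l i j] c(2) that by auto
    then have 2: "(k, l) \<in> d \<longleftrightarrow> k = i \<and> l = j" if "i \<le> k" "j \<le> l" for k l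
      using c(3) that by auto
    have "\<not> Suc i < r j" "\<not> i < r (Suc j)"
      using 2[of "Suc i" j] 2[of i "Suc j"] by (auto simp: rd)
    then have "i = r j - 1" "j \<in> R" using 1 by (auto simp: R_def)
    then show "c \<in> (\<lambda>j. d - {(r j - 1, j)}) ` R" using c by auto
  next
    fix c assume "c \<in> (\<lambda>j. d - {(r j - 1, j)}) ` R"
    then obtain j where j: "r (Suc j) < r j" "c = d - {(r j - 1, j)}" by (auto simp: R_def)
    have "young_diagram c"
      unfolding young_diagram_iff
    proof (intro conjI allI impI)
      show "finite c" using young_diagramD(1)[OF d] j by simp
      fix a b a' b' assume *: "(a, b) \<in> c" "a' \<le> a" "b' \<le> b"
      then have "(a', b') \<in> d" using young_diagramD(2)[OF d, of a b a' b'] j by auto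
      moreover have "(a', b') \<noteq> (r j - 1, j)"
      proof
        assume eq: "(a', b') = (r j - 1, j)"
        have "a < r b" "(a, b) \<noteq> (r j - 1, j)" using * j by (auto simp: rd)
        show False
        proof (cases "b = j")
          case False
          then have "r b \<le> r (Suc j)" using eq * by (intro anti) auto
          then show False using j(1) eq * \<open>a < r b\<close> by auto
        qed (use eq * \<open>a < r b\<close> \<open>(a, b) \<noteq> (r j - 1, j)\<close> in auto)
      qed
      ultimately show "(a', b') \<in> c" using j by auto
    qed
    moreover have "(r j - 1, j) \<in> d" using j by (auto simp: rd)
    ultimately show "c \<in> {c. c \<hookrightarrow> d}" using d j by (auto simp: add_box_def)
  qed
  have injU: "inj_on (\<lambda>j. insert (r j, j) d) A"
  proof (rule inj_onI)
    fix j k assume "insert (r j, j) d = insert (r k, k) d"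
    moreover have "(r j, j) \<notin> d" "(r k, k) \<notin> d" by (auto simp: rd)
    ultimately show "j = k" by blast
  qed
  have injD: "inj_on (\<lambda>j. d - {(r j - 1, j)}) R"
  proof (rule inj_onI)
    fix j k assume "j \<in> R" "k \<in> R" "d - {(r j - 1, j)} = d - {(r k - 1, k)}"
    moreover have "(r j - 1, j) \<in> d" "(r k - 1, k) \<in> d"
      using \<open>j \<in> R\<close> \<open>k \<in> R\<close> by (auto simp: rd R_def)
    ultimately show "j = k" by blast
  qed
  show "finite {e. d \<hookrightarrow> e}" "finite {c. c \<hookrightarrow> d}"
    unfolding U D using finR by (auto simp: A_def)
  show "card {e. d \<hookrightarrow> e} = Suc (card {c. c \<hookrightarrow> d})"
    unfolding U D card_image[OF injU] card_image[OF injD]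
    using finR by (auto simp: A_def card_image)
qed

lemma finite_standard_tableaux: "finite d \<Longrightarrow> finite (standard_tableaux d)"
  by (rule finite_subset[of _ "d \<rightarrow>\<^sub>E {1..card d}"])
     (auto simp: standard_tableaux_def bij_betw_def extensional_def intro: finite_PiE)

lemma num_syt_empty: "num_syt {} = 1"
proof -
  have "standard_tableaux {} = {\<lambda>_. undefined}"
    by (auto simp: standard_tableaux_def bij_betw_def)
  then show ?thesis by (simp add: num_syt_def)
qed

lemma num_syt_rec:
  assumes d: "young_diagram d" "d \<noteq> {}"
  shows "num_syt d = (\<Sum>c | c \<hookrightarrow> d. num_syt c)"
proof -
  let ?n = "card d"
  note fin = young_diagramD(1)[OF d(1)]
  have n: "?n > 0" using fin d by auto
  have "bij_betw (\<lambda>(c, t) b. if b \<in> d - c then ?n else t b)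
          (SIGMA c:{c. c \<hookrightarrow> d}. standard_tableaux c) (standard_tableaux d)"
  proof (rule bij_betw_byWitness[where f' = "\<lambda>t. ({b \<in> d. t b < ?n}, restrict t {b \<in> d. t b < ?n})"],
         goal_cases)
    case 1
    show ?case
    proof
      fix p assume "p \<in> (SIGMA c:{c. c \<hookrightarrow> d}. standard_tableaux c)"
      then obtain c t where 1: "p = (c, t)" "c \<hookrightarrow> d" "t \<in> standard_tableaux c" by auto
      then have t: "bij_betw t c {1..card c}" "t \<in> extensional c" "c \<subseteq> d"
        by (auto simp: standard_tableaux_def add_box_def)
      have "t b < ?n" if "b \<in> c" for b
        using bij_betwE[OF t(1)] that add_box_card[of c d] 1 by fastforce
      then have *: "{b \<in> d. (if b \<in> d - c then ?n else t b) < ?n} = c"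
        using t(3) by auto
      moreover have "restrict (\<lambda>b. if b \<in> d - c then ?n else t b) c = t"
        using t(2) by (auto simp: restrict_def extensional_def fun_eq_iff)
      ultimately show "(\<lambda>t. ({b \<in> d. t b < ?n}, restrict t {b \<in> d. t b < ?n}))
          (case p of (c, t) \<Rightarrow> \<lambda>b. if b \<in> d - c then ?n else t b) = p"
        by (simp add: 1(1))
    qed
  next
    case 2
    show ?case
    proof (clarify, goal_cases)
      case (1 t)
      then have "bij_betw t d {1..?n}" "t \<in> extensional d"
        by (auto simp: standard_tableaux_def)
      moreover have "t b \<le> ?n" if "b \<in> d" for b using bij_betwE[OF \<open>bij_betw t d {1..?n}\<close>] that by auto
      ultimately show ?case by (auto simp: fun_eq_iff extensional_def not_less intro: antisym)
    qed
  next
    case 3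
    show ?case
    proof (rule image_subsetI)
      fix p assume "p \<in> (SIGMA c:{c. c \<hookrightarrow> d}. standard_tableaux c)"
      then obtain c t where 1: "p = (c, t)" "c \<hookrightarrow> d" "t \<in> standard_tableaux c" by auto
      then obtain b where b: "b \<notin> c" "d = insert b c" and c: "young_diagram c"
        by (auto simp: add_box_def)
      have t: "bij_betw t c {1..card c}" "t \<in> extensional c" 
          "\<And>i j. (Suc i, j) \<in> c \<Longrightarrow> t (i, j) < t (Suc i, j)"
          "\<And>i j. (i, Suc j) \<in> c \<Longrightarrow> t (i, j) < t (i, Suc j)"
        using 1 by (auto simp: standard_tableaux_def)
      have card: "?n = Suc (card c)" using 1 add_box_card by simp
      let ?t = "\<lambda>b. if b \<in> d - c then ?n else t b"
      have eq: "?t = t(b := ?n)" using b by (auto simp: fun_eq_iff)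
      have "bij_betw ?t c {1..card c}"
        using t(1) by (subst bij_betw_cong[of c ?t t]) (auto)
      then have "bij_betw ?t (c \<union> {b}) ({1..card c} \<union> {?n})"
        by (rule bij_betw_combine) (use b card in \<open>auto simp: bij_betw_def\<close>)
      moreover have "c \<union> {b} = d" "{1..card c} \<union> {?n} = {1..?n}" using b card by auto
      ultimately have bij: "bij_betw ?t d {1..?n}" by simp
      have lt: "?t x < ?n" if "x \<in> c" for x
        using bij_betwE[OF t(1)] that card by fastforce
      have "?t (i, j) < ?t (Suc i, j)" if *: "(Suc i, j) \<in> d" for i j
      proof (cases "(Suc i, j) \<in> c")
        case True
        then show ?thesis using young_diagramD(2)[OF c True, of i j] t(3) by auto
      next
        case False
        then have "b = (Suc i, j)" using * b by auto
        then have "(i, j) \<in> c" using young_diagramD(2)[OF d(1) *, of i j] b by auto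
        then show ?thesis using lt False * by auto
      qed
      moreover have "?t (i, j) < ?t (i, Suc j)" if *: "(i, Suc j) \<in> d" for i j
      proof (cases "(i, Suc j) \<in> c")
        case True
        then show ?thesis using young_diagramD(2)[OF c True, of i j] t(4) by auto
      next
        case False
        then have "b = (i, Suc j)" using * b by auto
        then have "(i, j) \<in> c" using young_diagramD(2)[OF d(1) *, of i j] b by auto
        then show ?thesis using lt False * by auto
      qed
      moreover have "?t \<in> extensional d" using t(2) b by (auto simp: extensional_def)
      ultimately show "(case p of (c, t) \<Rightarrow> \<lambda>b. if b \<in> d - c then ?n else t b) \<in> standard_tableaux d"
        using bij 1(1) by (simp add: standard_tableaux_def)
    qed
  next
    case 4
    show ?case
    proof (rule image_subsetI)
      fix t assume "t \<in> standard_tableaux d"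
      then have t: "bij_betw t d {1..?n}" 
          "\<And>i j. (Suc i, j) \<in> d \<Longrightarrow> t (i, j) < t (Suc i, j)"
          "\<And>i j. (i, Suc j) \<in> d \<Longrightarrow> t (i, j) < t (i, Suc j)"
        by (auto simp: standard_tableaux_def)
      let ?c = "{b \<in> d. t b < ?n}"
      obtain b where b: "b \<in> d" "t b = ?n" 
        using t(1) n bij_betw_imp_surj_on[OF t(1)] by (metis atLeastAtMost_iff imageE less_eq_Suc_le One_nat_def order_refl)
      have le: "t x \<le> ?n" if "x \<in> d" for x using bij_betwE[OF t(1)] that by auto
      have c: "?c = d - {b}"
      proof -
        have "t x < ?n" if "x \<in> d" "x \<noteq> b" for x
          using le[OF that(1)] that b inj_onD[OF bij_betw_imp_inj_on[OF t(1)], of x b]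
          by (metis le_neq_implies_less)
        then show ?thesis using b by auto
      qed
      have mono1: "t (i', j) \<le> t (i, j)" if "(i, j) \<in> d" "i' \<le> i" for i i' j
        using that(2,1)
      proof (induction rule: dec_induct)
        case (step k)
        then show ?case using t(2)[of k j] young_diagramD(2)[OF d(1), of "Suc k" j k j] by fastforce
      qed simp
      have mono2: "t (i, j') \<le> t (i, j)" if "(i, j) \<in> d" "j' \<le> j" for i j j'
        using that(2,1)
      proof (induction rule: dec_induct)
        case (step k)
        then show ?case using t(3)[of i k] young_diagramD(2)[OF d(1), of i "Suc k" i k] by fastforce
      qed simp
      have mono: "t (i', j') \<le> t (i, j)" if "(i, j) \<in> d" "i' \<le> i" "j' \<le> j" for i j i' j'
        using mono2[OF young_diagramD(2)[OF d(1) that(1,2) order_refl] that(3)] mono1[OF that(1,2)]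
        by (rule order_trans)
      have yc: "young_diagram ?c"
        unfolding young_diagram_iff
      proof (intro conjI allI impI)
        fix i j i' j' assume *: "(i, j) \<in> ?c" "i' \<le> i" "j' \<le> j"
        then have "(i, j) \<in> d" "t (i, j) < ?n" by auto
        then show "(i', j') \<in> ?c"
          using young_diagramD(2)[OF d(1) _ *(2,3)] mono[OF _ *(2,3)] by (auto intro: le_less_trans)
      qed (use fin in auto)
      then have "?c \<hookrightarrow> d"
        unfolding add_box_def using d(1) b c by (intro conjI exI[of _ b]) auto
      moreover have "bij_betw t (d - {b}) ({1..?n} - {t b})"
        using t(1) b Suc_leI[OF n] by (intro bij_betw_DiffI) (auto simp: bij_betw_def)
      then have "bij_betw t ?c {1..card ?c}"
        unfolding c using b n fin Suc_leI[OF n] by (auto simp: bij_betw_def card_Diff_singleton)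
      then have "bij_betw (restrict t ?c) ?c {1..card ?c}"
        by (subst bij_betw_cong[of _ _ t]) auto
      moreover have "restrict t ?c (i, j) < restrict t ?c (Suc i, j)" if "(Suc i, j) \<in> ?c" for i j
        using young_diagramD(2)[OF yc that, of i j] t(2) that by auto
      moreover have "restrict t ?c (i, j) < restrict t ?c (i, Suc j)" if "(i, Suc j) \<in> ?c" for i j
        using young_diagramD(2)[OF yc that, of i j] t(3) that by auto
      ultimately show "({b \<in> d. t b < ?n}, restrict t {b \<in> d. t b < ?n}) \<in>
          (SIGMA c:{c. c \<hookrightarrow> d}. standard_tableaux c)"
        by (auto simp: standard_tableaux_def)
    qed
  qed
  then have "card (SIGMA c:{c. c \<hookrightarrow> d}. standard_tableaux c) = num_syt d"
    unfolding num_syt_def by (rule bij_betw_same_card)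
  moreover have "card (SIGMA c:{c. c \<hookrightarrow> d}. standard_tableaux c) = (\<Sum>c | c \<hookrightarrow> d. num_syt c)"
    unfolding num_syt_def
    by (intro card_SigmaI ballI card_add_box d finite_standard_tableaux)
       (auto simp: add_box_def young_diagram_iff)
  ultimately show ?thesis by simp
qed

lemma ex_remove_box:
  assumes "young_diagram d" "d \<noteq> {}"
  shows "\<exists>c. c \<hookrightarrow> d"
proof -
  note fin = young_diagramD(1)[OF assms(1)]
  define m where "m = Max ((\<lambda>(i, j). i + j) ` d)"
  have "m \<in> (\<lambda>(i, j). i + j) ` d" unfolding m_def using fin assms(2) by (intro Max_in) auto
  then obtain i j where ij: "(i, j) \<in> d" "i + j = m" by auto
  have le: "k + l \<le> m" if "(k, l) \<in> d" for k l
    unfolding m_def using fin that by (intro Max_ge) (auto simp: image_iff intro!: bexI[of _ "(k, l)"])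
  have "young_diagram (d - {(i, j)})"
    unfolding young_diagram_iff
  proof (intro conjI allI impI)
    fix a b a' b' assume *: "(a, b) \<in> d - {(i, j)}" "a' \<le> a" "b' \<le> b"
    then show "(a', b') \<in> d - {(i, j)}"
      using young_diagramD(2)[OF assms(1), of a b a' b'] le[of a b] ij by auto
  qed (use fin in auto)
  then have "(d - {(i, j)}) \<hookrightarrow> d" unfolding add_box_def using assms ij by auto
  then show ?thesis ..
qed

lemma num_syt_pos: "young_diagram d \<Longrightarrow> num_syt d > 0"
proof (induction "card d" arbitrary: d)
  case 0
  then have "d = {}" by (auto simp: young_diagram_iff)
  then show ?case by (simp add: num_syt_empty)
next
  case (Suc n)
  then have ne: "d \<noteq> {}" by auto
  then obtain c where c: "c \<hookrightarrow> d" using ex_remove_box Suc by blast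
  then have "num_syt c > 0"
    using Suc.hyps(1)[of c] Suc.hyps(2) add_box_card[OF c] by (simp add: add_box_def)
  also have "num_syt c \<le> (\<Sum>c | c \<hookrightarrow> d. num_syt c)"
    using c card_add_box[OF Suc(3)] by (intro member_le_sum) auto
  finally show ?case unfolding num_syt_rec[OF Suc(3) ne] .
qed

lemma add_boxI:
  "young_diagram d \<Longrightarrow> young_diagram e \<Longrightarrow> b \<notin> d \<Longrightarrow> e = insert b d \<Longrightarrow> d \<hookrightarrow> e"
  by (auto simp only: add_box_def)

lemma add_box_add_box:
  assumes "d \<hookrightarrow> e" "c \<hookrightarrow> e" "c \<noteq> d"
  shows "d \<union> c = e" "d \<inter> c \<hookrightarrow> d" "d \<inter> c \<hookrightarrow> c"
proof -
  obtain x y where x: "x \<notin> d" "e = insert x d" and y: "y \<notin> c" "e = insert y c"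
    and young: "young_diagram d" "young_diagram c"
    using assms by (auto simp: add_box_def)
  have "x \<noteq> y" using x y assms(3) by (metis Diff_insert_absorb)
  then have *: "y \<in> d" "x \<in> c" using x(2) y(2) by (metis insertE insertI1)+
  have "d \<subseteq> insert y c" "c \<subseteq> insert x d" using x(2) y(2) by (metis subset_insertI)+
  then have eq: "d = insert y (d \<inter> c)" "c = insert x (d \<inter> c)" using * by auto
  show "d \<inter> c \<hookrightarrow> d"
    by (rule add_boxI[OF young_diagram_Int[OF young] young(1) _ eq(1)]) (simp add: y(1))
  show "d \<inter> c \<hookrightarrow> c"
    by (rule add_boxI[OF young_diagram_Int[OF young] young(2) _ eq(2)]) (simp add: x(1))
  show "d \<union> c = e" unfolding x(2) using *(2) \<open>c \<subseteq> insert x d\<close> by auto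
qed

lemma remove_box_remove_box:
  assumes "g \<hookrightarrow> d" "g \<hookrightarrow> c" "c \<noteq> d"
  shows "d \<inter> c = g" "d \<hookrightarrow> d \<union> c" "c \<hookrightarrow> d \<union> c"
proof -
  obtain x y where x: "x \<notin> g" "d = insert x g" and y: "y \<notin> g" "c = insert y g"
    and young: "young_diagram d" "young_diagram c"
    using assms by (auto simp: add_box_def)
  have "x \<noteq> y" using x y assms(3) by blast
  then have *: "y \<notin> d" "x \<notin> c" unfolding x(2) y(2) using x(1) y(1) by auto
  have eq: "d \<union> c = insert y d" "d \<union> c = insert x c" unfolding x(2) y(2) by auto
  show "d \<hookrightarrow> d \<union> c" by (rule add_boxI[OF young(1) young_diagram_Un[OF young] *(1) eq(1)])
  show "c \<hookrightarrow> d \<union> c" by (rule add_boxI[OF young(2) young_diagram_Un[OF young] *(2) eq(2)])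
  show "d \<inter> c = g" unfolding x(2) y(2) using x(1) y(1) \<open>x \<noteq> y\<close> by auto
qed

lemma sum_num_syt:
  assumes "young_diagram d"
  shows "(\<Sum>e | d \<hookrightarrow> e. num_syt e) = (card d + 1) * num_syt d"
  using assms
proof (induction "card d" arbitrary: d rule: less_induct)
  case less
  note d = less.prems and fin = card_add_box[OF less.prems]
  have y: "young_diagram a" "young_diagram b" if "a \<hookrightarrow> b" for a b
    using that by (auto simp: add_box_def)
  let ?X = "SIGMA e:{e. d \<hookrightarrow> e}. {c. c \<hookrightarrow> e} - {d}"
  let ?Y = "SIGMA g:{g. g \<hookrightarrow> d}. {c. g \<hookrightarrow> c} - {d}"
  have bij: "bij_betw (\<lambda>(e, c). (d \<inter> c, c)) ?X ?Y"
  proof (rule bij_betw_byWitness[where f' = "\<lambda>(g, c). (d \<union> c, c)"])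
    have X: "\<exists>e c. p = (e, c) \<and> d \<hookrightarrow> e \<and> c \<hookrightarrow> e \<and> c \<noteq> d" if "p \<in> ?X" for p
      using that by auto
    have Y: "\<exists>g c. p = (g, c) \<and> g \<hookrightarrow> d \<and> g \<hookrightarrow> c \<and> c \<noteq> d" if "p \<in> ?Y" for p
      using that by auto
    show "\<forall>p\<in>?X. (case case p of (e, c) \<Rightarrow> (d \<inter> c, c) of (g, c) \<Rightarrow> (d \<union> c, c)) = p"
      by (auto dest!: X simp: add_box_add_box(1) simp del: mem_Sigma_iff)
    show "\<forall>p\<in>?Y. (case case p of (g, c) \<Rightarrow> (d \<union> c, c) of (e, c) \<Rightarrow> (d \<inter> c, c)) = p"
      by (auto dest!: Y simp: remove_box_remove_box(1) simp del: mem_Sigma_iff)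
    show "(\<lambda>(e, c). (d \<inter> c, c)) ` ?X \<subseteq> ?Y"
    proof (rule image_subsetI)
      fix p assume "p \<in> ?X"
      then obtain e c where "p = (e, c)" "d \<hookrightarrow> e" "c \<hookrightarrow> e" "c \<noteq> d" using X by blast
      then show "(case p of (e, c) \<Rightarrow> (d \<inter> c, c)) \<in> ?Y" using add_box_add_box[of d e c] by simp
    qed
    show "(\<lambda>(g, c). (d \<union> c, c)) ` ?Y \<subseteq> ?X"
    proof (rule image_subsetI)
      fix p assume "p \<in> ?Y"
      then obtain g c where "p = (g, c)" "g \<hookrightarrow> d" "g \<hookrightarrow> c" "c \<noteq> d" using Y by blast
      then show "(case p of (g, c) \<Rightarrow> (d \<union> c, c)) \<in> ?X"
        using remove_box_remove_box[of g d c] by simp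
    qed
  qed
  have "(\<Sum>e | d \<hookrightarrow> e. num_syt e) = (\<Sum>e | d \<hookrightarrow> e. num_syt d + (\<Sum>c\<in>{c. c \<hookrightarrow> e} - {d}. num_syt c))"
  proof (intro sum.cong refl)
    fix e assume "e \<in> {e. d \<hookrightarrow> e}"
    then have e: "d \<hookrightarrow> e" "young_diagram e" "e \<noteq> {}" by (auto simp: add_box_def)
    show "num_syt e = num_syt d + (\<Sum>c\<in>{c. c \<hookrightarrow> e} - {d}. num_syt c)"
      unfolding num_syt_rec[OF e(2,3)] using card_add_box[OF e(2)] e(1) by (subst sum.remove) auto
  qed
  also have "\<dots> = card {e. d \<hookrightarrow> e} * num_syt d + (\<Sum>(e, c)\<in>?X. num_syt c)"
    unfolding sum.distrib using fin card_add_box(2) y(2) by (subst sum.Sigma) auto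
  also have "(\<Sum>(e, c)\<in>?X. num_syt c) = (\<Sum>(g, c)\<in>?Y. num_syt c)"
    using sum.reindex_bij_betw[OF bij, of "\<lambda>(g, c). num_syt c"] by (simp add: case_prod_unfold)
  also have "\<dots> = (\<Sum>g | g \<hookrightarrow> d. \<Sum>c\<in>{c. g \<hookrightarrow> c} - {d}. num_syt c)"
    using fin card_add_box(1) y(1) by (subst sum.Sigma) auto
  finally have 1: "(\<Sum>e | d \<hookrightarrow> e. num_syt e) =
    card {e. d \<hookrightarrow> e} * num_syt d + (\<Sum>g | g \<hookrightarrow> d. \<Sum>c\<in>{c. g \<hookrightarrow> c} - {d}. num_syt c)" .
  have "(\<Sum>g | g \<hookrightarrow> d. \<Sum>c\<in>{c. g \<hookrightarrow> c} - {d}. num_syt c) + card {c. c \<hookrightarrow> d} * num_syt d =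
    (\<Sum>g | g \<hookrightarrow> d. num_syt d + (\<Sum>c\<in>{c. g \<hookrightarrow> c} - {d}. num_syt c))"
    by (simp add: sum.distrib)
  also have "\<dots> = (\<Sum>g | g \<hookrightarrow> d. card d * num_syt g)"
  proof (intro sum.cong refl)
    fix g assume "g \<in> {g. g \<hookrightarrow> d}"
    then have g: "g \<hookrightarrow> d" "young_diagram g" by (auto simp: y)
    have "num_syt d + (\<Sum>c\<in>{c. g \<hookrightarrow> c} - {d}. num_syt c) = (\<Sum>c | g \<hookrightarrow> c. num_syt c)"
      using card_add_box[OF g(2)] g(1) by (subst sum.remove[of _ d]) auto
    also have "\<dots> = card d * num_syt g"
      using less.hyps[of g] g add_box_card[OF g(1)] by simp
    finally show "num_syt d + (\<Sum>c\<in>{c. g \<hookrightarrow> c} - {d}. num_syt c) = card d * num_syt g" .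
  qed
  also have "\<dots> = card d * num_syt d"
  proof (cases "d = {}")
    case False
    then show ?thesis by (simp only: num_syt_rec[OF d False] sum_distrib_left)
  qed (auto simp: add_box_def)
  finally have 2: "(\<Sum>g | g \<hookrightarrow> d. \<Sum>c\<in>{c. g \<hookrightarrow> c} - {d}. num_syt c) +
    card {c. c \<hookrightarrow> d} * num_syt d = card d * num_syt d" .
  have "s = (k + 1) * f" if "s = u * f + r" "u = Suc v" "r + v * f = k * f" for s u f r v k :: nat
  proof -
    have "s = f + (r + v * f)" by (simp add: that(1,2))
    then show ?thesis by (simp only: that(3) mult_Suc Suc_eq_plus1[symmetric])
  qed
  from this[OF 1 fin(3) 2] show ?case .
qed

definition infinite_tableaux :: "tableau set" where
  "infinite_tableaux = {t. bij_betw t UNIV {1..} \<and>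
     (\<forall>i j. t (i, j) < t (Suc i, j) \<and> t (i, j) < t (i, Suc j))}"

text \<open>As a measure space this carries the zero measure; only its \<open>\<sigma>\<close>-algebra is used.\<close>

definition tableau_algebra :: "tableau measure" where
  "tableau_algebra = sigma infinite_tableaux
     {{t \<in> infinite_tableaux. t b \<in> A} | b A. True}"

definition complete_paths :: "(nat \<Rightarrow> diagram) set" where
  "complete_paths = {d. d 0 = {} \<and> (\<forall>n. d n \<hookrightarrow> d (Suc n)) \<and> (\<forall>b. \<exists>n. b \<in> d n)}"

text \<open>Only meaningful on \<^const>\<open>complete_paths\<close>, where \<open>d n = {b. recording_tableau d b \<le> n}\<close>.\<close>

definition recording_tableau :: "(nat \<Rightarrow> diagram) \<Rightarrow> tableau" where
  "recording_tableau d = (\<lambda>b. LEAST n. b \<in> d n)"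

section \<open>The Plancherel growth process and the Plancherel measure\<close>

definition plancherel_transition :: "diagram \<Rightarrow> diagram \<Rightarrow> real" where
  "plancherel_transition d e =
     (if d \<hookrightarrow> e then num_syt e / ((card d + 1) * num_syt d) else 0)"

definition plancherel_step :: "diagram \<Rightarrow> diagram pmf" where
  "plancherel_step d = embed_pmf (plancherel_transition d)"

lemma pmf_plancherel_step:
  assumes "young_diagram d"
  shows "pmf (plancherel_step d) e = plancherel_transition d e"
  unfolding plancherel_step_def
proof (rule pmf_embed_pmf)
  show "plancherel_transition d e \<ge> 0" for e
    by (simp add: plancherel_transition_def)
  note fin = card_add_box(1)[OF assms]
  have "(\<integral>\<^sup>+e. ennreal (plancherel_transition d e) \<partial>count_space UNIV) =
      (\<Sum>e | d \<hookrightarrow> e. ennreal (plancherel_transition d e))"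
    using fin by (intro nn_integral_count_space') (auto simp: plancherel_transition_def)
  also have "\<dots> = ennreal (\<Sum>e | d \<hookrightarrow> e. plancherel_transition d e)"
    by (intro sum_ennreal) (auto simp: plancherel_transition_def)
  also have "(\<Sum>e | d \<hookrightarrow> e. plancherel_transition d e) =
      (\<Sum>e | d \<hookrightarrow> e. real (num_syt e)) / ((card d + 1) * num_syt d)"
    by (simp add: plancherel_transition_def sum_divide_distrib)
  also have "(\<Sum>e | d \<hookrightarrow> e. real (num_syt e)) = (card d + 1) * num_syt d"
    using sum_num_syt[OF assms] by (metis of_nat_sum)
  also have "real ((card d + 1) * num_syt d) / real ((card d + 1) * num_syt d) = 1"
    using num_syt_pos[OF assms] by (intro divide_self) (simp del: of_nat_mult of_nat_add)
  finally show "(\<integral>\<^sup>+e. ennreal (plancherel_transition d e) \<partial>count_space UNIV) = 1"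
    by simp
qed


definition plancherel_kernel :: "nat \<Rightarrow> (nat \<Rightarrow> diagram) \<Rightarrow> diagram measure" where
  "plancherel_kernel n d = measure_pmf
     (case n of 0 \<Rightarrow> return_pmf {} | Suc m \<Rightarrow> plancherel_step (d m))"

global_interpretation plancherel: Ionescu_Tulcea plancherel_kernel "\<lambda>_. count_space UNIV"
  defines plancherel_growth = plancherel.PF.lim
proof (rule Ionescu_Tulcea.intro)
  fix n
  show "plancherel_kernel n \<in> (\<Pi>\<^sub>M i\<in>{0..<n}. count_space UNIV) \<rightarrow>\<^sub>M subprob_algebra (count_space UNIV)"
  proof (cases n)
    case 0
    then show ?thesis
      by (auto simp: plancherel_kernel_def[abs_def] space_subprob_algebra
          intro!: measurable_const prob_space_imp_subprob_space prob_space_measure_pmf)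
  next
    case (Suc m)
    have "(\<lambda>d. d m) \<in> (\<Pi>\<^sub>M i\<in>{0..<n}. count_space UNIV) \<rightarrow>\<^sub>M count_space (UNIV :: diagram set)"
      using Suc by (intro measurable_component_singleton) auto
    moreover have "(\<lambda>e. measure_pmf (plancherel_step e)) \<in>
        count_space UNIV \<rightarrow>\<^sub>M subprob_algebra (count_space UNIV)"
      by (auto simp: space_subprob_algebra
          intro!: prob_space_imp_subprob_space prob_space_measure_pmf)
    ultimately show ?thesis
      using Suc by (auto simp: plancherel_kernel_def[abs_def] dest: measurable_compose)
  qed
qed (simp add: plancherel_kernel_def prob_space_measure_pmf)

lemma prob_space_plancherel_growth: "prob_space plancherel_growth"
proof
  interpret prob_space "plancherel.CI {}" by (rule plancherel.PF.prob_space_P) auto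
  have "emeasure plancherel_growth (prod_emb UNIV (\<lambda>_. count_space UNIV) {} {\<lambda>_. undefined}) = 1"
  proof -
    have "{\<lambda>_. undefined} \<in> sets (PiM {} (\<lambda>_::nat. count_space (UNIV :: diagram set)))"
      by (simp add: sets_PiM_empty)
    from plancherel.lim[OF finite.emptyI this] show ?thesis
      using emeasure_space_1 by (simp add: plancherel.PF.space_P space_PiM)
  qed
  moreover have "prod_emb UNIV (\<lambda>_. count_space UNIV) {} {\<lambda>_. undefined} =
      (UNIV :: (nat \<Rightarrow> diagram) set)"
    by (auto simp: prod_emb_def)
  ultimately show "emeasure plancherel_growth (space plancherel_growth) = 1"
    by (simp add: space_PiM)
qed

text \<open>The joint law of the first \<open>n + 1\<close> diagrams: a Markov chain with the above transitions.\<close>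

lemma plancherel_growth_cylinder:
  assumes "c 0 = {}" "\<And>i. i < n \<Longrightarrow> young_diagram (c i)"
  shows "emeasure plancherel_growth {d. \<forall>i\<le>n. d i = c i} =
    ennreal (\<Prod>i<n. plancherel_transition (c i) (c (Suc i)))"
proof -
  let ?M = "\<lambda>_::nat. count_space (UNIV :: diagram set)"
  let ?X = "\<lambda>n. {restrict c {0..<n}}"
  have X: "?X n = (\<Pi>\<^sub>E i\<in>{0..<n}. {c i})" for n
    by (auto simp: PiE_def extensional_def restrict_def fun_eq_iff Pi_iff)
  have X_sets: "?X n \<in> sets (PiM {0..<n} ?M)" for n
    unfolding X by (intro sets_PiM_I_finite) auto
  have C_Suc: "emeasure (plancherel.C 0 (Suc n) (\<lambda>_. undefined)) (?X (Suc n)) =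
      emeasure (plancherel.C 0 n (\<lambda>_. undefined)) (?X n) *
      emeasure (plancherel_kernel n (restrict c {0..<n})) {c n}" for n
  proof -
    let ?C = "plancherel.C 0 n (\<lambda>_. undefined)"
    have C: "space ?C = space (PiM {0..<n} ?M)" "sets ?C = sets (PiM {0..<n} ?M)"
      using plancherel.space_C[of "\<lambda>_. undefined" 0 n] plancherel.sets_C[of "\<lambda>_. undefined" 0 n]
      by (auto simp: space_PiM)
    have "emeasure (plancherel.C 0 (Suc n) (\<lambda>_. undefined)) (?X (Suc n)) =
        (\<integral>\<^sup>+d. emeasure (plancherel.eP n d) (?X (Suc n)) \<partial>?C)"
      using plancherel.measurable_eP[of n] X_sets[of "Suc n"]
      by (simp, subst emeasure_bind[where N="PiM {0..<Suc n} ?M"])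
         (auto simp: C space_PiM measurable_cong_sets[OF C(2) refl])
    also have "\<dots> = (\<integral>\<^sup>+d. emeasure (plancherel_kernel n (restrict c {0..<n})) {c n} *
        indicator (?X n) d \<partial>?C)"
    proof (intro nn_integral_cong)
      fix d assume "d \<in> space ?C"
      then have d: "d \<in> space (PiM {0..<n} ?M)" by (simp add: C)
      then have "d i = undefined" if "i \<ge> n" for i
        using that by (auto simp: space_PiM PiE_def extensional_def)
      then have "d(n := x) = restrict c {0..<Suc n} \<longleftrightarrow> d = restrict c {0..<n} \<and> x = c n" for x
        by (auto simp: fun_eq_iff restrict_def less_Suc_eq split: if_splits)
      then have "fun_upd d n -` ?X (Suc n) = (if d = restrict c {0..<n} then {c n} else {})"
        by auto
      then show "emeasure (plancherel.eP n d) (?X (Suc n)) =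
          emeasure (plancherel_kernel n (restrict c {0..<n})) {c n} * indicator (?X n) d"
        using plancherel.emeasure_eP[OF d X_sets] by simp
    qed
    also have "\<dots> = emeasure ?C (?X n) * emeasure (plancherel_kernel n (restrict c {0..<n})) {c n}"
      using X_sets[of n] by (subst nn_integral_cmult_indicator) (auto simp: C mult.commute)
    finally show ?thesis .
  qed
  have C: "emeasure (plancherel.C 0 (Suc n) (\<lambda>_. undefined)) (?X (Suc n)) =
      ennreal (\<Prod>i<n. plancherel_transition (c i) (c (Suc i)))"
    if "\<And>i. i < n \<Longrightarrow> young_diagram (c i)" for n
    using that
  proof (induction n)
    case 0
    show ?case
      unfolding C_Suc using X_sets[of 0]
      by (simp add: plancherel_kernel_def assms(1)) (simp add: restrict_def)
  next
    case (Suc n)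
    have "emeasure (plancherel_kernel (Suc n) (restrict c {0..<Suc n})) {c (Suc n)} =
        ennreal (plancherel_transition (c n) (c (Suc n)))"
      using Suc.prems[of n]
      by (simp add: plancherel_kernel_def emeasure_pmf_single pmf_plancherel_step)
    moreover have "emeasure (plancherel.C 0 (Suc n) (\<lambda>_. undefined)) (?X (Suc n)) =
        ennreal (\<Prod>i<n. plancherel_transition (c i) (c (Suc i)))"
      by (rule Suc.IH) (simp add: Suc.prems)
    ultimately show ?case
      unfolding C_Suc[of "Suc n"]
      by (simp only: prod.lessThan_Suc)
         (simp add: ennreal_mult'' plancherel_transition_def)
  qed
  have "{d. \<forall>i\<le>n. d i = c i} = prod_emb UNIV ?M {0..<Suc n} (?X (Suc n))"
    by (simp add: prod_emb_def fun_eq_iff restrict_def less_Suc_eq_le set_eq_iff)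
  then have "emeasure plancherel_growth {d. \<forall>i\<le>n. d i = c i} =
      emeasure (plancherel.CI {0..<Suc n}) (?X (Suc n))"
    using plancherel.lim[OF _ X_sets, of "Suc n"] by simp
  also have "\<dots> = emeasure (plancherel.C 0 (Suc n) (\<lambda>_. undefined)) (?X (Suc n))"
    using plancherel.emeasure_CI[of "{0..<Suc n}" "Suc n" "?X (Suc n)"] X_sets
    by (simp add: prod_emb_id)
  finally show ?thesis using C assms by simp
qed

text \<open>
  Almost every path is in \<^const>\<open>complete_paths\<close>, so the restriction only discards a null set
  on which the recording tableau is undefined.
\<close>

definition plancherel_measure :: "tableau measure" where
  "plancherel_measure =
     distr (restrict_space plancherel_growth complete_paths) tableau_algebra recording_tableau"

section \<open>Jeu de taquin\<close>

primrec jdt_path :: "tableau \<Rightarrow> nat \<Rightarrow> box" where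
  "jdt_path t 0 = (0, 0)"
| "jdt_path t (Suc k) = (case jdt_path t k of (i, j) \<Rightarrow>
     if t (Suc i, j) < t (i, Suc j) then (Suc i, j) else (i, Suc j))"

text \<open>The \<open>k\<close> below is unique, since \<^const>\<open>jdt_path\<close> is injective in its second argument.\<close>

definition jdt :: "tableau \<Rightarrow> tableau" where
  "jdt t b = (if \<exists>k. b = jdt_path t k
     then t (jdt_path t (Suc (THE k. b = jdt_path t k))) - 1
     else t b - 1)"

section \<open>Robinson--Schensted--Knuth\<close>

text \<open>
  Rows are increasing lists, so the first entry larger than \<open>x\<close> is the smallest such entry.
  The second component is the replaced entry, if any.
\<close>

fun row_insert :: "real \<Rightarrow> real list \<Rightarrow> real list \<times> real option" where
  "row_insert x [] = ([x], None)"
| "row_insert x (y # r) = (if x < y then (x # r, Some y)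
     else (case row_insert x r of (r', z) \<Rightarrow> (y # r', z)))"

fun rs_insert :: "real \<Rightarrow> real list list \<Rightarrow> real list list" where
  "rs_insert x [] = [[x]]"
| "rs_insert x (r # P) = (case row_insert x r of
     (r', None) \<Rightarrow> r' # P
   | (r', Some y) \<Rightarrow> r' # rs_insert y P)"

primrec insertion_tableau :: "(nat \<Rightarrow> real) \<Rightarrow> nat \<Rightarrow> real list list" where
  "insertion_tableau x 0 = []"
| "insertion_tableau x (Suc n) = rs_insert (x n) (insertion_tableau x n)"

definition rsk_shape :: "(nat \<Rightarrow> real) \<Rightarrow> nat \<Rightarrow> diagram" where
  "rsk_shape x n = diagram_of (map length (insertion_tableau x n))"

definition rsk_domain :: "(nat \<Rightarrow> real) set" where
  "rsk_domain = {x. range x \<subseteq> {0..1} \<and> inj x \<and> rsk_shape x \<in> complete_paths}"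

definition rsk :: "(nat \<Rightarrow> real) \<Rightarrow> tableau" where
  "rsk x = recording_tableau (rsk_shape x)"

section \<open>Dynamical systems\<close>

definition measure_preserving_system :: "'a measure \<Rightarrow> ('a \<Rightarrow> 'a) \<Rightarrow> bool" where
  "measure_preserving_system M T \<longleftrightarrow> prob_space M \<and> T \<in> M \<rightarrow>\<^sub>M M \<and> distr M M T = M"

text \<open>
  \<open>\<phi>\<close> is an almost everywhere defined map, with domain \<open>D\<close>; its values outside \<open>D\<close> are
  irrelevant.
\<close>

definition mps_isomorphism ::
    "'a measure \<Rightarrow> ('a \<Rightarrow> 'a) \<Rightarrow> 'b measure \<Rightarrow> ('b \<Rightarrow> 'b) \<Rightarrow> 'a set \<Rightarrow> ('a \<Rightarrow> 'b) \<Rightarrow> bool" where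
  "mps_isomorphism M S N T D \<phi> \<longleftrightarrow>
     measure_preserving_system M S \<and> measure_preserving_system N T \<and>
     D \<in> sets M \<and> (AE x in M. x \<in> D) \<and>
     \<phi> \<in> restrict_space M D \<rightarrow>\<^sub>M N \<and> distr (restrict_space M D) N \<phi> = N \<and>
     (AE x in M. x \<in> D \<and> S x \<in> D \<and> \<phi> (S x) = T (\<phi> x)) \<and>
     (\<exists>X Y. X \<in> sets M \<and> X \<subseteq> D \<and> (AE x in M. x \<in> X) \<and>
        Y \<in> sets N \<and> (AE y in N. y \<in> Y) \<and> bij_betw \<phi> X Y \<and>
        the_inv_into X \<phi> \<in> restrict_space N Y \<rightarrow>\<^sub>M restrict_space M X)"

definition unit_cube :: "(nat \<Rightarrow> real) measure" where
  "unit_cube = (\<Pi>\<^sub>M n\<in>UNIV. restrict_space lborel {0..1})"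

definition left_shift :: "(nat \<Rightarrow> 'a) \<Rightarrow> nat \<Rightarrow> 'a" where
  "left_shift x = (\<lambda>n. x (Suc n))"

end

theory Submission
  imports Defs "HOL-Combinatorics.Multiset_Permutations"
begin

text \<open>
  RSK carries the shift to jeu de taquin because deleting the first letter of a word changes its shape the
  way a slide does.  All diagrams in question are shapes of words, and growth diagrams describe how the
  shape changes if one appends a letter (Schensted's bumping), prepends a letter, or adds a largest letter
  in between.  The bumping of the largest letter is elementary, and the remaining rules follow from it by
  induction on the length of the word, since the local rules on the faces of a cube of eight shapes force
  each other (\<open>growth_cube\<close>, \<open>left_rules\<close>).  As a result the shapes of \<open>x\<^sub>2, x\<^sub>3, \<dots>\<close> and those of
  \<open>x\<^sub>1, x\<^sub>2, \<dots>\<close> are linked by slides, and the box in which they differ runs along the jeu de taquin path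
  (\<open>recording_slide\<close>).

  The law of the recording tableau is the Plancherel measure.  By the injectivity of the
  Robinson--Schensted correspondence at most \<open>f\<^sup>d\<close> of the \<open>n!\<close> orders of \<open>n\<close> letters produce a given
  growth path to a diagram \<open>d\<close>, and these bounds add up to 1 because the sum of \<open>(f\<^sup>d)\<^sup>2\<close> over all diagrams
  with \<open>n\<close> boxes is \<open>n!\<close>; hence they are equalities (\<open>shape_path_prob\<close>).

  The main point is that RSK is almost everywhere injective: the letter \<open>x\<^sub>1\<close> is almost surely a function of
  the recording tableau.  Reversing a word transposes its shape (\<open>sh_rev\<close>), so it suffices to estimate the
  letter that is inserted last into a word from the shapes before and after its insertion, with an
  arbitrarily small mean error (\<open>letter_determined\<close>).

  Fix the letters inserted so far.  A larger letter is inserted further to the right, so the letters whose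
  insertion adds a box to the first \<open>r\<close> columns form an initial segment of the unit interval, of random
  length \<open>H\<close> (\<open>threshold\<close>).  The conditional expectation of \<open>H\<close> given the shape alone is the
  probability \<open>G\<close> that the Plancherel growth process adds its next box to the first \<open>r\<close> columns
  (\<open>left_prob\<close>).  The two are close in mean square if their second moments are.  The second moment of \<open>H\<close>
  is twice the probability that a box in the first \<open>r\<close> columns is added and the next letter is smaller;
  then the next box lies in a lower row.  Under the law of two consecutive growth steps, two boxes that can
  be added in either order are exchangeable, and an exchange compares this probability with the one that
  both boxes lie in the first \<open>r\<close> columns, which is the second moment of \<open>G\<close> up to the effect of one step
  on \<open>G\<close> (\<open>descent_prob_le\<close>, \<open>threshold_close\<close>).  Boxes that cannot be exchanged are adjacent; by the
  Cauchy--Schwarz inequality for the dimensions, this has probability \<open>O(1/n)\<close> for two given columns.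

  The effect of one step on \<open>G\<close> is small at suitable times.  The same exchange shows that \<open>G\<close> is almost a
  martingale along the growth process, with drift \<open>O(1/n)\<close>.  As \<open>G\<close> is bounded, its quadratic variation
  between the times \<open>n\<close> and \<open>2 n\<close> is bounded as well (\<open>left_prob_variation\<close>), hence small in mean at some
  time in between, for many values of \<open>r\<close> at once.  Now cut the columns into blocks.  A letter whose box
  falls into some block lies between the values of \<open>H\<close> at both ends of the block; these are close to the
  values of \<open>G\<close>, which differ little because no column carries much probability (\<open>left_prob_gap\<close>).

  The other letters are recovered by applying jeu de taquin first, so RSK has a measurable inverse on a set
  of full measure.
\<close>

section \<open>Insertion tableaux of words\<close>

definition ins :: "real list \<Rightarrow> real list list" where
  "ins w = fold rs_insert w []"

definition sh :: "real list \<Rightarrow> diagram" where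
  "sh w = diagram_of (map length (ins w))"

lemma ins_Nil [simp]: "ins [] = []"
  by (simp add: ins_def)

lemma ins_snoc [simp]: "ins (w @ [y]) = rs_insert y (ins w)"
  by (simp add: ins_def)

lemma insertion_tableau_eq_ins: "insertion_tableau x n = ins (map x [0..<n])"
  by (induction n) simp_all

lemma rsk_shape_eq_sh: "rsk_shape x n = sh (map x [0..<n])"
  by (simp add: rsk_shape_def sh_def insertion_tableau_eq_ins)

definition entries :: "real list list \<Rightarrow> real set" where
  "entries P = \<Union>(set ` set P)"

lemma entries_simps [simp]:
  "entries [] = {}" "entries (r # P) = set r \<union> entries P"
  by (auto simp: entries_def)

lemma set_row_insert:
  "row_insert y r = (r', z) \<Longrightarrow> set r' \<union> set_option z = insert y (set r)"
  by (induction y r arbitrary: r' z rule: row_insert.induct)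
     (fastforce split: if_splits prod.splits)+

lemma entries_rs_insert: "entries (rs_insert y P) = insert y (entries P)"
proof (induction P arbitrary: y)
  case (Cons r P)
  obtain r' z where r: "row_insert y r = (r', z)" by fastforce
  show ?case using set_row_insert[OF r] Cons by (cases z) (auto simp: r)
qed simp

lemma entries_ins [simp]: "entries (ins w) = set w"
  by (induction w rule: rev_induct) (simp_all add: entries_rs_insert)

text \<open>The row in which the insertion of \<open>y\<close> ends, which is where the shape grows.\<close>

fun ins_row :: "real \<Rightarrow> real list list \<Rightarrow> nat" where
  "ins_row y [] = 0"
| "ins_row y (r # P) = (case snd (row_insert y r) of None \<Rightarrow> 0 | Some z \<Rightarrow> Suc (ins_row z P))"

definition add_at :: "nat \<Rightarrow> diagram \<Rightarrow> diagram" where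
  "add_at k d = insert (card {i. (i, k) \<in> d}, k) d"

fun lengthen :: "nat \<Rightarrow> nat list \<Rightarrow> nat list" where
  "lengthen k [] = [1]"
| "lengthen 0 (n # l) = Suc n # l"
| "lengthen (Suc k) (n # l) = n # lengthen k l"

lemma length_row_insert:
  "row_insert y r = (r', z) \<Longrightarrow> length r' = (if z = None then Suc (length r) else length r)"
  by (induction y r arbitrary: r' z rule: row_insert.induct)
     (fastforce split: if_splits prod.splits)+

lemma row_insert_None: "row_insert y r = (r', None) \<Longrightarrow> r' = r @ [y]"
  by (induction y r arbitrary: r' rule: row_insert.induct)
     (fastforce split: if_splits prod.splits)+

lemma ins_row_le_length: "ins_row y P \<le> length P"
  by (induction y P rule: ins_row.induct) (auto split: option.splits)

lemma lengths_rs_insert: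
  "map length (rs_insert y P) = lengthen (ins_row y P) (map length P)"
proof (induction P arbitrary: y)
  case (Cons r P)
  obtain r' z where r: "row_insert y r = (r', z)" by fastforce
  show ?case using length_row_insert[OF r] Cons by (cases z) (auto simp: r)
qed simp

lemma mem_diagram_of [simp]: "(i, j) \<in> diagram_of l \<longleftrightarrow> j < length l \<and> i < l ! j"
  by (simp add: diagram_of_def)

lemma length_lengthen: "k \<le> length l \<Longrightarrow> length (lengthen k l) = (if k = length l then Suc k else length l)"
  by (induction k l rule: lengthen.induct) auto

lemma nth_lengthen:
  "k \<le> length l \<Longrightarrow> j < length (lengthen k l) \<Longrightarrow>
    lengthen k l ! j = (if j = k then Suc (if k < length l then l ! k else 0) else l ! j)"
  by (induction k l arbitrary: j rule: lengthen.induct) (auto simp: nth_Cons split: nat.splits)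

lemma diagram_of_lengthen:
  assumes "k \<le> length l"
  shows "diagram_of (lengthen k l) = add_at k (diagram_of l)"
proof -
  have "{i. k < length l \<and> i < l ! k} = (if k < length l then {..<l ! k} else {})" by auto
  then have "card {i. (i, k) \<in> diagram_of l} = (if k < length l then l ! k else 0)" by simp
  then show ?thesis
    using assms
    by (auto simp: add_at_def length_lengthen nth_lengthen less_Suc_eq split: if_splits)
qed

lemma shape_rs_insert:
  "diagram_of (map length (rs_insert y P)) = add_at (ins_row y P) (diagram_of (map length P))"
  by (simp add: lengths_rs_insert diagram_of_lengthen ins_row_le_length)

lemma sh_Nil [simp]: "sh [] = {}"
  by (auto simp: sh_def diagram_of_def)

lemma sh_snoc: "sh (w @ [y]) = add_at (ins_row y (ins w)) (sh w)"
  by (simp add: sh_def shape_rs_insert)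

section \<open>Removing the largest letter\<close>

text \<open>
  The tableau with the entry \<open>m\<close> appended to row \<open>k\<close>; a new row is opened below the last one.
\<close>

fun place :: "real \<Rightarrow> nat \<Rightarrow> real list list \<Rightarrow> real list list" where
  "place m k [] = [[m]]"
| "place m 0 (r # P) = (r @ [m]) # P"
| "place m (Suc k) (r # P) = r # place m k P"

lemma lengths_place: "map length (place m k P) = lengthen k (map length P)"
  by (induction m k P rule: place.induct) auto

lemma row_insert_greatest: "\<forall>a\<in>set r. a < m \<Longrightarrow> row_insert m r = (r @ [m], None)"
  by (induction r) auto

lemma rs_insert_greatest:
  assumes "\<forall>a\<in>entries P. a < m"
  shows "rs_insert m P = place m 0 P"
  using assms by (cases P) (auto simp: row_insert_greatest)

lemma row_insert_snoc_greatest: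
  assumes "row_insert y r = (r', z)" "y < m" "\<forall>a\<in>set r. a < m"
  shows "row_insert y (r @ [m]) = (case z of None \<Rightarrow> (r', Some m) | Some z \<Rightarrow> (r' @ [m], Some z))"
  using assms
  by (induction y r arbitrary: r' z rule: row_insert.induct)
     (auto split: if_splits prod.splits option.splits)

text \<open>
  The largest letter never displaces another one.  It moves to the next row exactly if the insertion of \<open>y\<close>
  ends in its own row, because then \<open>y\<close> or a letter bumped by it replaces \<open>m\<close> at the end of the row.
\<close>

lemma rs_insert_place:
  assumes "\<forall>a\<in>entries P. a < m" "y < m" "k \<le> length P"
  shows "rs_insert y (place m k P) =
    place m (if ins_row y P = k then Suc k else k) (rs_insert y P)"
  using assms
proof (induction P arbitrary: y k)
  case (Cons r P)
  obtain r' z where r: "row_insert y r = (r', z)" by fastforce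
  have m: "\<forall>a\<in>set r. a < m" "\<forall>a\<in>entries P. a < m" using Cons.prems by auto
  have z: "z' < m" if "z = Some z'" for z'
    using set_row_insert[OF r] that Cons.prems by auto
  show ?case
  proof (cases k)
    case 0
    then show ?thesis
      using row_insert_snoc_greatest[OF r Cons.prems(2) m(1)] row_insert_None[of y r r'] m(2)
      by (cases z) (auto simp: r rs_insert_greatest)
  next
    case (Suc k')
    then show ?thesis
      using Cons.IH[OF m(2) z, of _ k'] Cons.prems by (cases z) (auto simp: r)
  qed
qed simp

text \<open>
  By induction on the word: all other entries are inserted as if the largest letter were absent.
\<close>

lemma ins_eq_place:
  assumes "distinct w" "m \<in> set w" "\<forall>a\<in>set w. a \<le> m"
  shows "\<exists>k \<le> length (ins (remove1 m w)). ins w = place m k (ins (remove1 m w))"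
  using assms
proof (induction w rule: rev_induct)
  case (snoc y w)
  show ?case
  proof (cases "y = m")
    case True
    then have "m \<notin> set w" "\<forall>a\<in>set w. a < m"
      using snoc.prems by (auto simp: less_le)
    then have "ins (w @ [y]) = place m 0 (ins w)"
      using True rs_insert_greatest[of "ins w" m] by simp
    then show ?thesis using True \<open>m \<notin> set w\<close> by (auto simp: remove1_append)
  next
    case False
    then have m: "m \<in> set w" "y < m" using snoc.prems by (auto simp: less_le)
    then obtain k where k: "k \<le> length (ins (remove1 m w))" "ins w = place m k (ins (remove1 m w))"
      using snoc by auto
    have a: "\<forall>a\<in>entries (ins (remove1 m w)). a < m"
      using snoc.prems by (auto simp: set_remove1_eq less_le)
    show ?thesis
    proof (intro exI conjI)
      let ?P = "ins (remove1 m w)"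
      let ?k = "if ins_row y ?P = k then Suc k else k"
      show "ins (w @ [y]) = place m ?k (ins (remove1 m (w @ [y])))"
        using m rs_insert_place[OF a m(2) k(1)] k(2) by (simp add: remove1_append)
      have "length (rs_insert y ?P) = length (lengthen (ins_row y ?P) (map length ?P))"
        by (metis length_map lengths_rs_insert)
      then show "?k \<le> length (ins (remove1 m (w @ [y])))"
        using m k(1) ins_row_le_length[of y ?P] by (auto simp: remove1_append length_lengthen)
    qed
  qed
qed simp

lemma shape_place:
  "k \<le> length P \<Longrightarrow>
    diagram_of (map length (place m k P)) = add_at k (diagram_of (map length P))"
  by (simp add: lengths_place diagram_of_lengthen)

section \<open>Growth diagrams\<close>

abbreviation yd where "yd \<equiv> young_diagram"

lemma add_at_notin: "yd d \<Longrightarrow> (card {i. (i, k) \<in> d}, k) \<notin> d"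
proof
  assume d: "yd d" and *: "(card {i. (i, k) \<in> d}, k) \<in> d"
  have "finite {i. (i, k) \<in> d}"
    using young_diagramD(1)[OF d] by (rule finite_subset[of _ "fst ` d", rotated, OF finite_imageI]) force
  moreover have "{..card {i. (i, k) \<in> d}} \<subseteq> {i. (i, k) \<in> d}"
    by (intro subsetI CollectI young_diagramD(2)[OF d *]) simp_all
  ultimately have "card {..card {i. (i, k) \<in> d}} \<le> card {i. (i, k) \<in> d}" by (rule card_mono)
  then show False by simp
qed

lemma in_add_at: "yd d \<Longrightarrow> i < card {i. (i, k) \<in> d} \<Longrightarrow> (i, k) \<in> d"
proof -
  assume d: "yd d" and i: "i < card {i. (i, k) \<in> d}"
  have "finite {i. (i, k) \<in> d}"
    using young_diagramD(1)[OF d] by (rule finite_subset[of _ "fst ` d", rotated, OF finite_imageI]) force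
  then have "{i. (i, k) \<in> d} = {..<card {i. (i, k) \<in> d}}"
    using young_diagramD(2)[OF d] by (intro down_closed_nat_eq) auto
  then show ?thesis using i by blast
qed

lemma addable_row_unique:
  assumes "yd (insert b d)" "yd (insert b' d)" "b \<notin> d" "b' \<notin> d" "snd b = snd b'"
  shows "b = b'"
proof -
  obtain i i' j where b: "b = (i, j)" "b' = (i', j)" using assms(5) by (metis prod.collapse)
  have "i = i'"
  proof (rule ccontr)
    assume "i \<noteq> i'"
    then show False
      using assms(3,4) young_diagramD(2)[OF assms(1), of i j i' j]
        young_diagramD(2)[OF assms(2), of i' j i j] unfolding b by (cases "i \<le> i'") auto
  qed
  then show ?thesis using b by simp
qed

lemma addable_col_unique:
  assumes "yd (insert b d)" "yd (insert b' d)" "b \<notin> d" "b' \<notin> d" "fst b = fst b'"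
  shows "b = b'"
proof -
  obtain i j j' where b: "b = (i, j)" "b' = (i, j')" using assms(5) by (metis prod.collapse)
  have "j = j'"
  proof (rule ccontr)
    assume "j \<noteq> j'"
    then show False
      using assms(3,4) young_diagramD(2)[OF assms(1), of i j i j']
        young_diagramD(2)[OF assms(2), of i j' i j] unfolding b by (cases "j \<le> j'") auto
  qed
  then show ?thesis using b by simp
qed

text \<open>
  After row \<open>k\<close> has grown, it is longer than the next row was, which leaves room for a box there.
\<close>

lemma yd_add_next_row:
  assumes d: "yd d" and e: "yd (add_at k d)"
  shows "yd (add_at (Suc k) (add_at k d))"
proof -
  let ?r = "\<lambda>k d. card {i. (i, k) \<in> d}"
  let ?e = "add_at k d"
  have row: "{i. (i, Suc k) \<in> ?e} = {i. (i, Suc k) \<in> d}" by (auto simp: add_at_def)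
  have "?r (Suc k) d \<le> ?r k d"
  proof (rule card_mono)
    show "finite {i. (i, k) \<in> d}"
      using young_diagramD(1)[OF d] by (rule finite_subset[of _ "fst ` d", rotated, OF finite_imageI]) force
    show "{i. (i, Suc k) \<in> d} \<subseteq> {i. (i, k) \<in> d}" using young_diagramD(2)[OF d] by auto
  qed
  then have below: "(?r (Suc k) d, k) \<in> ?e"
    using in_add_at[OF d, of "?r (Suc k) d" k] by (auto simp: add_at_def le_less)
  show ?thesis
    unfolding young_diagram_iff
  proof (intro conjI allI impI)
    show "finite (add_at (Suc k) ?e)" using young_diagramD(1)[OF d] by (simp add: add_at_def)
    fix i j i' j' assume *: "(i, j) \<in> add_at (Suc k) ?e" "i' \<le> i" "j' \<le> j"
    show "(i', j') \<in> add_at (Suc k) ?e"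
    proof (cases "(i, j) \<in> ?e")
      case True
      then show ?thesis using young_diagramD(2)[OF e True *(2,3)] by (auto simp: add_at_def)
    next
      case False
      then have ij: "i = ?r (Suc k) d" "j = Suc k" using *(1) row by (auto simp: add_at_def)
      show ?thesis
      proof (cases "j' = Suc k")
        case True
        then show ?thesis
          using ij *(2) in_add_at[OF d, of i' "Suc k"] row by (auto simp: add_at_def le_less)
      next
        case False
        then have "(i', j') \<in> ?e" using young_diagramD(2)[OF e below, of i' j'] ij * by auto
        then show ?thesis by (simp add: add_at_def)
      qed
    qed
  qed
qed

lemma yd_add_first_row:
  assumes d: "yd d"
  shows "yd (add_at 0 d)"
  unfolding young_diagram_iff
proof (intro conjI allI impI)
  show "finite (add_at 0 d)" using young_diagramD(1)[OF d] by (simp add: add_at_def)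
  fix i j i' j' assume *: "(i, j) \<in> add_at 0 d" "i' \<le> i" "j' \<le> j"
  show "(i', j') \<in> add_at 0 d"
  proof (cases "(i, j) \<in> d")
    case True
    then show ?thesis using young_diagramD(2)[OF d True *(2,3)] by (simp add: add_at_def)
  next
    case False
    then show ?thesis using * in_add_at[OF d, of i' 0] by (auto simp: add_at_def le_less)
  qed
qed

text \<open>
  A local rule of a growth diagram: \<open>B\<close> and \<open>V\<close> arise from \<open>A\<close> by adding one box each, and \<open>C\<close> is their
  union if these boxes differ.  If they coincide, \<open>C\<close> has one more box, and \<open>R\<close> tells its position relative
  to the common one: in the next row for Schensted insertion, in the next column for insertion on the other
  side, and adjacent to it for jeu de taquin.
\<close>

definition growth_square :: "(box \<Rightarrow> box \<Rightarrow> bool) \<Rightarrow> diagram \<Rightarrow> diagram \<Rightarrow> diagram \<Rightarrow> diagram \<Rightarrow> bool" where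
  "growth_square R A B V C \<longleftrightarrow> yd A \<and> yd B \<and> yd V \<and> yd C \<and>
     (\<exists>p q. p \<notin> A \<and> q \<notin> A \<and> B = insert p A \<and> V = insert q A \<and>
        (if p = q then \<exists>r. r \<notin> B \<and> C = insert r B \<and> R p r else C = insert p (insert q A)))"

definition next_row :: "box \<Rightarrow> box \<Rightarrow> bool" where
  "next_row p r \<longleftrightarrow> snd r = Suc (snd p)"

definition next_col :: "box \<Rightarrow> box \<Rightarrow> bool" where
  "next_col p r \<longleftrightarrow> fst r = Suc (fst p)"

definition next_box :: "box \<Rightarrow> box \<Rightarrow> bool" where
  "next_box p r \<longleftrightarrow> r = (Suc (fst p), snd p) \<or> r = (fst p, Suc (snd p))"

lemma growth_square_neqI:
  assumes "yd A" "yd B" "yd V" "yd C" "p \<notin> A" "q \<notin> A" "p \<noteq> q"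
    "B = insert p A" "V = insert q A" "C = insert p (insert q A)"
  shows "growth_square R A B V C"
  unfolding growth_square_def using assms(1-4)
  by (intro conjI exI[of _ p] exI[of _ q]) (simp_all add: assms(5-10))

lemma growth_square_eqI:
  assumes "yd A" "yd B" "yd C" "p \<notin> A" "B = insert p A" "V = B"
    "r \<notin> B" "C = insert r B" "R p r"
  shows "growth_square R A B V C"
proof -
  have "\<exists>r. r \<notin> B \<and> C = insert r B \<and> R p r" using assms by blast
  then show ?thesis
    unfolding growth_square_def using assms(1-3)
    by (intro conjI exI[of _ p]) (simp_all add: assms(4-6))
qed

lemma growth_squareE:
  assumes "growth_square R A B V C"
  obtains p r where "yd A" "yd B" "yd C" "p \<notin> A" "B = insert p A" "V = B"
      "r \<notin> B" "C = insert r B" "R p r"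
  | p q where "yd A" "yd B" "yd V" "yd C" "p \<notin> A" "q \<notin> A" "p \<noteq> q"
      "B = insert p A" "V = insert q A" "C = insert p (insert q A)"
  using assms unfolding growth_square_def by (metis (full_types))

lemma growth_square_sym: "growth_square R A B V C \<Longrightarrow> growth_square R A V B C"
  unfolding growth_square_def by (metis insert_commute)

lemma growth_squareD:
  assumes "growth_square R A B V C"
  shows "A \<hookrightarrow> B" "A \<hookrightarrow> V" "B \<hookrightarrow> C" "V \<hookrightarrow> C"
proof -
  have "A \<hookrightarrow> B \<and> A \<hookrightarrow> V \<and> B \<hookrightarrow> C \<and> V \<hookrightarrow> C"
    using assms
  proof (cases rule: growth_squareE)
    case (1 p r)
    then show ?thesis using add_boxI[of A B p] add_boxI[of B C r] by simp
  next
    case (2 p q)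
    then show ?thesis
      using add_boxI[of A B p] add_boxI[of A V q] add_boxI[of B C q] add_boxI[of V C p]
      by (simp add: insert_commute)
  qed
  then show "A \<hookrightarrow> B" "A \<hookrightarrow> V" "B \<hookrightarrow> C" "V \<hookrightarrow> C" by auto
qed

text \<open>
  Two boxes in the same row or in the same column cannot both be added to \<open>B\<close>.  The relation
  \<^const>\<open>next_box\<close> leaves two possibilities.
\<close>

lemma growth_square_unique:
  assumes "growth_square R A B V C" "growth_square R A B V C'" "R \<in> {next_row, next_col}"
  shows "C = C'"
  using assms(1)
proof (cases rule: growth_squareE)
  case (1 p r)
  note r = 1
  from assms(2) show ?thesis
  proof (cases rule: growth_squareE)
    case (1 p' r')
    then have "p' = p" using r(4,5) by (metis insertE insertI1)
    then have "snd r = snd r' \<or> fst r = fst r'"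
      using 1 r assms(3) by (auto simp: next_row_def next_col_def)
    then have "r = r'"
      using addable_row_unique[of r B r'] addable_col_unique[of r B r'] 1 r by auto
    then show ?thesis using 1 r by simp
  next
    case (2 p' q')
    then have "insert p' A = insert q' A" using r(6) by simp
    then show ?thesis using 2(5-7) by (metis insertE insertI1)
  qed
next
  case (2 p q)
  note r = 2
  from assms(2) show ?thesis
  proof (cases rule: growth_squareE)
    case (1 p' r')
    then have "insert p A = insert q A" using r(8,9) by simp
    then show ?thesis using r(5-7) by (metis insertE insertI1)
  next
    case (2 p' q')
    then have "C = B \<union> V" "C' = B \<union> V" using r by auto
    then show ?thesis by simp
  qed
qed

lemma addable_antichain:
  assumes "yd (insert p A)" "yd (insert q A)" "p \<notin> A" "q \<notin> A" "p \<noteq> q"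
  shows "fst p < fst q \<and> snd q < snd p \<or> fst q < fst p \<and> snd p < snd q"
proof -
  obtain i j k l where pq: "p = (i, j)" "q = (k, l)" by fastforce
  have "\<not> (i \<le> k \<and> j \<le> l)" "\<not> (k \<le> i \<and> l \<le> j)"
    using young_diagramD(2)[OF assms(2), of k l i j] young_diagramD(2)[OF assms(1), of i j k l]
      assms(3-5) pq by auto
  then show ?thesis using pq by auto
qed

text \<open>
  If \<open>q\<close> sits in the column after \<open>p\<close>, then the box after \<open>q\<close> in the next row lies directly below \<open>q\<close>:
  the box to its left belongs to the column of \<open>p\<close>.
\<close>

lemma box_below:
  assumes "yd (insert p A)" "yd (insert q A)" "p \<notin> A" "q \<notin> A"
    and pq: "fst q = Suc (fst p)"
    and r: "yd (insert r (insert p (insert q A)))" "r \<notin> insert p (insert q A)" "snd r = Suc (snd q)"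
  shows "r = (fst q, Suc (snd q))"
proof -
  obtain i j k l a where eq: "p = (i, j)" "q = (k, l)" "r = (a, Suc l)"
    using r(3) by (metis prod.collapse)
  have j: "l < j" "k = Suc i" using addable_antichain[OF assms(1-4)] pq eq by auto
  have "\<not> k < a"
  proof
    assume "k < a"
    then have "(k, Suc l) \<in> insert p (insert q A)"
      using young_diagramD(2)[OF r(1), of a "Suc l" k "Suc l"] eq by auto
    then have "(k, Suc l) \<in> A" using j eq by auto
    moreover have "yd A"
    proof -
      have "A = insert p A \<inter> insert q A" using assms(3,4) pq by auto
      then show ?thesis using young_diagram_Int[OF assms(1,2)] by simp
    qed
    ultimately show False using young_diagramD(2)[of A k "Suc l" k l] eq assms(4) by auto
  qed
  moreover have "\<not> a < k"
  proof
    assume "a < k"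
    then have "(a, Suc l) \<in> insert p A"
      using young_diagramD(2)[OF assms(1), of i j a "Suc l"] eq j by auto
    then show False using r eq by auto
  qed
  ultimately show ?thesis using eq by auto
qed

text \<open>
  A box added after \<open>p\<close> in the row of \<open>p\<close> is its right neighbour.
\<close>

lemma box_right:
  assumes "yd (insert p A)" "p \<notin> A" "yd A"
    and r: "yd (insert r (insert p A))" "r \<notin> insert p A" "snd r = snd p"
  shows "r = (Suc (fst p), snd p)"
proof -
  obtain i j k where eq: "p = (i, j)" "r = (k, j)"
    using r(3) by (metis prod.collapse)
  have "\<not> Suc i < k"
  proof
    assume "Suc i < k"
    then have "(Suc i, j) \<in> A"
      using young_diagramD(2)[OF r(1), of k j "Suc i" j] eq by auto
    then show False using young_diagramD(2)[OF assms(3), of "Suc i" j i j] assms(2) eq by auto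
  qed
  moreover have "\<not> k \<le> i"
    using young_diagramD(2)[OF assms(1), of i j k j] r(2) eq by auto
  ultimately show ?thesis using eq by auto
qed

lemma next_box_neq:
  assumes "yd (insert p A)" "yd (insert q A)" "p \<notin> A" "q \<notin> A" "p \<noteq> q" "next_box p r"
  shows "r \<noteq> q"
  using addable_antichain[OF assms(1-5)] assms(6) by (auto simp: next_box_def)

text \<open>
  The three-dimensional step.  The eight diagrams of a cube are indexed by whether one adds a letter
  on the left (\<open>A\<close>), a letter on the right (\<open>B\<close>) and a largest letter in between (\<open>V\<close>).  The rules on
  the three faces through the smallest diagram and on the face with both \<open>A\<close> and \<open>B\<close>, \<open>V\<close> varying,
  force the rules on the remaining two faces.
\<close>

lemma growth_cube:
  assumes B: "growth_square next_row d B V BV"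
    and V: "growth_square next_col d A V AV"
    and AB: "growth_square next_box d A B AB"
    and ABV: "growth_square next_row A AB AV ABV"
  shows "growth_square next_col B AB BV ABV \<and> growth_square next_box V AV BV ABV"
proof -
  obtain p q where pq: "p \<notin> d" "q \<notin> d" "A = insert p d" "B = insert q d"
      "p = q \<Longrightarrow> \<exists>r. r \<notin> A \<and> AB = insert r A \<and> next_box p r"
      "p \<noteq> q \<Longrightarrow> AB = insert p (insert q d)"
    using AB unfolding growth_square_def by (smt (verit))
  obtain s where s: "s \<notin> d" "V = insert s d"
    using V unfolding growth_square_def by (smt (verit))
  have qs: "q = s \<Longrightarrow> \<exists>r. r \<notin> B \<and> BV = insert r B \<and> next_row q r"
      "q \<noteq> s \<Longrightarrow> BV = insert q (insert s d)"
    using B pq s unfolding growth_square_def by (smt (verit) insert_ident insertE insertI1)+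
  have ps: "p = s \<Longrightarrow> \<exists>r. r \<notin> A \<and> AV = insert r A \<and> next_col p r"
      "p \<noteq> s \<Longrightarrow> AV = insert p (insert s d)"
    using V pq s unfolding growth_square_def by (smt (verit) insert_ident insertE insertI1)+
  have y: "yd d" "yd A" "yd B" "yd V" "yd AB" "yd AV" "yd BV" "yd ABV"
    using B V AB ABV unfolding growth_square_def by auto
  have top: "ABV = insert a (insert b A)" if "AB = insert a A" "AV = insert b A" "a \<notin> A" "b \<notin> A" "a \<noteq> b" for a b
    using ABV that unfolding growth_square_def by (smt (verit) insert_ident insertE insertI1)
  have top': "\<exists>r. r \<notin> AB \<and> ABV = insert r AB \<and> next_row a r" if "AB = insert a A" "AV = AB" "a \<notin> A" for a
    using ABV that unfolding growth_square_def by (smt (verit) insert_ident insertE insertI1)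
  consider "p \<noteq> q" "p \<noteq> s" "q \<noteq> s" | "p = q" "p \<noteq> s" | "p = s" "p \<noteq> q" | "q = s" "p \<noteq> q"
    | "p = q" "p = s" by blast
  then show ?thesis
  proof cases
    case 1
    have AB: "AB = insert p (insert q d)" "AV = insert p (insert s d)" "BV = insert q (insert s d)"
      using 1 pq(6) qs(2) ps(2) by simp_all
    have "ABV = insert q (insert s A)"
      by (rule top) (simp_all add: AB pq(1-4) s insert_commute 1 1[symmetric])
    note eqs = AB this pq(1-4) s 1 1[symmetric]
    show ?thesis
    proof (rule conjI)
      show "growth_square next_col B AB BV ABV"
        by (rule growth_square_neqI[OF y(3) y(5) y(7) y(8), of p s]) (simp_all add: eqs insert_commute)
      show "growth_square next_box V AV BV ABV"
        by (rule growth_square_neqI[OF y(4) y(6) y(7) y(8), of p q]) (simp_all add: eqs insert_commute)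
    qed
  next
    case 2
    obtain r where r: "r \<notin> A" "AB = insert r A" "next_box p r" using 2 pq(5) by auto
    have "r \<noteq> s"
      using next_box_neq[OF _ _ pq(1) s(1) 2(2) r(3)] y(2,4) unfolding pq(3) s(2) by blast
    have AV: "AV = insert p (insert s d)" "BV = insert p (insert s d)" "B = A"
      using 2 qs(2) ps(2) pq(3,4) by simp_all
    have "p \<noteq> r" "r \<notin> d" using r(1) pq(3) by auto
    have "ABV = insert r (insert s A)"
      by (rule top) (simp_all add: r(2) \<open>p \<noteq> r\<close>[symmetric] \<open>r \<notin> d\<close> AV pq(1-3) s insert_commute 2(2) 2(2)[symmetric] \<open>r \<noteq> s\<close>)
    note eqs = AV this r(2) pq(1,3) s 2(2) 2(2)[symmetric] \<open>r \<noteq> s\<close> \<open>r \<noteq> s\<close>[symmetric]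
      \<open>p \<noteq> r\<close> \<open>p \<noteq> r\<close>[symmetric] \<open>r \<notin> d\<close>
    show ?thesis
    proof (rule conjI)
      show "growth_square next_col B AB BV ABV"
        by (rule growth_square_neqI[OF y(3) y(5) y(7) y(8), of r s]) (simp_all add: eqs insert_commute)
      show "growth_square next_box V AV BV ABV"
        by (rule growth_square_eqI[OF y(4) y(6) y(8), of p _ r]) (simp_all add: eqs insert_commute r(3))
    qed
  next
    case 3
    obtain r where r: "r \<notin> A" "AV = insert r A" "next_col p r" using 3 ps(1) by auto
    have AB: "AB = insert p (insert q d)" "BV = insert p (insert q d)" "V = A"
      using 3 pq(3,6) qs(2) s(2) by (simp_all add: insert_commute)
    have "p \<noteq> r" "r \<notin> d" using r(1) pq(3) by auto
    show ?thesis
    proof (cases "q = r")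
      case False
      have "ABV = insert q (insert r A)"
        by (rule top) (simp_all add: r(2) \<open>p \<noteq> r\<close>[symmetric] \<open>r \<notin> d\<close> AB pq(1-3) insert_commute 3(2) 3(2)[symmetric] False)
      note eqs = AB this r(2) pq(1-4) 3(2) 3(2)[symmetric] False False[symmetric]
        \<open>p \<noteq> r\<close> \<open>p \<noteq> r\<close>[symmetric] \<open>r \<notin> d\<close>
      show ?thesis
      proof (rule conjI)
        show "growth_square next_col B AB BV ABV"
          by (rule growth_square_eqI[OF y(3) y(5) y(8), of p _ r]) (simp_all add: eqs insert_commute r(3))
        show "growth_square next_box V AV BV ABV"
          by (rule growth_square_neqI[OF y(4) y(6) y(7) y(8), of r q]) (simp_all add: eqs insert_commute)
      qed
    next
      case True
      have "\<exists>t. t \<notin> AB \<and> ABV = insert t AB \<and> next_row q t"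
        by (rule top') (use True r AB pq(1-3) in \<open>simp_all add: insert_commute\<close>)
      then obtain t where t: "t \<notin> AB" "ABV = insert t AB" "next_row q t" by blast
      have "t = (fst q, Suc (snd q))"
        by (rule box_below[of p d q t])
           (use y(2,3,8) r(3) t True AB(1) pq(1-4) in \<open>simp_all add: next_col_def next_row_def\<close>)
      then have nt: "next_box q t" "next_col p t"
        using r True by (simp_all add: next_box_def next_col_def)
      have "t \<noteq> p" "t \<noteq> q" "t \<notin> d" using t(1) AB(1) by auto
      note eqs = AB t(2) r(2) pq(1-4) 3(2) 3(2)[symmetric] True[symmetric] this
      show ?thesis
      proof (rule conjI)
        show "growth_square next_col B AB BV ABV"
          by (rule growth_square_eqI[OF y(3) y(5) y(8), of p _ t]) (simp_all add: eqs insert_commute nt)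
        show "growth_square next_box V AV BV ABV"
          by (rule growth_square_eqI[OF y(4) y(6) y(8), of q _ t]) (simp_all add: eqs insert_commute nt)
      qed
    qed
  next
    case 4
    obtain r where r: "r \<notin> B" "BV = insert r B" "next_row q r" using 4 qs(1) by auto
    have AB: "AB = insert p (insert q d)" "AV = insert p (insert q d)" "V = B"
      using 4 pq(4,6) ps(2) s(2) by simp_all
    have "r \<noteq> q" "r \<notin> d" using r(1) pq(4) by auto
    have "\<exists>t. t \<notin> AB \<and> ABV = insert t AB \<and> next_row q t"
      by (rule top') (use AB pq(1-3) 4 in \<open>simp_all add: insert_commute\<close>)
    then obtain t where t: "t \<notin> AB" "ABV = insert t AB" "next_row q t" by blast
    have tn: "t \<noteq> p" "t \<noteq> q" "t \<notin> d" using t(1) AB(1) by auto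
    show ?thesis
    proof (cases "p = r")
      case False
      have "r \<notin> AB" using False \<open>r \<noteq> q\<close> \<open>r \<notin> d\<close> AB(1) by simp
      moreover have "yd (insert r AB)"
      proof -
        have "insert r AB = AB \<union> BV" unfolding r(2) AB(1) pq(4) by blast
        then show ?thesis using young_diagram_Un[OF y(5,7)] by simp
      qed
      ultimately have "t = r"
        using addable_row_unique[of t AB r] t r(3) y(8) by (simp add: next_row_def)
      then have "ABV = insert r AB" using t by simp
      note eqs = AB this r(2) pq(1-4) 4(2) 4(2)[symmetric] False False[symmetric]
        \<open>r \<noteq> q\<close> \<open>r \<notin> d\<close>
      show ?thesis
      proof (rule conjI)
        show "growth_square next_col B AB BV ABV"
          by (rule growth_square_neqI[OF y(3) y(5) y(7) y(8), of p r]) (simp_all add: eqs insert_commute)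
        show "growth_square next_box V AV BV ABV"
          by (rule growth_square_neqI[OF y(4) y(6) y(7) y(8), of p r]) (simp_all add: eqs insert_commute)
      qed
    next
      case True
      have "t = (Suc (fst p), snd p)"
        by (rule box_right[of p B t])
           (use y(3,5,8) t r(3) True AB(1) pq(1-4) 4 in \<open>simp_all add: next_row_def\<close>)
      then have nt: "next_box p t" "next_col p t" by (simp_all add: next_box_def next_col_def)
      note eqs = AB t(2) r(2) pq(1-4) 4(2) 4(2)[symmetric] True[symmetric] tn
      show ?thesis
      proof (rule conjI)
        show "growth_square next_col B AB BV ABV"
          by (rule growth_square_eqI[OF y(3) y(5) y(8), of p _ t]) (simp_all add: eqs insert_commute nt)
        show "growth_square next_box V AV BV ABV"
          by (rule growth_square_eqI[OF y(4) y(6) y(8), of p _ t]) (simp_all add: eqs insert_commute nt)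
      qed
    qed
  next
    case 5
    have eq: "B = A" "V = A" using 5 pq(3,4) s(2) by simp_all
    obtain r where r: "r \<notin> A" "AB = insert r A" "next_box p r" using 5 pq(5) by auto
    obtain t where t: "t \<notin> A" "AV = insert t A" "next_col p t" using 5 ps(1) by auto
    obtain u where u: "u \<notin> A" "BV = insert u A" "next_row p u" using 5 qs(1) eq by auto
    show ?thesis
    proof (cases "fst r = fst p")
      case False
      then have r': "fst r = Suc (fst p)" "snd r = snd p" using r(3) by (auto simp: next_box_def)
      then have "t = r"
        using addable_col_unique[of t A r] y r t by (simp add: next_col_def)
      have "\<exists>v. v \<notin> AB \<and> ABV = insert v AB \<and> next_row r v"
        by (rule top') (use r t \<open>t = r\<close> in simp_all)
      then obtain v where v: "v \<notin> AB" "ABV = insert v AB" "next_row r v" by blast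
      have "u \<noteq> r" using u r' by (auto simp: next_row_def)
      moreover have "yd (insert u AB)"
      proof -
        have "insert u AB = AB \<union> BV" unfolding u(2) r(2) by blast
        then show ?thesis using young_diagram_Un[OF y(5,7)] by simp
      qed
      ultimately have "v = u"
        using addable_row_unique[of v AB u] u v y r r' by (simp add: next_row_def)
      note eqs = eq r(1,2) t(2) u(1,2) v(2) \<open>u \<noteq> r\<close> \<open>u \<noteq> r\<close>[symmetric] \<open>t = r\<close> \<open>v = u\<close>
      show ?thesis
      proof (rule conjI)
        show "growth_square next_col B AB BV ABV"
          by (rule growth_square_neqI[OF y(3) y(5) y(7) y(8), of r u]) (simp_all add: eqs insert_commute)
        show "growth_square next_box V AV BV ABV"
          by (rule growth_square_neqI[OF y(4) y(6) y(7) y(8), of r u]) (simp_all add: eqs insert_commute)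
      qed
    next
      case True
      then have r': "snd r = Suc (snd p)" using r(3) by (auto simp: next_box_def)
      then have "u = r"
        using addable_row_unique[of u A r] y r u by (simp add: next_row_def)
      have "t \<noteq> r" using t True by (auto simp: next_col_def)
      have ABV: "ABV = insert r (insert t A)"
        using top[OF r(2) t(2) r(1) t(1)] \<open>t \<noteq> r\<close> by simp
      have "next_col r t" using t True by (simp add: next_col_def)
      note eqs = eq r(1,2) t(1,2) u(2) ABV \<open>t \<noteq> r\<close> \<open>t \<noteq> r\<close>[symmetric] \<open>u = r\<close>
      show ?thesis
      proof (rule conjI)
        show "growth_square next_col B AB BV ABV"
          by (rule growth_square_eqI[OF y(3) y(5) y(8), of r _ t])
             (simp_all add: eqs insert_commute \<open>next_col r t\<close>)
        show "growth_square next_box V AV BV ABV"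
          by (rule growth_square_neqI[OF y(4) y(6) y(7) y(8), of t r]) (simp_all add: eqs insert_commute)
      qed
    qed
  qed
qed

section \<open>Shapes of words as growth diagrams\<close>

lemma sh_snoc_greatest: "\<forall>a\<in>set w. a < m \<Longrightarrow> sh (w @ [m]) = add_at 0 (sh w)"
  by (simp add: sh_def rs_insert_greatest shape_place)

lemma sh_last_greatest:
  assumes "distinct w" "m \<in> set w" "\<forall>a\<in>set w. a \<le> m" "y < m"
  obtains j k where "sh (remove1 m w @ [y]) = add_at j (sh (remove1 m w))"
    "sh w = add_at k (sh (remove1 m w))"
    "sh (w @ [y]) = add_at (if j = k then Suc k else k) (sh (remove1 m w @ [y]))"
proof -
  let ?P = "ins (remove1 m w)"
  obtain k where k: "k \<le> length ?P" "ins w = place m k ?P"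
    using ins_eq_place[OF assms(1-3)] by blast
  have P: "\<forall>a\<in>entries ?P. a < m"
    using assms by (auto simp: set_remove1_eq less_le)
  let ?j = "ins_row y ?P"
  have "length (rs_insert y ?P) = length (lengthen ?j (map length ?P))"
    by (metis length_map lengths_rs_insert)
  then have len: "(if ?j = k then Suc k else k) \<le> length (rs_insert y ?P)"
    using k(1) ins_row_le_length[of y ?P] by (auto simp: length_lengthen)
  show thesis
  proof (rule that[of ?j k])
    show "sh (remove1 m w @ [y]) = add_at ?j (sh (remove1 m w))" by (rule sh_snoc)
    show "sh w = add_at k (sh (remove1 m w))"
      using k shape_place[OF k(1)] by (simp add: sh_def)
    show "sh (w @ [y]) = add_at (if ?j = k then Suc k else k) (sh (remove1 m w @ [y]))"
      using rs_insert_place[OF P assms(4) k(1)] k(2) shape_place[OF len] by (simp add: sh_def)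
  qed
qed

lemma yd_sh: "distinct w \<Longrightarrow> yd (sh w)"
proof (induction "length w" arbitrary: w rule: less_induct)
  case less
  show ?case
  proof (cases w rule: rev_exhaust)
    case Nil
    then show ?thesis by (simp add: young_diagram_iff)
  next
    case (snoc v y)
    obtain m where m: "m \<in> set w" "\<forall>a\<in>set w. a \<le> m"
      using Max_in[of "set w"] Max_ge[of "set w"] snoc by blast
    have v: "distinct v" "y \<notin> set v" "length v < length w" using snoc less.prems by auto
    have yv: "yd (sh v)" using less.hyps[OF v(3,1)] .
    show ?thesis
    proof (cases "y = m")
      case True
      then have "sh w = add_at 0 (sh v)"
        using m v snoc by (auto intro!: sh_snoc_greatest simp: less_le)
      then show ?thesis using yd_add_first_row[OF yv] by simp
    next
      case False
      then have mv: "m \<in> set v" "\<forall>a\<in>set v. a \<le> m" "y < m" using m snoc by (auto simp: less_le)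
      obtain j k where jk: "sh (remove1 m v @ [y]) = add_at j (sh (remove1 m v))"
          "sh v = add_at k (sh (remove1 m v))"
          "sh (v @ [y]) = add_at (if j = k then Suc k else k) (sh (remove1 m v @ [y]))"
        using sh_last_greatest[OF v(1) mv] .
      have l: "length (remove1 m v) < length v" using mv(1) by (simp add: length_remove1)
           (metis One_nat_def diff_less length_pos_if_in_set zero_less_one)
      have y1: "yd (sh (remove1 m v))"
        using less.hyps[of "remove1 m v"] v l by simp
      have y2: "yd (sh (remove1 m v @ [y]))"
        using less.hyps[of "remove1 m v @ [y]"] v l snoc notin_set_remove1[OF v(2)] by simp
      show ?thesis
      proof (cases "j = k")
        case True
        then show ?thesis
          using jk snoc yd_add_next_row[OF y1, of k] y2 by simp
      next
        case False
        then have "sh w = sh v \<union> sh (remove1 m v @ [y])"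
          using jk snoc by (auto simp: add_at_def)
        then show ?thesis using young_diagram_Un[OF yv y2] by simp
      qed
    qed
  qed
qed

lemma growth_square_add_at:
  assumes "yd d" "yd (add_at j d)" "yd (add_at k d)"
    and "yd (add_at (if j = k then Suc k else k) (add_at j d))"
  shows "growth_square next_row d (add_at j d) (add_at k d)
    (add_at (if j = k then Suc k else k) (add_at j d))"
proof (cases "j = k")
  case True
  show ?thesis
  proof (rule growth_square_eqI)
    let ?r = "(card {i. (i, Suc k) \<in> add_at j d}, Suc k)"
    show "(card {i. (i, j) \<in> d}, j) \<notin> d" by (rule add_at_notin[OF assms(1)])
    show "?r \<notin> add_at j d" by (rule add_at_notin[OF assms(2)])
    show "next_row (card {i. (i, j) \<in> d}, j) ?r" using True by (simp add: next_row_def)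
  qed (use assms True in \<open>simp_all add: add_at_def\<close>)
next
  case False
  show ?thesis
    by (rule growth_square_neqI[OF assms, of "(card {i. (i, j) \<in> d}, j)" "(card {i. (i, k) \<in> d}, k)"])
       (use False add_at_notin[OF assms(1)] in \<open>simp_all add: add_at_def insert_commute\<close>)
qed

text \<open>
  What happens in \<open>rs_insert_place\<close>, read off the shapes: the box of \<open>m\<close> moves to the next row if the box
  added by \<open>y\<close> takes its place.
\<close>

lemma row_rule:
  assumes "distinct (w @ [y])" "m \<in> set w" "\<forall>a\<in>set w. a \<le> m" "y < m"
  shows "growth_square next_row (sh (remove1 m w)) (sh (remove1 m w @ [y])) (sh w) (sh (w @ [y]))"
proof -
  have w: "distinct w" using assms(1) by simp
  have "distinct (remove1 m w @ [y])"
    using assms(1) notin_set_remove1[of y w m] by simp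
  then have y: "yd (sh (remove1 m w @ [y]))" "yd (sh (remove1 m w))" "yd (sh w)" "yd (sh (w @ [y]))"
    using yd_sh assms(1) by simp_all
  obtain j k where "sh (remove1 m w @ [y]) = add_at j (sh (remove1 m w))"
      "sh w = add_at k (sh (remove1 m w))"
      "sh (w @ [y]) = add_at (if j = k then Suc k else k) (sh (remove1 m w @ [y]))"
    using sh_last_greatest[OF w assms(2-4)] .
  then show ?thesis using growth_square_add_at[of "sh (remove1 m w)" j k] y by simp
qed

lemma sh_snoc_add_box:
  assumes "distinct (w @ [y])"
  shows "sh w \<hookrightarrow> sh (w @ [y])"
  using yd_sh[of w] yd_sh[OF assms] assms add_at_notin[of "sh w" "ins_row y (ins w)"]
  by (intro add_boxI[where b="(card {i. (i, ins_row y (ins w)) \<in> sh w}, ins_row y (ins w))"])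
     (simp_all add: sh_snoc add_at_def)

definition first_col :: "diagram \<Rightarrow> diagram \<Rightarrow> bool" where
  "first_col d e \<longleftrightarrow> (\<exists>b. b \<notin> d \<and> e = insert b d \<and> fst b = 0)"

definition first_row :: "diagram \<Rightarrow> diagram \<Rightarrow> bool" where
  "first_row d e \<longleftrightarrow> (\<exists>b. b \<notin> d \<and> e = insert b d \<and> snd b = 0)"

lemma first_row_add_at: "yd d \<Longrightarrow> first_row d (add_at 0 d)"
  using add_at_notin[of d 0] by (auto simp: first_row_def add_at_def)

text \<open>
  If a largest letter is appended, the shape grows in the first row, whatever was added before.  So two
  consecutive boxes of this kind only interfere if the other box lies in the first row, too, and then the
  second one is its right neighbour.
\<close>

lemma first_row_growth:
  assumes "yd d" "yd e" "yd d'" "yd e'" "d \<hookrightarrow> e" "first_row d d'" "first_row e e'"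
    and R: "\<And>p. R p (Suc (fst p), snd p)"
  shows "growth_square R d e d' e'"
proof -
  obtain b where b: "b \<notin> d" "d' = insert b d" "snd b = 0" using assms by (auto simp: first_row_def)
  obtain c where c: "c \<notin> e" "e' = insert c e" "snd c = 0" using assms by (auto simp: first_row_def)
  obtain p where p: "p \<notin> d" "e = insert p d" using assms(5) unfolding add_box_def by blast
  show ?thesis
  proof (cases "p = b")
    case True
    have "c = (Suc (fst p), snd p)"
      by (rule box_right[of p d c]) (use assms p c b True in simp_all)
    then have "R p c" using R by simp
    then show ?thesis
      by (rule growth_square_eqI[OF assms(1,2,4) p _ c(1,2), rotated]) (simp add: p b True)
  next
    case False
    have "insert b e = e \<union> d'" using p(2) b(2) by blast
    then have "yd (insert b e)" using young_diagram_Un[OF assms(2,3)] by simp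
    moreover have "b \<notin> e" using p(2) b(1) False by simp
    ultimately have "c = b"
      using addable_row_unique[of c e b] c b(3) assms(4) by simp
    then have "e' = insert p (insert b d)" using c(2) p(2) by blast
    then show ?thesis
      by (rule growth_square_neqI[OF assms(1-4) p(1) b(1) False p(2) b(2)])
  qed
qed

text \<open>
  The mirror image, for prepending a largest letter.
\<close>

lemma first_col_growth:
  assumes "yd d" "yd e" "yd d'" "yd e'" "d \<hookrightarrow> e" "first_col d d'" "first_col e e'"
    and R: "\<And>p. R p (fst p, Suc (snd p))"
  shows "growth_square R d e d' e'"
proof -
  obtain b where b: "b \<notin> d" "d' = insert b d" "fst b = 0" using assms by (auto simp: first_col_def)
  obtain c where c: "c \<notin> e" "e' = insert c e" "fst c = 0" using assms by (auto simp: first_col_def)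
  obtain p where p: "p \<notin> d" "e = insert p d" using assms(5) unfolding add_box_def by blast
  show ?thesis
  proof (cases "p = b")
    case True
    obtain j l where jl: "p = (0, j)" "c = (0, l)" using b c True by (metis prod.collapse)
    have "\<not> Suc j < l"
    proof
      assume "Suc j < l"
      then have "(0, Suc j) \<in> d"
        using young_diagramD(2)[OF assms(4), of 0 l 0 "Suc j"] c(2) p(2) jl by auto
      then show False using young_diagramD(2)[OF assms(1), of 0 "Suc j" 0 j] p(1) jl by auto
    qed
    moreover have "\<not> l \<le> j"
      using young_diagramD(2)[OF assms(2), of 0 j 0 l] p(2) c(1) jl by auto
    ultimately have "R p c" using R[of p] jl by (simp add: le_less_Suc_eq not_less_eq)
    then show ?thesis
      by (rule growth_square_eqI[OF assms(1,2,4) p _ c(1,2), rotated]) (simp add: p b True)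
  next
    case False
    have "insert b e = e \<union> d'" using p(2) b(2) by blast
    then have "yd (insert b e)" using young_diagram_Un[OF assms(2,3)] by simp
    moreover have "b \<notin> e" using p(2) b(1) False by simp
    ultimately have "c = b"
      using addable_col_unique[of c e b] c b(3) assms(4) by simp
    then have "e' = insert p (insert b d)" using c(2) p(2) by blast
    then show ?thesis
      by (rule growth_square_neqI[OF assms(1-4) p(1) b(1) False p(2) b(2)])
  qed
qed

text \<open>
  If the first letter of a word is the largest one, it stays in the first column: a letter appended to the
  word leaves it in place or pushes it down by one row.
\<close>

lemma first_col_step:
  assumes "growth_square next_row d B V C" "first_col d V"
  shows "first_col B C"
proof -
  obtain b where b: "b \<notin> d" "V = insert b d" "fst b = 0" using assms by (auto simp: first_col_def)
  from assms(1) show ?thesis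
  proof (cases rule: growth_squareE)
    case (1 p r)
    then have "p = b" using b by (metis insertE insertI1)
    then obtain j k where jk: "p = (0, j)" "r = (k, Suc j)"
      using b(3) 1(9) unfolding next_row_def by (metis prod.collapse)
    have "k = 0"
    proof (rule ccontr)
      assume "k \<noteq> 0"
      then have "(0, Suc j) \<in> d"
        using young_diagramD(2)[OF 1(3), of k "Suc j" 0 "Suc j"] 1(5,8) jk by auto
      then show False using young_diagramD(2)[OF 1(1), of 0 "Suc j" 0 j] 1(4) jk by auto
    qed
    then show ?thesis using 1(7,8) jk unfolding first_col_def by (intro exI[of _ r]) simp
  next
    case (2 p q)
    then have "q = b" using b by (metis insertE insertI1)
    then show ?thesis using 2 b unfolding first_col_def
      by (intro exI[of _ b]) auto
  qed
qed

text \<open>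
  Prepending a letter obeys the transposed rules of appending one, and prepending and appending
  together obey the rule \<^const>\<open>next_box\<close>, which is that of a jeu de taquin slide.  All of
  this follows by induction on the length, by removing the largest letter and applying the cube.
\<close>

lemma left_rules:
  "distinct w \<Longrightarrow>
   (\<forall>x. distinct (x # w) \<longrightarrow> (\<forall>a\<in>set w. a < x) \<longrightarrow> first_col (sh w) (sh (x # w))) \<and>
   (\<forall>x m. distinct (x # w) \<longrightarrow> m \<in> set w \<longrightarrow> (\<forall>a\<in>set w. a \<le> m) \<longrightarrow> x < m \<longrightarrow>
      growth_square next_col (sh (remove1 m w)) (sh (x # remove1 m w)) (sh w) (sh (x # w))) \<and>
   (\<forall>x. distinct (x # w) \<longrightarrow> sh w \<hookrightarrow> sh (x # w)) \<and>
   (\<forall>x y. distinct (x # w @ [y]) \<longrightarrow>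
      growth_square next_box (sh w) (sh (x # w)) (sh (w @ [y])) (sh (x # w @ [y])))"
  (is "_ \<Longrightarrow> ?C w \<and> ?L w \<and> ?D w \<and> ?J w")
proof (induction "length w" arbitrary: w rule: less_induct)
  case less
  have IH: "?C v" "?L v" "?D v" "?J v" if "distinct v" "length v < length w" for v
    using less.hyps[OF that(2,1)] by blast+
  have rem: "length (remove1 m v) < length v \<and> set (remove1 m v) \<subseteq> set v"
    if "m \<in> set v" for m and v :: "real list"
    using that length_pos_if_in_set[OF that] by (auto simp: length_remove1 dest: set_remove1_subset[THEN subsetD])
  have dist: "distinct (remove1 m v)" "distinct (x # remove1 m v)" "distinct (remove1 m v @ [y])"
      "distinct (x # remove1 m v @ [y])"
    if "distinct (x # v @ [y])" for x y m and v :: "real list"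
    using that set_remove1_subset[of m v] by auto
  have rowx: "growth_square next_row (sh (x # remove1 m v)) (sh (x # remove1 m v @ [y]))
      (sh (x # v)) (sh (x # v @ [y]))"
    if "distinct (x # v @ [y])" "m \<in> set v" "\<forall>a\<in>set v. a \<le> m" "x < m" "y < m" for x y m v
    using row_rule[of "x # v" y m] that by auto
  have C: "?C w"
  proof (intro allI impI)
    fix x assume x: "distinct (x # w)" "\<forall>a\<in>set w. a < x"
    show "first_col (sh w) (sh (x # w))"
    proof (cases w rule: rev_exhaust)
      case Nil
      then show ?thesis by (auto simp: first_col_def sh_def ins_def diagram_of_def)
    next
      case (snoc v y)
      have "growth_square next_row (sh v) (sh (v @ [y])) (sh (x # v)) (sh ((x # v) @ [y]))"
        using row_rule[of "x # v" y x] x snoc less.prems by (auto simp: less_imp_le)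
      then show ?thesis
        using first_col_step[of "sh v" "sh (v @ [y])" "sh (x # v)"] IH(1)[of v] x snoc by simp
    qed
  qed
  have L: "?L w"
  proof (intro allI impI)
    fix x m assume x: "distinct (x # w)" "m \<in> set w" "\<forall>a\<in>set w. a \<le> m" "x < m"
    then obtain v y where w: "w = v @ [y]" by (cases w rule: rev_exhaust) auto
    have v: "distinct v" "length v < length w" "y \<notin> set v" "distinct (x # v)" using x w by auto
    show "growth_square next_col (sh (remove1 m w)) (sh (x # remove1 m w)) (sh w) (sh (x # w))"
    proof (cases "y = m")
      case True
      then have "\<forall>a\<in>set v. a < m" "remove1 m w = v" using x w v by (auto simp: less_le remove1_append)
      then show ?thesis
        using sh_snoc_greatest[of v m] sh_snoc_greatest[of "x # v" m] first_row_add_at yd_add_first_row yd_sh x w True v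
          IH(3)[OF v(1,2)]
        by (auto intro!: first_row_growth simp: next_col_def)
    next
      case False
      then have m: "m \<in> set v" "\<forall>a\<in>set v. a \<le> m" "y < m" using x w by (auto simp: less_le)
      let ?v = "remove1 m v"
      have r: "remove1 m w = ?v @ [y]" using m w by (simp add: remove1_append)
      have xy: "distinct (x # v @ [y])" using x w by simp
      have len: "length ?v < length w" using rem[OF m(1)] v by auto
      \<comment> \<open>The cube of the words that arise from the word without its largest letter by adding \<open>x\<close>, \<open>y\<close> and \<open>m\<close>.\<close>
      have "growth_square next_col (sh (?v @ [y])) (sh (x # ?v @ [y])) (sh (v @ [y])) (sh (x # v @ [y])) \<and>
          growth_square next_box (sh v) (sh (x # v)) (sh (v @ [y])) (sh (x # v @ [y]))"
      proof (rule growth_cube)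
        show "growth_square next_row (sh ?v) (sh (?v @ [y])) (sh v) (sh (v @ [y]))"
          using row_rule[of v y m] xy m by simp
        show "growth_square next_col (sh ?v) (sh (x # ?v)) (sh v) (sh (x # v))"
          using IH(2)[OF v(1,2)] v m x by blast
        show "growth_square next_box (sh ?v) (sh (x # ?v)) (sh (?v @ [y])) (sh (x # ?v @ [y]))"
          using IH(4)[OF dist(1)[OF xy] len] dist(4)[OF xy] by blast
        show "growth_square next_row (sh (x # ?v)) (sh (x # ?v @ [y])) (sh (x # v)) (sh (x # v @ [y]))"
          using rowx[OF xy m(1,2) x(4) m(3)] .
      qed
      then show ?thesis using w r by simp
    qed
  qed
  have D: "?D w"
  proof (intro allI impI)
    fix x assume x: "distinct (x # w)"
    show "sh w \<hookrightarrow> sh (x # w)"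
    proof (cases "\<forall>a\<in>set w. a < x")
      case True
      then obtain b where "b \<notin> sh w" "sh (x # w) = insert b (sh w)" using C x by (auto simp: first_col_def)
      then show ?thesis using yd_sh[OF x] yd_sh[OF less.prems] by (intro add_boxI)
    next
      case False
      then have ne: "set w \<noteq> {}" by auto
      then obtain m where m: "m \<in> set w" "\<forall>a\<in>set w. a \<le> m"
        using Max_in[of "set w"] Max_ge[of "set w"] by blast
      then have "x < m" using False x by (metis distinct.simps(2) leI le_less order_trans)
      then show ?thesis using L x m growth_squareD(4) by blast
    qed
  qed
  \<comment> \<open>In each case the largest of all letters is removed: it is the last, the first or an inner letter.\<close>
  have J: "?J w"
  proof (intro allI impI)
    fix x y assume xy: "distinct (x # w @ [y])"
    have y: "yd (sh w)" "yd (sh (x # w))" "yd (sh (w @ [y]))" "yd (sh (x # w @ [y]))"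
      using xy by (auto intro!: yd_sh)
    have "set (x # w @ [y]) \<noteq> {}" by simp
    then obtain m where m: "m \<in> set (x # w @ [y])" "\<forall>a\<in>set (x # w @ [y]). a \<le> m"
      using Max_in[of "set (x # w @ [y])"] Max_ge[of "set (x # w @ [y])"] by blast
    consider "m = y" | "m = x" | "m \<in> set w" using m(1) by auto
    then show "growth_square next_box (sh w) (sh (x # w)) (sh (w @ [y])) (sh (x # w @ [y]))"
    proof cases
      case 1
      then have "\<forall>a\<in>set w. a < y" "\<forall>a\<in>set (x # w). a < y" using m xy by (auto simp: less_le)
      then have "sh (w @ [y]) = add_at 0 (sh w)" "sh (x # w @ [y]) = add_at 0 (sh (x # w))"
        using sh_snoc_greatest[of w y] sh_snoc_greatest[of "x # w" y] by simp_all
      then show ?thesis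
        using D xy y first_row_add_at by (intro first_row_growth) (auto simp: next_box_def)
    next
      case 2
      then have x: "\<forall>a\<in>set w. a < x" "y < x" using m xy by (auto simp: less_le)
      then have 1: "first_col (sh w) (sh (x # w))" using C xy by simp
      have "growth_square next_row (sh w) (sh (w @ [y])) (sh (x # w)) (sh (x # w @ [y]))"
        using row_rule[of "x # w" y x] xy x by (auto simp: less_imp_le)
      then have 2: "first_col (sh (w @ [y])) (sh (x # w @ [y]))" using 1 by (rule first_col_step)
      have "sh w \<hookrightarrow> sh (w @ [y])" using xy by (intro sh_snoc_add_box) simp
      then have "growth_square next_box (sh w) (sh (w @ [y])) (sh (x # w)) (sh (x # w @ [y]))"
        using 1 2 y by (intro first_col_growth) (auto simp: next_box_def)
      then show ?thesis by (rule growth_square_sym)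
    next
      case 3
      then have lt: "\<forall>a\<in>set w. a \<le> m" "x < m" "y < m" using m xy by (auto simp: less_le)
      let ?w = "remove1 m w"
      have "growth_square next_col (sh (?w @ [y])) (sh (x # ?w @ [y])) (sh (w @ [y])) (sh (x # w @ [y])) \<and>
          growth_square next_box (sh w) (sh (x # w)) (sh (w @ [y])) (sh (x # w @ [y]))"
      proof (rule growth_cube)
        show "growth_square next_row (sh ?w) (sh (?w @ [y])) (sh w) (sh (w @ [y]))"
          using row_rule[of w y m] xy 3 lt by simp
        show "growth_square next_col (sh ?w) (sh (x # ?w)) (sh w) (sh (x # w))"
          using L xy 3 lt by simp
        show "growth_square next_box (sh ?w) (sh (x # ?w)) (sh (?w @ [y])) (sh (x # ?w @ [y]))"
          using IH(4)[OF dist(1)[OF xy]] rem[OF 3] dist(4)[OF xy] by blast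
        show "growth_square next_row (sh (x # ?w)) (sh (x # ?w @ [y])) (sh (x # w)) (sh (x # w @ [y]))"
          using rowx[OF xy 3 lt] .
      qed
      then show ?thesis by simp
    qed
  qed
  show ?case using C L D J by blast
qed

lemmas first_col_Cons = left_rules[THEN conjunct1, rule_format]
  and col_rule = left_rules[THEN conjunct2, THEN conjunct1, rule_format]
  and sh_Cons_add_box = left_rules[THEN conjunct2, THEN conjunct2, THEN conjunct1, rule_format]
  and slide_rule = left_rules[THEN conjunct2, THEN conjunct2, THEN conjunct2, rule_format]

definition transp :: "diagram \<Rightarrow> diagram" where
  "transp d = prod.swap ` d"

lemma mem_transp [simp]: "(i, j) \<in> transp d \<longleftrightarrow> (j, i) \<in> d"
  by (force simp: transp_def image_iff)

lemma swap_in_transp [simp]: "prod.swap b \<in> transp d \<longleftrightarrow> b \<in> d"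
  by (cases b) simp

lemma transp_transp [simp]: "transp (transp d) = d"
  by (simp add: transp_def image_image)

lemma transp_insert: "transp (insert b d) = insert (prod.swap b) (transp d)"
  by (simp add: transp_def)

lemma yd_transp [simp]: "yd (transp d) \<longleftrightarrow> yd d"
proof -
  have "yd (transp d)" if "yd d" for d
    using that unfolding young_diagram_iff by (fastforce simp: transp_def)
  then show ?thesis by (metis transp_transp)
qed

lemma growth_square_transp:
  assumes "growth_square next_row A B V C"
  shows "growth_square next_col (transp A) (transp B) (transp V) (transp C)"
  using assms
proof (cases rule: growth_squareE)
  case (1 p r)
  show ?thesis
  proof (rule growth_square_eqI[of _ _ _ "prod.swap p" _ "prod.swap r"])
    show "transp B = insert (prod.swap p) (transp A)" using 1(5) by (simp only: transp_insert)
    show "transp C = insert (prod.swap r) (transp B)" using 1(8) by (simp only: transp_insert)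
  qed (use 1 in \<open>simp_all add: next_row_def next_col_def\<close>)
next
  case (2 p q)
  show ?thesis
  proof (rule growth_square_neqI[of _ _ _ _ "prod.swap p" "prod.swap q"])
    show "transp B = insert (prod.swap p) (transp A)" using 2(8) by (simp only: transp_insert)
    show "transp V = insert (prod.swap q) (transp A)" using 2(9) by (simp only: transp_insert)
    show "transp C = insert (prod.swap p) (insert (prod.swap q) (transp A))"
      using 2(10) by (simp only: transp_insert)
    show "prod.swap p \<noteq> prod.swap q" using 2(7) by (metis swap_swap)
  qed (use 2 in simp_all)
qed

lemma first_row_transp:
  assumes "first_row d e"
  shows "first_col (transp d) (transp e)"
proof -
  obtain b where "b \<notin> d" "e = insert b d" "snd b = 0" using assms by (auto simp: first_row_def)
  then show ?thesis unfolding first_col_def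
    by (intro exI[of _ "prod.swap b"]) (simp add: transp_insert)
qed

lemma first_col_unique:
  assumes "yd e" "yd e'" "first_col d e" "first_col d e'"
  shows "e = e'"
proof -
  obtain b where b: "b \<notin> d" "e = insert b d" "fst b = 0" using assms by (auto simp: first_col_def)
  obtain c where c: "c \<notin> d" "e' = insert c d" "fst c = 0" using assms by (auto simp: first_col_def)
  show ?thesis using addable_col_unique[of b d c] assms b c by simp
qed

text \<open>
  Prepending a letter obeys the transposed rules of appending one, and these rules determine the shape.
\<close>

theorem sh_rev:
  "distinct w \<Longrightarrow> sh (rev w) = transp (sh w)"
proof (induction "length w" arbitrary: w rule: less_induct)
  case less
  show ?case
  proof (cases w rule: rev_exhaust)
    case Nil
    then show ?thesis by (simp add: transp_def)
  next
    case (snoc v y)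
    have v: "distinct v" "length v < length w" "y \<notin> set v" using snoc less.prems by auto
    have IHv: "sh (rev v) = transp (sh v)" using less.hyps[OF v(2,1)] .
    have yw: "distinct (y # rev v)" "distinct (rev v)" "yd (sh (y # rev v))"
      using v by (auto intro!: yd_sh)
    have y2: "yd (sh w)" using less.prems by (rule yd_sh)
    show ?thesis
    proof (cases "\<forall>a\<in>set v. a < y")
      case True
      have "first_row (sh v) (sh w)"
        using sh_snoc_greatest[OF True] snoc first_row_add_at[OF yd_sh[OF v(1)]] by simp
      then have 1: "first_col (sh (rev v)) (transp (sh w))" using first_row_transp IHv by simp
      have 2: "first_col (sh (rev v)) (sh (y # rev v))"
        using first_col_Cons[OF yw(2,1)] True by simp
      show ?thesis using first_col_unique[OF _ _ 2 1] yw y2 snoc by simp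
    next
      case False
      then have "set v \<noteq> {}" by auto
      then obtain m where m: "m \<in> set v" "\<forall>a\<in>set v. a \<le> m"
        using Max_in[of "set v"] Max_ge[of "set v"] by blast
      then have ym: "y < m" using False v(3) by (metis leI le_less order_trans)
      have len: "length (remove1 m v) < length v"
        using m length_pos_if_in_set[OF m(1)] by (simp add: length_remove1)
      have rr: "rev (remove1 m v) = remove1 m (rev v)"
        using v(1) by (simp add: distinct_remove1_removeAll removeAll_filter_not_eq rev_filter)
      have "y \<notin> set (remove1 m v)" using v set_remove1_subset[of m v] by auto
      then have 1: "sh (rev (remove1 m v)) = transp (sh (remove1 m v))"
        "sh (rev (remove1 m v @ [y])) = transp (sh (remove1 m v @ [y]))"
        using less.hyps[of "remove1 m v"] less.hyps[of "remove1 m v @ [y]"] len v snoc by auto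
      have "growth_square next_row (sh (remove1 m v)) (sh (remove1 m v @ [y])) (sh v) (sh w)"
        using row_rule[of v y m] less.prems snoc m ym by simp
      then have 2: "growth_square next_col (sh (rev (remove1 m v))) (sh (y # rev (remove1 m v)))
          (sh (rev v)) (transp (sh w))"
        using growth_square_transp 1 IHv by fastforce
      have "growth_square next_col (sh (rev (remove1 m v))) (sh (y # rev (remove1 m v)))
          (sh (rev v)) (sh (y # rev v))"
        using col_rule[OF yw(2,1)] m ym rr by simp
      then show ?thesis using growth_square_unique[OF 2] snoc by simp
    qed
  qed
qed

section \<open>Jeu de taquin and the shift\<close>

lemma completeD:
  assumes "L \<in> complete_paths"
  shows "L 0 = {}" "L n \<hookrightarrow> L (Suc n)" "\<exists>n. b \<in> L n" "yd (L n)"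
proof -
  have *: "L 0 = {} \<and> (\<forall>n. L n \<hookrightarrow> L (Suc n)) \<and> (\<forall>b. \<exists>n. b \<in> L n)"
    using assms unfolding complete_paths_def by blast
  show "L 0 = {}" "L n \<hookrightarrow> L (Suc n)" "\<exists>n. b \<in> L n" using * by blast+
  show "yd (L n)" using * unfolding add_box_def by blast
qed

lemma complete_mono:
  assumes "L \<in> complete_paths" "m \<le> n"
  shows "L m \<subseteq> L n"
proof -
  have "L k \<subseteq> L (Suc k)" for k using completeD(2)[OF assms(1), of k] by (auto simp: add_box_def)
  then show ?thesis using lift_Suc_mono_le[of L m n] assms(2) by blast
qed

lemma recording_le_iff:
  assumes "L \<in> complete_paths"
  shows "recording_tableau L b \<le> n \<longleftrightarrow> b \<in> L n"
proof
  have "b \<in> L (recording_tableau L b)"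
    unfolding recording_tableau_def using completeD(3)[OF assms] by (rule LeastI_ex)
  then show "recording_tableau L b \<le> n \<Longrightarrow> b \<in> L n" using complete_mono[OF assms] by blast
qed (simp add: recording_tableau_def Least_le)

lemma recording_infinite:
  assumes "L \<in> complete_paths"
  shows "recording_tableau L \<in> infinite_tableaux"
proof -
  let ?t = "recording_tableau L"
  note le = recording_le_iff[OF assms]
  have eq: "?t b = Suc n \<longleftrightarrow> b \<in> L (Suc n) \<and> b \<notin> L n" for b n
    using le[of b n] le[of b "Suc n"] by auto
  have pos: "?t b \<noteq> 0" for b using le[of b 0] completeD(1)[OF assms] by simp
  have ex: "\<exists>!b. ?t b = Suc n" for n
    using completeD(2)[OF assms, of n] unfolding eq add_box_def by auto
  have inj: "inj ?t"
  proof (rule injI)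
    fix a b assume ab: "?t a = ?t b"
    obtain n where "?t b = Suc n" using pos[of b] not0_implies_Suc by blast
    then show "a = b" using ab ex1E[OF ex[of n]] by metis
  qed
  have "\<exists>b. m = ?t b" if m: "m \<ge> 1" for m
  proof -
    obtain n where "m = Suc n" using m by (cases m) auto
    then show ?thesis using ex1_implies_ex[OF ex[of n]] by metis
  qed
  then have "{1..} \<subseteq> range ?t" by blast
  moreover have "?t b \<in> {1..}" for b using pos[of b] by simp
  ultimately have "range ?t = {1..}" by blast
  then have bij: "bij_betw ?t UNIV {1..}" using inj by (simp add: bij_betw_def)
  have "?t (i, j) < ?t (Suc i, j) \<and> ?t (i, j) < ?t (i, Suc j)" for i j
  proof -
    have "(Suc i, j) \<in> L (?t (Suc i, j))" "(i, Suc j) \<in> L (?t (i, Suc j))"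
      using le by blast+
    then have "?t (i, j) \<le> ?t (Suc i, j)" "?t (i, j) \<le> ?t (i, Suc j)"
      using young_diagramD(2)[OF completeD(4)[OF assms], of "Suc i" j "?t (Suc i, j)" i j]
        young_diagramD(2)[OF completeD(4)[OF assms], of i "Suc j" "?t (i, Suc j)" i j]
      by (simp_all add: le)
    moreover have "?t (i, j) \<noteq> ?t (Suc i, j)" "?t (i, j) \<noteq> ?t (i, Suc j)"
      unfolding inj_eq[OF inj] by simp_all
    ultimately show ?thesis by simp
  qed
  then show ?thesis using bij by (simp add: infinite_tableaux_def)
qed

lemma jdt_path_sum: "fst (jdt_path t k) + snd (jdt_path t k) = k"
  by (induction k) (auto split: prod.splits)

lemma jdt_path_less:
  assumes "t \<in> infinite_tableaux"
  shows "t (jdt_path t k) < t (jdt_path t (Suc k))"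
  using assms by (auto simp: infinite_tableaux_def split: prod.splits)

lemma jdt_path_strict_mono:
  assumes "t \<in> infinite_tableaux"
  shows "strict_mono (\<lambda>k. t (jdt_path t k))"
  using jdt_path_less[OF assms] by (intro strict_monoI_Suc)

text \<open>
  A path box \<open>(i, j)\<close> is reached after \<open>i + j\<close> steps, which turns the definition of \<^const>\<open>jdt\<close> into
  a finite computation.
\<close>

lemma jdt_eq:
  "jdt t b = (if jdt_path t (fst b + snd b) = b then t (jdt_path t (Suc (fst b + snd b))) - 1 else t b - 1)"
proof -
  have ex: "(\<exists>k. b = jdt_path t k) \<longleftrightarrow> jdt_path t (fst b + snd b) = b"
    using jdt_path_sum by metis
  have the: "(THE k. b = jdt_path t k) = fst b + snd b" if "jdt_path t (fst b + snd b) = b"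
    using that jdt_path_sum by (metis (mono_tags, lifting) the_equality)
  show ?thesis unfolding jdt_def ex using the by simp
qed

text \<open>
  Let \<open>L\<close> and \<open>M\<close> be growth paths whose shapes are linked by slides.  The box of \<open>L (n + 1)\<close> that is
  missing in \<open>M n\<close> stays in place until the neighbour with the smaller entry is occupied in \<open>L\<close> and then moves there:
  it runs along the jeu de taquin path.
\<close>

lemma slide_path:
  assumes L: "L \<in> complete_paths" and M0: "M 0 = {}"
    and sq: "\<And>n. growth_square next_box (M n) (L (Suc n)) (M (Suc n)) (L (Suc (Suc n)))"
  defines "t \<equiv> recording_tableau L"
  shows "\<exists>k. jdt_path t k \<notin> M n \<and> L (Suc n) = insert (jdt_path t k) (M n) \<and>
    t (jdt_path t k) \<le> Suc n \<and> Suc n < t (jdt_path t (Suc k))"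
proof (induction n)
  note le = recording_le_iff[OF L, folded t_def]
  have t: "t \<in> infinite_tableaux" unfolding t_def by (rule recording_infinite[OF L])
  {
    case 0
    obtain b where b: "L 1 = insert b {}" "yd (L 1)"
      using completeD[OF L] by (metis One_nat_def add_box_def)
    then have "(0, 0) \<in> L 1" using young_diagramD(2)[OF b(2), of "fst b" "snd b" 0 0] by simp
    then have 1: "L 1 = {(0, 0)}" using b by auto
    moreover have "t (0, 0) \<le> 1" using 1 le by simp
    moreover have "jdt_path t 1 \<notin> L 1" using jdt_path_sum[of t 1] unfolding 1 by auto
    then have "1 < t (jdt_path t 1)" using le[of _ 1] by (meson not_le)
    ultimately show ?case using M0 by (intro exI[of _ 0]) simp
  next
    case (Suc n)
    then obtain k where k: "jdt_path t k \<notin> M n" "L (Suc n) = insert (jdt_path t k) (M n)"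
      "t (jdt_path t k) \<le> Suc n" "Suc n < t (jdt_path t (Suc k))" by blast
    obtain i j where ij: "jdt_path t k = (i, j)" by fastforce
    have path: "jdt_path t (Suc k) = (if t (Suc i, j) < t (i, Suc j) then (Suc i, j) else (i, Suc j))"
      by (simp add: ij)
    have nb: "(Suc i, j) \<notin> A \<and> (i, Suc j) \<notin> A" if "yd A" "(i, j) \<notin> A" for A
      using young_diagramD(2)[OF that(1), of "Suc i" j i j]
        young_diagramD(2)[OF that(1), of i "Suc j" i j] that(2) by auto
    from sq[of n] show ?case
    proof (cases rule: growth_squareE)
      case (1 p r)
      then have p: "p = (i, j)" using k(1,2) ij by (metis insertE insertI1)
      have tr: "t r = Suc (Suc n)" using 1 le[of r "Suc n"] le[of r "Suc (Suc n)"] by auto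
      have r': "Suc (Suc n) < t r'" if "r' \<in> {(Suc i, j), (i, Suc j)}" "r' \<noteq> r" for r'
      proof -
        have "r' \<notin> M n" using nb[OF 1(1)] 1(4) p that by auto
        then have "r' \<notin> L (Suc (Suc n))" using 1(5,8) p that by auto
        then show ?thesis using le by (meson not_le)
      qed
      have r: "r = (Suc i, j) \<or> r = (i, Suc j)" using 1(9) p by (simp add: next_box_def)
      then have "jdt_path t (Suc k) = r"
        using r'[of "(Suc i, j)"] r'[of "(i, Suc j)"] tr unfolding path by auto
      then show ?thesis
        using 1 tr jdt_path_less[OF t, of "Suc k"] by (intro exI[of _ "Suc k"]) simp
    next
      case (2 p q)
      then have p: "p = (i, j)" using k(1,2) ij by (metis insertE insertI1)
      have "jdt_path t (Suc k) \<in> {(Suc i, j), (i, Suc j)}" unfolding path by simp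
      moreover have "(i, j) \<notin> M (Suc n)" using 2(5,7,9) p by simp
      ultimately have "jdt_path t (Suc k) \<notin> L (Suc (Suc n))"
        using nb[OF 2(3)] 2(9,10) p by auto
      then have "Suc (Suc n) < t (jdt_path t (Suc k))" using le by (meson not_le)
      then show ?thesis
        using 2(9,10) k(3) \<open>(i, j) \<notin> M (Suc n)\<close> p ij by (intro exI[of _ k]) simp
    qed
  }
qed

text \<open>
  The path box that \<open>L (n + 1)\<close> has in addition to \<open>M n\<close> shows how the entries change: a box of the jeu de
  taquin path is filled when the next box of the path is filled in \<open>L\<close>, any other box when it is filled in
  \<open>L\<close>, and the time is shifted by one.
\<close>

lemma recording_slide:
  assumes L: "L \<in> complete_paths" and M0: "M 0 = {}"
    and sq: "\<And>n. growth_square next_box (M n) (L (Suc n)) (M (Suc n)) (L (Suc (Suc n)))"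
  shows "M \<in> complete_paths" "recording_tableau M = jdt (recording_tableau L)"
proof -
  define t where "t = recording_tableau L"
  note le = recording_le_iff[OF L, folded t_def]
  have t: "t \<in> infinite_tableaux" unfolding t_def by (rule recording_infinite[OF L])
  note mono = strict_mono_less[OF jdt_path_strict_mono[OF t]]
    strict_mono_less_eq[OF jdt_path_strict_mono[OF t]]
  have iff: "b \<in> M n \<longleftrightarrow> jdt t b \<le> n" for b n
  proof -
    obtain k where k: "jdt_path t k \<notin> M n" "L (Suc n) = insert (jdt_path t k) (M n)"
      "t (jdt_path t k) \<le> Suc n" "Suc n < t (jdt_path t (Suc k))"
      using slide_path[OF assms, of n] unfolding t_def by blast
    have M: "b \<in> M n \<longleftrightarrow> t b \<le> Suc n \<and> b \<noteq> jdt_path t k" using k(1,2) le by auto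
    show ?thesis
    proof (cases "jdt_path t (fst b + snd b) = b")
      case True
      define l where "l = fst b + snd b"
      have b: "b = jdt_path t l" using True by (simp add: l_def)
      have tm: "t (jdt_path t m) \<le> Suc n \<longleftrightarrow> m \<le> k" for m
      proof
        assume "t (jdt_path t m) \<le> Suc n"
        then have "t (jdt_path t m) < t (jdt_path t (Suc k))" using k(4) by simp
        then show "m \<le> k" unfolding mono(1) by simp
      next
        assume "m \<le> k"
        then have "t (jdt_path t m) \<le> t (jdt_path t k)" using mono(2) by simp
        then show "t (jdt_path t m) \<le> Suc n" using k(3) by simp
      qed
      have "b = jdt_path t k \<longleftrightarrow> l = k" using jdt_path_sum b by metis
      then have 1: "b \<in> M n \<longleftrightarrow> l \<le> k \<and> l \<noteq> k" unfolding M using tm[of l] b by simp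
      have "jdt t b = t (jdt_path t (Suc l)) - 1"
        using True by (simp add: jdt_eq l_def del: jdt_path.simps)
      then have "jdt t b \<le> n \<longleftrightarrow> t (jdt_path t (Suc l)) \<le> Suc n" by linarith
      then show ?thesis unfolding 1 tm by linarith
    next
      case False
      then have "b \<noteq> jdt_path t k" using jdt_path_sum by metis
      moreover have "jdt t b = t b - 1" using False by (simp add: jdt_eq)
      ultimately show ?thesis using M by auto
    qed
  qed
  have "(LEAST n. jdt t b \<le> n) = jdt t b" for b by (rule Least_equality) auto
  then have "recording_tableau M = jdt t" 
    by (intro ext) (simp only: recording_tableau_def iff)
  then show "recording_tableau M = jdt (recording_tableau L)" by (simp add: t_def)
  show "M \<in> complete_paths"
    using M0 growth_squareD(2)[OF sq] iff by (auto simp: complete_paths_def)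
qed

lemma rsk_shape_slide:
  assumes "inj x"
  shows "growth_square next_box (rsk_shape (left_shift x) n) (rsk_shape x (Suc n))
    (rsk_shape (left_shift x) (Suc n)) (rsk_shape x (Suc (Suc n)))"
proof -
  let ?w = "map (left_shift x) [0..<n]"
  have 1: "map x [0..<Suc m] = x 0 # map (left_shift x) [0..<m]" for m
    by (simp add: left_shift_def upt_conv_Cons map_Suc_upt[symmetric] comp_def del: upt_Suc)
  have 2: "map (left_shift x) [0..<Suc n] = ?w @ [x (Suc n)]" by (simp add: left_shift_def)
  have "distinct (map x [0..<Suc (Suc n)])"
    using assms by (simp add: distinct_map inj_on_subset[OF assms] del: upt_Suc)
  then have "distinct (x 0 # ?w @ [x (Suc n)])" unfolding 1 2 .
  then show ?thesis
    unfolding rsk_shape_eq_sh 1 2 by (intro slide_rule) auto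
qed

theorem rsk_left_shift:
  assumes "x \<in> rsk_domain"
  shows "left_shift x \<in> rsk_domain" "rsk (left_shift x) = jdt (rsk x)"
proof -
  have x: "range x \<subseteq> {0..1}" "inj x" "rsk_shape x \<in> complete_paths"
    using assms by (auto simp: rsk_domain_def)
  have 0: "rsk_shape (left_shift x) 0 = {}" by (simp add: rsk_shape_eq_sh)
  note * = recording_slide[OF x(3), of "rsk_shape (left_shift x)", OF 0 rsk_shape_slide[OF x(2)]]
  have "inj (left_shift x)" using x(2) by (auto simp: left_shift_def inj_def)
  moreover have "range (left_shift x) \<subseteq> {0..1}" using x(1) by (auto simp: left_shift_def)
  ultimately show "left_shift x \<in> rsk_domain" using *(1) by (simp add: rsk_domain_def)
  show "rsk (left_shift x) = jdt (rsk x)" using *(2) by (simp add: rsk_def)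
qed

section \<open>Insertion into increasing rows\<close>

text \<open>
  The part of the tableau conditions that the comparison of two insertions needs: increasing rows and
  distinct entries.
\<close>

primrec row_strict :: "real list list \<Rightarrow> bool" where
  "row_strict [] \<longleftrightarrow> True"
| "row_strict (r # P) \<longleftrightarrow> sorted_wrt (<) r \<and> set r \<inter> entries P = {} \<and> row_strict P"

lemma row_insert_strict:
  assumes "row_insert y r = (r', z)" "sorted_wrt (<) r" "y \<notin> set r"
  shows "sorted_wrt (<) r' \<and> y \<in> set r' \<and> (case z of None \<Rightarrow> \<forall>a\<in>set r. a < y
    | Some z \<Rightarrow> y < z \<and> z \<in> set r \<and> z \<notin> set r' \<and> (\<forall>a\<in>set r. y < a \<longrightarrow> z \<le> a))"
  using assms
proof (induction y r arbitrary: r' z rule: row_insert.induct)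
  case (2 y a r)
  show ?case
  proof (cases "y < a")
    case True
    have lt: "\<forall>x\<in>set r. a < x" using 2(3) by simp
    have "\<forall>x\<in>set r. y < x \<and> a \<le> x" "a \<notin> set r"
      using lt True by (metis less_imp_le less_trans, blast)
    then show ?thesis using 2(2-) True by auto
  next
    case False
    obtain r1 z1 where r1: "row_insert y r = (r1, z1)" by fastforce
    then have eq: "r' = a # r1" "z = z1" using 2(2) False by auto
    have IH: "sorted_wrt (<) r1 \<and> y \<in> set r1 \<and> (case z1 of None \<Rightarrow> \<forall>a\<in>set r. a < y
      | Some z \<Rightarrow> y < z \<and> z \<in> set r \<and> z \<notin> set r1 \<and> (\<forall>a\<in>set r. y < a \<longrightarrow> z \<le> a))"
      using 2(1)[OF False r1] 2(3,4) by auto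
    have "a < y" using False 2(4) by auto
    moreover have "set r1 \<subseteq> insert y (set r)" using set_row_insert[OF r1] by auto
    ultimately show ?thesis using IH 2(3) eq by (auto split: option.splits)
  qed
qed auto

lemma row_strict_rs_insert:
  "row_strict P \<Longrightarrow> y \<notin> entries P \<Longrightarrow> row_strict (rs_insert y P)"
proof (induction P arbitrary: y)
  case (Cons r P)
  obtain r' z where r: "row_insert y r = (r', z)" by fastforce
  have "sorted_wrt (<) r'" "case z of None \<Rightarrow> True | Some z \<Rightarrow> z \<in> set r \<and> z \<notin> set r'"
    using row_insert_strict[OF r] Cons.prems by (auto split: option.splits)
  moreover have "set r' \<subseteq> insert y (set r)" using set_row_insert[OF r] by auto
  ultimately show ?case
    using Cons by (cases z) (auto simp: r entries_rs_insert)
qed simp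

lemma row_strict_ins: "distinct w \<Longrightarrow> row_strict (ins w)"
  by (induction w rule: rev_induct) (auto intro: row_strict_rs_insert)

text \<open>
  The larger of two letters replaces an entry that is at least as large, or its insertion ends in the row.  So
  the order of the two letters is the same in the next row.
\<close>

lemma ins_row_antimono:
  "row_strict P \<Longrightarrow> u \<notin> entries P \<Longrightarrow> v \<notin> entries P \<Longrightarrow> u \<le> v \<Longrightarrow> ins_row v P \<le> ins_row u P"
proof (induction P arbitrary: u v)
  case (Cons r P)
  obtain r1 z1 where r1: "row_insert u r = (r1, z1)" by fastforce
  obtain r2 z2 where r2: "row_insert v r = (r2, z2)" by fastforce
  note s1 = row_insert_strict[OF r1] and s2 = row_insert_strict[OF r2]
  show ?case
  proof (cases z2)
    case (Some b)
    then have b: "v < b" "b \<in> set r" using s2 Cons.prems by auto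
    have "z1 \<noteq> None"
    proof
      assume "z1 = None"
      then have "\<forall>a\<in>set r. a < u" using s1 Cons.prems by simp
      then show False using b Cons.prems(4) by force
    qed
    then obtain a where a: "z1 = Some a" by blast
    then have "a \<le> b" "a \<in> set r" using s1 b Cons.prems by auto
    then have "ins_row b P \<le> ins_row a P" using Cons b by (intro Cons.IH) auto
    then show ?thesis by (simp add: r1 r2 Some a)
  qed (simp add: r2)
qed simp

text \<open>
  If \<open>u\<close> is inserted after the larger letter \<open>y\<close>, it replaces an entry that does not exceed \<open>y\<close>.  So the two
  letters that reach the next row form a descent again, and the insertion of \<open>u\<close> cannot end in the row in
  which the one of \<open>y\<close> ended.
\<close>

lemma ins_row_descent:
  "row_strict P \<Longrightarrow> u \<notin> entries P \<Longrightarrow> y \<notin> entries P \<Longrightarrow> u < y \<Longrightarrow>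
    ins_row y P < ins_row u (rs_insert y P)"
proof (induction P arbitrary: u y)
  case (Cons r P)
  obtain r1 z1 where r1: "row_insert y r = (r1, z1)" by fastforce
  obtain r2 z2 where r2: "row_insert u r1 = (r2, z2)" by fastforce
  have s1: "sorted_wrt (<) r1" "y \<in> set r1" "case z1 of None \<Rightarrow> True | Some z \<Rightarrow> y < z \<and> z \<in> set r"
    using row_insert_strict[OF r1] Cons.prems by (auto split: option.splits)
  have sub: "set r1 \<subseteq> insert y (set r)" using set_row_insert[OF r1] by auto
  then have "u \<notin> set r1" using Cons.prems by auto
  note s2 = row_insert_strict[OF r2 s1(1) this]
  obtain v where v: "z2 = Some v" using s2 s1(2) Cons.prems(4) by (cases z2) auto
  have v': "v \<le> y" "v \<in> insert y (set r)" using s2 v s1(2) Cons.prems(4) sub by auto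
  show ?case
  proof (cases z1)
    case None
    then show ?thesis by (simp add: r1 r2 v)
  next
    case (Some z)
    then have "y < z" "z \<in> set r" using s1(3) by auto
    then have "ins_row z P < ins_row v (rs_insert z P)"
      using Cons.prems v' by (intro Cons.IH) auto
    then show ?thesis by (simp add: r1 r2 v Some)
  qed
qed simp

definition new_box :: "diagram \<Rightarrow> diagram \<Rightarrow> box" where
  "new_box d e = (THE b. b \<in> e - d)"

lemma new_box_insert: "b \<notin> d \<Longrightarrow> new_box d (insert b d) = b"
  unfolding new_box_def by (rule the_equality) auto

lemma new_box:
  assumes "d \<hookrightarrow> e"
  shows "new_box d e \<notin> d" "e = insert (new_box d e) d"
proof -
  obtain b where b: "b \<notin> d" "e = insert b d" using assms unfolding add_box_def by blast
  then have "new_box d e = b" by (simp add: new_box_insert)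
  then show "new_box d e \<notin> d" "e = insert (new_box d e) d" using b by auto
qed

lemma snd_new_box_sh:
  assumes "distinct w"
  shows "snd (new_box (sh w) (sh (w @ [y]))) = ins_row y (ins w)"
  unfolding sh_snoc add_at_def by (subst new_box_insert) (simp_all add: add_at_notin yd_sh assms)

text \<open>
  The boxes that can be added to a diagram form an antichain, so further up means further to the right.
\<close>

lemma new_col_mono:
  assumes "distinct (w @ [u])" "distinct (w @ [v])" "u \<le> v"
  shows "fst (new_box (sh w) (sh (w @ [u]))) \<le> fst (new_box (sh w) (sh (w @ [v])))"
proof (rule ccontr)
  let ?p = "new_box (sh w) (sh (w @ [u]))" and ?q = "new_box (sh w) (sh (w @ [v]))"
  assume *: "\<not> fst ?p \<le> fst ?q"
  note p = new_box[OF sh_snoc_add_box[OF assms(1)]] and q = new_box[OF sh_snoc_add_box[OF assms(2)]]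
  have "yd (insert ?p (sh w))" "yd (insert ?q (sh w))"
    using yd_sh[OF assms(1)] yd_sh[OF assms(2)] p(2) q(2) by simp_all
  then have "snd ?p < snd ?q" using addable_antichain[OF _ _ p(1) q(1)] * by force
  moreover have "ins_row v (ins w) \<le> ins_row u (ins w)"
    using assms by (intro ins_row_antimono row_strict_ins) auto
  ultimately show False using assms by (simp add: snd_new_box_sh)
qed

lemma new_row_descent:
  assumes "distinct (w @ [y, u])" "u < y"
  shows "snd (new_box (sh w) (sh (w @ [y]))) < snd (new_box (sh (w @ [y])) (sh (w @ [y, u])))"
proof -
  have "distinct (w @ [y])" "distinct w" using assms by auto
  moreover have "ins_row y (ins w) < ins_row u (rs_insert y (ins w))"
    using assms by (intro ins_row_descent row_strict_ins) auto
  ultimately show ?thesis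
    using snd_new_box_sh[of w y] snd_new_box_sh[of "w @ [y]" u] by simp
qed

section \<open>Counting words by the growth of their shapes\<close>

lemma Nil_notin_rs_insert: "[] \<notin> set P \<Longrightarrow> [] \<notin> set (rs_insert y P)"
proof (induction P arbitrary: y)
  case (Cons r P)
  obtain r' z where r: "row_insert y r = (r', z)" by fastforce
  have "r' \<noteq> []" using length_row_insert[OF r] Cons.prems by (cases z) auto
  then show ?case using Cons by (cases z) (auto simp: r)
qed simp

lemma Nil_notin_ins: "[] \<notin> set (ins w)"
  by (induction w rule: rev_induct) (auto dest: Nil_notin_rs_insert)

lemma diagram_of_inject:
  assumes "diagram_of l = diagram_of l'" "0 \<notin> set l" "0 \<notin> set l'"
  shows "l = l'"
proof -
  have eq: "j < length l \<and> i < l ! j \<longleftrightarrow> j < length l' \<and> i < l' ! j" for i j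
    using assms(1) by (auto simp: set_eq_iff)
  have pos: "j < length l \<Longrightarrow> 0 < l ! j" "j < length l' \<Longrightarrow> 0 < l' ! j" for j
    using assms(2,3) by (metis neq0_conv nth_mem)+
  have "j < length l \<longleftrightarrow> j < length l'" for j using eq[of j 0] pos by blast
  then have len: "length l = length l'" by (metis linorder_neqE_nat less_irrefl)
  show ?thesis
  proof (rule nth_equalityI[OF len])
    fix j assume "j < length l"
    then have "i < l ! j \<longleftrightarrow> i < l' ! j" for i using eq[of j i] len by simp
    then show "l ! j = l' ! j" by (metis linorder_neqE_nat less_irrefl)
  qed
qed

lemma sh_eq_lengths:
  assumes "sh v = sh w"
  shows "map length (ins v) = map length (ins w)"
  using assms Nil_notin_ins[of v] Nil_notin_ins[of w]
  by (intro diagram_of_inject) (auto simp: sh_def)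

text \<open>The insertion can be undone once the shape before the insertion is known.\<close>

lemma rs_insert_inject:
  assumes "rs_insert y P = rs_insert y' P'" "map length P = map length P'"
    "row_strict P" "row_strict P'" "y \<notin> entries P" "y' \<notin> entries P'"
  shows "y = y' \<and> P = P'"
  using assms
proof (induction P arbitrary: y y' P')
  case Nil
  then show ?case by simp
next
  case (Cons r P)
  then obtain s R where P': "P' = s # R" "length r = length s" "map length P = map length R"
    by (cases P') auto
  obtain r1 z1 where r1: "row_insert y r = (r1, z1)" by fastforce
  obtain s1 z2 where s1: "row_insert y' s = (s1, z2)" by fastforce
  have eq: "r1 = s1" using Cons.prems(1) by (auto simp: P' r1 s1 split: option.splits)
  have z: "z1 = None \<longleftrightarrow> z2 = None"
    using length_row_insert[OF r1] length_row_insert[OF s1] eq P'(2) by (auto split: if_splits)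
  have r: "sorted_wrt (<) r" "y \<notin> set r" "sorted_wrt (<) s" "y' \<notin> set s"
    using Cons.prems P' by auto
  note sr = row_insert_strict[OF r1 r(1,2)] and ss = row_insert_strict[OF s1 r(3,4)]
  show ?case
  proof (cases z1)
    case None
    then have "z2 = None" using z by simp
    then show ?thesis
      using None eq row_insert_None[of y r r1] row_insert_None[of y' s s1] r1 s1 Cons.prems(1) P'(1)
      by simp
  next
    case (Some a)
    then obtain b where b: "z2 = Some b" using z by auto
    have "a \<notin> entries P" "b \<notin> entries R" using sr ss Some b Cons.prems P' by auto
    then have ab: "a = b" "P = R"
      using Cons.IH[of a b R] Cons.prems P' Some b by (auto simp: r1 s1)
    have sets: "insert a (set r1) = insert y (set r)" "insert a (set s1) = insert y' (set s)"
      using set_row_insert[OF r1] set_row_insert[OF s1] Some b ab by auto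
    have "y' \<le> y"
    proof (rule ccontr)
      assume "\<not> y' \<le> y"
      moreover have "y' \<in> insert y (set r)" using ss eq sets by auto
      ultimately have "a \<le> y'" using sr Some by auto
      then show False using ss b ab by auto
    qed
    moreover have "y \<le> y'"
    proof (rule ccontr)
      assume "\<not> y \<le> y'"
      moreover have "y \<in> insert y' (set s)" using sr eq sets by auto
      ultimately have "a \<le> y" using ss b ab by auto
      then show False using sr Some by auto
    qed
    ultimately have y: "y = y'" by simp
    then have "set r = set s" using sets r eq by auto
    then have "r = s" using r by (metis sorted_distinct_set_unique strict_sorted_iff)
    then show ?thesis using y ab P' by simp
  qed
qed

text \<open>
  The shapes of the subwords of the smallest letters; this path encodes the insertion tableau.
\<close>

function value_path :: "real list \<Rightarrow> diagram list" where
  "value_path w = (if w = [] then [{}] else value_path (remove1 (Max (set w)) w) @ [sh w])"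
  by auto
termination
  by (relation "Wellfounded.measure length")
     (auto simp: length_remove1 Max_in)

declare value_path.simps [simp del]

text \<open>
  The shapes of the initial subwords; this path encodes the recording tableau.
\<close>

definition time_path :: "real list \<Rightarrow> diagram list" where
  "time_path w = map (\<lambda>n. sh (take n w)) [0..<Suc (length w)]"

lemma time_path_snoc: "time_path (w @ [y]) = time_path w @ [sh (w @ [y])]"
  by (simp add: time_path_def)

primrec growth_paths :: "nat \<Rightarrow> diagram list set" where
  "growth_paths 0 = {[{}]}"
| "growth_paths (Suc n) = (\<Union>l\<in>growth_paths n. (\<lambda>e. l @ [e]) ` {e. last l \<hookrightarrow> e})"

lemma growth_paths_last:
  "l \<in> growth_paths n \<Longrightarrow> l \<noteq> [] \<and> yd (last l) \<and> card (last l) = n \<and> length l = Suc n"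
  by (induction n arbitrary: l)
     (auto simp: young_diagram_iff[of "{}"] add_box_def young_diagramD(1) dest: add_box_card)

lemma finite_growth_paths: "finite (growth_paths n)"
  by (induction n) (use growth_paths_last card_add_box(1) in auto)

text \<open>
  The paths to \<open>d\<close> satisfy the recursion of the number of standard tableaux.
\<close>

lemma card_growth_paths_to:
  "yd d \<Longrightarrow> card d = n \<Longrightarrow> card {l \<in> growth_paths n. last l = d} = num_syt d"
proof (induction n arbitrary: d)
  case 0
  then have "d = {}" by (auto simp: young_diagram_iff)
  then have "{l \<in> growth_paths 0. last l = d} = {[{}]}" by auto
  then show ?case by (simp add: num_syt_empty \<open>d = {}\<close>)
next
  case (Suc n)
  then have ne: "d \<noteq> {}" by auto
  let ?A = "\<lambda>c. (\<lambda>l. l @ [d]) ` {l \<in> growth_paths n. last l = c}"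
  have eq: "{l \<in> growth_paths (Suc n). last l = d} = (\<Union>c\<in>{c. c \<hookrightarrow> d}. ?A c)"
    by auto
  have "card (\<Union>c\<in>{c. c \<hookrightarrow> d}. ?A c) = (\<Sum>c | c \<hookrightarrow> d. card (?A c))"
    using card_add_box(2)[OF Suc.prems(1)] finite_growth_paths
    by (intro card_UN_disjoint) auto
  also have "\<dots> = (\<Sum>c | c \<hookrightarrow> d. num_syt c)"
  proof (rule sum.cong[OF refl])
    fix c assume "c \<in> {c. c \<hookrightarrow> d}"
    then have c: "yd c" "card c = n" using add_box_card[of c d] Suc.prems(2) by (auto simp: add_box_def)
    have "card (?A c) = card {l \<in> growth_paths n. last l = c}"
      by (intro card_image inj_onI) simp
    then show "card (?A c) = num_syt c" using Suc.IH[OF c] by simp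
  qed
  also have "\<dots> = num_syt d" using num_syt_rec[OF Suc.prems(1) ne] by simp
  finally show ?case unfolding eq .
qed

lemma Max_list:
  assumes "w \<noteq> []"
  shows "Max (set w) \<in> set w" "\<forall>a\<in>set w. a \<le> Max (set w)"
  using assms by auto

lemma add_at_inject:
  assumes "add_at j d = add_at k d" "yd d"
  shows "j = k"
  using assms add_at_notin[OF assms(2), of j] add_at_notin[OF assms(2), of k]
  unfolding add_at_def by (metis insertE insertI1 prod.inject)

lemma sh_eq_add_at_place:
  assumes "distinct w" "w \<noteq> []"
  obtains k where "ins w = place (Max (set w)) k (ins (remove1 (Max (set w)) w))"
    "sh w = add_at k (sh (remove1 (Max (set w)) w))"
proof -
  obtain k where k: "k \<le> length (ins (remove1 (Max (set w)) w))"
    "ins w = place (Max (set w)) k (ins (remove1 (Max (set w)) w))"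
    using ins_eq_place[OF assms(1) Max_list[OF assms(2)]] by blast
  then show thesis using that[of k] shape_place[OF k(1), of "Max (set w)"] by (simp add: sh_def)
qed

lemma value_path_growth:
  "distinct w \<Longrightarrow> value_path w \<in> growth_paths (length w) \<and> last (value_path w) = sh w"
proof (induction w rule: value_path.induct)
  case (1 w)
  show ?case
  proof (cases "w = []")
    case True
    then show ?thesis by (simp add: value_path.simps)
  next
    case False
    let ?v = "remove1 (Max (set w)) w"
    have d: "distinct ?v" using 1(2) by simp
    have len: "length w = Suc (length ?v)"
      using Max_list(1)[OF False] length_pos_if_in_set[OF Max_list(1)[OF False]]
      by (simp add: length_remove1)
    obtain k where k: "sh w = add_at k (sh ?v)" using sh_eq_add_at_place[OF 1(2) False] .
    have "sh ?v \<hookrightarrow> sh w"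
      using yd_sh[OF d] yd_sh[OF 1(2)] add_at_notin[OF yd_sh[OF d], of k] k
      by (intro add_boxI[where b="(card {i. (i, k) \<in> sh ?v}, k)"]) (simp_all add: add_at_def)
    then show ?thesis
      using 1(1)[OF False d] False unfolding len
      by (subst (1 2) value_path.simps) (auto intro!: bexI[of _ "value_path ?v"])
  qed
qed

lemma value_path_inject:
  "distinct w \<Longrightarrow> distinct w' \<Longrightarrow> set w = set w' \<Longrightarrow> value_path w = value_path w' \<Longrightarrow> ins w = ins w'"
proof (induction w arbitrary: w' rule: value_path.induct)
  case (1 w)
  show ?case
  proof (cases "w = []")
    case True
    then show ?thesis using 1(4) by simp
  next
    case False
    then have ne: "w' \<noteq> []" using 1(4) by auto
    let ?v = "remove1 (Max (set w)) w" and ?v' = "remove1 (Max (set w')) w'"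
    have eq: "value_path ?v = value_path ?v'" "sh w = sh w'"
      using 1(5) False ne by (simp_all add: value_path.simps[of w] value_path.simps[of w'])
    have d: "distinct ?v" "distinct ?v'" using 1(2,3) by simp_all
    have "set ?v = set ?v'" using 1(2-4) by simp
    then have IH: "ins ?v = ins ?v'" using 1(1)[OF False d _ eq(1)] by simp
    obtain k where k: "ins w = place (Max (set w)) k (ins ?v)" "sh w = add_at k (sh ?v)"
      using sh_eq_add_at_place[OF 1(2) False] .
    obtain k' where k': "ins w' = place (Max (set w')) k' (ins ?v')" "sh w' = add_at k' (sh ?v')"
      using sh_eq_add_at_place[OF 1(3) ne] .
    have "k = k'"
      using add_at_inject[OF _ yd_sh[OF d(1)], of k k'] k(2) k'(2) eq(2) IH by (simp add: sh_def)
    then show ?thesis using k(1) k'(1) IH 1(4) by simp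
  qed
qed

text \<open>The Robinson--Schensted correspondence is injective: the first path gives the insertion tableau,
  the second one tells where to start the reverse insertions.\<close>

lemma time_path_inject:
  "distinct w \<Longrightarrow> distinct w' \<Longrightarrow> ins w = ins w' \<Longrightarrow> time_path w = time_path w' \<Longrightarrow> w = w'"
proof (induction w arbitrary: w' rule: rev_induct)
  case Nil
  have "length (time_path w') = Suc 0" using Nil(4) by (simp add: time_path_def flip: Nil(4))
  then show ?case by (simp add: time_path_def)
next
  case (snoc y v)
  have "length (time_path w') = Suc (Suc (length v))"
    using arg_cong[OF snoc.prems(4), of length] by (simp add: time_path_def)
  then have "w' \<noteq> []" by (auto simp: time_path_def)
  then obtain v' y' where w': "w' = v' @ [y']" by (metis rev_exhaust)
  have tp: "time_path v = time_path v'" using snoc.prems(4) by (simp add: time_path_snoc w')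
  have last: "last (time_path u) = sh u" for u by (simp add: time_path_def)
  have "sh v = sh v'" using tp last by metis
  then have len: "map length (ins v) = map length (ins v')" by (rule sh_eq_lengths)
  have d: "distinct v" "y \<notin> set v" "distinct v'" "y' \<notin> set v'" using snoc.prems w' by auto
  have "y = y' \<and> ins v = ins v'"
    using snoc.prems(3) len d by (intro rs_insert_inject) (simp_all add: w' row_strict_ins)
  then show ?case using snoc.IH[of v'] d tp w' by simp
qed

text \<open>
  For words with a given \<^const>\<open>time_path\<close>, the path \<^const>\<open>value_path\<close> ends in the same diagram and
  determines the word.
\<close>

lemma card_words_time_path:
  assumes "finite S"
  shows "card {w \<in> permutations_of_set S. time_path w = l} \<le> num_syt (last l)"
proof (cases "{w \<in> permutations_of_set S. time_path w = l} = {}")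
  case False
  let ?W = "{w \<in> permutations_of_set S. time_path w = l}"
  have last: "last (time_path u) = sh u" for u by (simp add: time_path_def)
  have W: "distinct w" "set w = S" "length w = card S" "sh w = last l" "time_path w = l" if "w \<in> ?W" for w
    using that last[of w] by (auto simp: permutations_of_set_def distinct_card)
  obtain w0 where w0: "w0 \<in> ?W" using False by blast
  have "length l = Suc (card S)" using W[OF w0] by (simp add: time_path_def flip: W(5)[OF w0])
  have mem: "value_path w \<in> {p \<in> growth_paths (card S). last p = last l}" if "w \<in> ?W" for w
    using value_path_growth[OF W(1)[OF that]] W(3,4)[OF that] by simp
  have "card (last l) = card S" "yd (last l)"
    using mem[OF w0] growth_paths_last by fastforce+
  moreover have "card ?W \<le> card {p \<in> growth_paths (card S). last p = last l}"
  proof (rule card_inj_on_le[where f=value_path])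
    show "inj_on value_path ?W"
      using W value_path_inject time_path_inject by (intro inj_onI) metis
    show "value_path ` ?W \<subseteq> {p \<in> growth_paths (card S). last p = last l}" using mem by blast
    show "finite {p \<in> growth_paths (card S). last p = last l}"
      using finite_growth_paths[of "card S"] by simp
  qed
  ultimately show ?thesis using card_growth_paths_to[of "last l"] by simp
next
  case True
  show ?thesis unfolding True by simp
qed

section \<open>Plancherel averages\<close>

definition diagrams :: "nat \<Rightarrow> diagram set" where
  "diagrams n = {d. yd d \<and> card d = n}"

abbreviation up :: "diagram \<Rightarrow> diagram set" where
  "up d \<equiv> {e. d \<hookrightarrow> e}"

abbreviation dim :: "diagram \<Rightarrow> real" where
  "dim d \<equiv> real (num_syt d)"

lemma dim_pos: "yd d \<Longrightarrow> dim d > 0"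
  using num_syt_pos by simp

lemma finite_up: "yd d \<Longrightarrow> finite (up d)"
  by (rule card_add_box(1))

lemma up_diagrams: "d \<in> diagrams n \<Longrightarrow> e \<in> up d \<Longrightarrow> e \<in> diagrams (Suc n)"
  by (auto simp: diagrams_def add_box_def young_diagramD(1))

lemma diagrams_add_box: "d \<in> diagrams n \<Longrightarrow> d \<hookrightarrow> e \<Longrightarrow> e \<in> diagrams (Suc n)"
  using up_diagrams by simp

lemma diagrams_remove_box: "e \<in> diagrams (Suc n) \<Longrightarrow> d \<hookrightarrow> e \<Longrightarrow> d \<in> diagrams n"
  using add_box_card[of d e] by (simp add: diagrams_def add_box_def)

lemma diagrams_0: "diagrams 0 = {{}}"
  by (auto simp: diagrams_def young_diagram_iff)

lemma finite_diagrams: "finite (diagrams n)"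
proof -
  have "diagrams n \<subseteq> last ` growth_paths n"
  proof
    fix d assume "d \<in> diagrams n"
    then have d: "yd d" "card d = n" by (auto simp: diagrams_def)
    have "card {l \<in> growth_paths n. last l = d} \<noteq> 0"
      unfolding card_growth_paths_to[OF d] using num_syt_pos[OF d(1)] by simp
    then have "{l \<in> growth_paths n. last l = d} \<noteq> {}" by (metis card.empty)
    then show "d \<in> last ` growth_paths n" by blast
  qed
  then show ?thesis using finite_growth_paths finite_surj by blast
qed

lemma sum_up_dim: "yd d \<Longrightarrow> (\<Sum>e\<in>up d. dim e) = (real (card d) + 1) * dim d"
  using sum_num_syt[of d] by (metis of_nat_1 of_nat_add of_nat_mult of_nat_sum)

lemma sum_diagrams_up:
  "(\<Sum>d\<in>diagrams n. \<Sum>e\<in>up d. \<phi> d e) = (\<Sum>e\<in>diagrams (Suc n). \<Sum>d | d \<hookrightarrow> e. \<phi> d e)"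
proof -
  have fin: "finite {d. d \<hookrightarrow> e}" if "e \<in> diagrams (Suc n)" for e
    using that card_add_box(2) by (auto simp: diagrams_def)
  have finu: "finite (up d)" if "d \<in> diagrams n" for d
    using that finite_up by (auto simp: diagrams_def)
  have "(\<Sum>d\<in>diagrams n. \<Sum>e\<in>up d. \<phi> d e) = (\<Sum>(d, e)\<in>(SIGMA d:diagrams n. up d). \<phi> d e)"
    using finite_diagrams finu by (subst sum.Sigma) auto
  also have "\<dots> = (\<Sum>(e, d)\<in>(SIGMA e:diagrams (Suc n). {d. d \<hookrightarrow> e}). \<phi> d e)"
  proof (rule sum.reindex_bij_witness[where i=prod.swap and j=prod.swap])
    fix x assume "x \<in> (SIGMA d:diagrams n. up d)"
    then show "prod.swap x \<in> (SIGMA e:diagrams (Suc n). {d. d \<hookrightarrow> e})"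
      using up_diagrams by auto
  next
    fix x assume "x \<in> (SIGMA e:diagrams (Suc n). {d. d \<hookrightarrow> e})"
    then show "prod.swap x \<in> (SIGMA d:diagrams n. up d)"
      using diagrams_remove_box by auto
  qed auto
  also have "\<dots> = (\<Sum>e\<in>diagrams (Suc n). \<Sum>d | d \<hookrightarrow> e. \<phi> d e)"
    using finite_diagrams fin by (subst sum.Sigma) auto
  finally show ?thesis .
qed

text \<open>
  The dimension of \<open>e\<close> is the sum of the dimensions below it, and the dimensions above \<open>d\<close> add up to
  \<open>n + 1\<close> times the dimension of \<open>d\<close>; so the sum of squares grows by the factor \<open>n + 1\<close>.
\<close>

lemma sum_diagrams_dim_sq: "(\<Sum>d\<in>diagrams n. dim d ^ 2) = fact n"
proof (induction n)
  case 0
  then show ?case by (simp add: diagrams_0 num_syt_empty)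
next
  case (Suc n)
  have "(\<Sum>e\<in>diagrams (Suc n). dim e ^ 2) = (\<Sum>e\<in>diagrams (Suc n). \<Sum>d | d \<hookrightarrow> e. dim d * dim e)"
  proof (rule sum.cong[OF refl])
    fix e assume "e \<in> diagrams (Suc n)"
    then have e: "yd e" "e \<noteq> {}" by (auto simp: diagrams_def)
    have "dim e = (\<Sum>d | d \<hookrightarrow> e. dim d)" using num_syt_rec[OF e] by simp
    then show "dim e ^ 2 = (\<Sum>d | d \<hookrightarrow> e. dim d * dim e)"
      by (simp add: power2_eq_square flip: sum_distrib_right)
  qed
  also have "\<dots> = (\<Sum>d\<in>diagrams n. \<Sum>e\<in>up d. dim d * dim e)"
    by (rule sum_diagrams_up[symmetric])
  also have "\<dots> = (\<Sum>d\<in>diagrams n. (real n + 1) * dim d ^ 2)"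
    by (intro sum.cong refl) (auto simp: diagrams_def sum_up_dim power2_eq_square simp flip: sum_distrib_left)
  also have "\<dots> = (real n + 1) * (\<Sum>d\<in>diagrams n. dim d ^ 2)" by (simp only: sum_distrib_left)
  also have "\<dots> = fact (Suc n)" using Suc by simp
  finally show ?case .
qed

text \<open>
  Averages over the diagram at time \<open>n\<close> of the Plancherel growth process, over the diagrams at times
  \<open>n\<close> and \<open>n + 1\<close>, and over those at times \<open>n\<close>, \<open>n + 1\<close> and \<open>n + 2\<close>.
\<close>

definition avg1 :: "nat \<Rightarrow> (diagram \<Rightarrow> real) \<Rightarrow> real" where
  "avg1 n \<phi> = (\<Sum>d\<in>diagrams n. dim d * dim d / fact n * \<phi> d)"

definition avg2 :: "nat \<Rightarrow> (diagram \<Rightarrow> diagram \<Rightarrow> real) \<Rightarrow> real" where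
  "avg2 n \<phi> = (\<Sum>d\<in>diagrams n. \<Sum>e\<in>up d. dim d * dim e / fact (Suc n) * \<phi> d e)"

definition avg3 :: "nat \<Rightarrow> (diagram \<Rightarrow> diagram \<Rightarrow> diagram \<Rightarrow> real) \<Rightarrow> real" where
  "avg3 n \<phi> = (\<Sum>d\<in>diagrams n. \<Sum>e\<in>up d. \<Sum>g\<in>up e. dim d * dim g / fact (Suc (Suc n)) * \<phi> d e g)"

lemma yd_of: "d \<in> diagrams n \<Longrightarrow> yd d" "e \<in> up d \<Longrightarrow> yd e" "e \<in> up d \<Longrightarrow> yd d"
  by (auto simp: diagrams_def add_box_def)

lemma plancherel_transition_up:
  "d \<in> diagrams n \<Longrightarrow> e \<in> up d \<Longrightarrow> plancherel_transition d e = dim e / ((real n + 1) * dim d)"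
  by (simp add: plancherel_transition_def diagrams_def algebra_simps)

lemma insert_weight: "(c :: real) \<noteq> 0 \<Longrightarrow> a * b / (k * m) * \<phi> = a * c / m * (b / (k * c) * \<phi>)"
  by (simp add: mult_ac)

lemma avg2_eq_avg1:
  "avg2 n \<phi> = avg1 n (\<lambda>d. \<Sum>e\<in>up d. plancherel_transition d e * \<phi> d e)"
  unfolding avg2_def avg1_def sum_distrib_left
proof (intro sum.cong refl)
  fix d e assume de: "d \<in> diagrams n" "e \<in> up d"
  have "dim d \<noteq> 0" using dim_pos[OF yd_of(1)[OF de(1)]] by simp
  from insert_weight[OF this, of "dim d" "dim e" "real n + 1" "fact n" "\<phi> d e"]
  show "dim d * dim e / fact (Suc n) * \<phi> d e =
      dim d * dim d / fact n * (plancherel_transition d e * \<phi> d e)"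
    unfolding plancherel_transition_up[OF de] fact_Suc by (simp add: add.commute)
qed

lemma avg3_eq_avg2:
  "avg3 n \<phi> = avg2 n (\<lambda>d e. \<Sum>g\<in>up e. plancherel_transition e g * \<phi> d e g)"
  unfolding avg2_def avg3_def sum_distrib_left
proof (intro sum.cong refl)
  fix d e g assume de: "d \<in> diagrams n" "e \<in> up d" "g \<in> up e"
  have "dim e \<noteq> 0" using dim_pos[OF yd_of(2)[OF de(2)]] by simp
  from insert_weight[OF this, of "dim d" "dim g" "real (Suc n) + 1" "fact (Suc n)" "\<phi> d e g"]
  show "dim d * dim g / fact (Suc (Suc n)) * \<phi> d e g =
      dim d * dim e / fact (Suc n) * (plancherel_transition e g * \<phi> d e g)"
    unfolding plancherel_transition_up[OF up_diagrams[OF de(1,2)] de(3)] fact_Suc[of "Suc n"]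
    by (simp add: add.commute del: fact_Suc)
qed

lemma sum_plancherel_transition:
  assumes "yd d"
  shows "(\<Sum>e\<in>up d. plancherel_transition d e) = 1"
proof -
  have d: "d \<in> diagrams (card d)" using assms by (simp add: diagrams_def)
  have "(\<Sum>e\<in>up d. plancherel_transition d e) = (\<Sum>e\<in>up d. dim e) / ((real (card d) + 1) * dim d)"
    unfolding sum_divide_distrib by (intro sum.cong refl plancherel_transition_up[OF d])
  then show ?thesis using dim_pos[OF assms] by (simp add: sum_up_dim[OF assms])
qed

lemma avg2_fst: "avg2 n (\<lambda>d e. \<phi> d) = avg1 n \<phi>"
  unfolding avg2_eq_avg1 avg1_def
  by (intro sum.cong refl) (simp add: sum_plancherel_transition yd_of flip: sum_distrib_right)

lemma avg3_fst: "avg3 n (\<lambda>d e g. \<phi> d e) = avg2 n \<phi>"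
  unfolding avg3_eq_avg2 avg2_def
  by (intro sum.cong refl) (simp add: sum_plancherel_transition yd_of flip: sum_distrib_right)

lemma avg2_snd: "avg2 n (\<lambda>d e. \<phi> e) = avg1 (Suc n) \<phi>"
proof -
  have "avg2 n (\<lambda>d e. \<phi> e) =
      (\<Sum>e\<in>diagrams (Suc n). \<Sum>d | d \<hookrightarrow> e. dim d * dim e / fact (Suc n) * \<phi> e)"
    unfolding avg2_def by (rule sum_diagrams_up)
  also have "\<dots> = (\<Sum>e\<in>diagrams (Suc n). dim e * dim e / fact (Suc n) * \<phi> e)"
  proof (rule sum.cong[OF refl])
    fix e assume "e \<in> diagrams (Suc n)"
    then have e: "yd e" "e \<noteq> {}" by (auto simp: diagrams_def)
    have "(\<Sum>d | d \<hookrightarrow> e. dim d * dim e / fact (Suc n) * \<phi> e) =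
        (\<Sum>d | d \<hookrightarrow> e. dim d) * (dim e / fact (Suc n) * \<phi> e)"
      unfolding sum_distrib_right by (intro sum.cong refl) simp
    also have "(\<Sum>d | d \<hookrightarrow> e. dim d) = dim e" using num_syt_rec[OF e] by simp
    finally show "(\<Sum>d | d \<hookrightarrow> e. dim d * dim e / fact (Suc n) * \<phi> e) = dim e * dim e / fact (Suc n) * \<phi> e"
      by simp
  qed
  finally show ?thesis by (simp add: avg1_def)
qed

lemma avg1_mono: "(\<And>d. d \<in> diagrams n \<Longrightarrow> \<phi> d \<le> \<psi> d) \<Longrightarrow> avg1 n \<phi> \<le> avg1 n \<psi>"
  unfolding avg1_def by (intro sum_mono mult_left_mono) auto

lemma avg2_mono:
  "(\<And>d e. d \<in> diagrams n \<Longrightarrow> d \<hookrightarrow> e \<Longrightarrow> \<phi> d e \<le> \<psi> d e) \<Longrightarrow> avg2 n \<phi> \<le> avg2 n \<psi>"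
  unfolding avg2_def by (intro sum_mono mult_left_mono) auto

lemma avg3_mono:
  "(\<And>d e g. d \<in> diagrams n \<Longrightarrow> d \<hookrightarrow> e \<Longrightarrow> e \<hookrightarrow> g \<Longrightarrow> \<phi> d e g \<le> \<psi> d e g) \<Longrightarrow>
    avg3 n \<phi> \<le> avg3 n \<psi>"
  unfolding avg3_def by (intro sum_mono mult_left_mono) auto

lemma avg_add:
  "avg1 n (\<lambda>d. \<phi>1 d + \<psi>1 d) = avg1 n \<phi>1 + avg1 n \<psi>1"
  "avg2 n (\<lambda>d e. \<phi>2 d e + \<psi>2 d e) = avg2 n \<phi>2 + avg2 n \<psi>2"
  "avg3 n (\<lambda>d e g. \<phi>3 d e g + \<psi>3 d e g) = avg3 n \<phi>3 + avg3 n \<psi>3"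
  by (simp_all add: avg1_def avg2_def avg3_def distrib_left sum.distrib)

lemma avg_cmult:
  "avg1 n (\<lambda>d. c * \<phi>1 d) = c * avg1 n \<phi>1"
  "avg2 n (\<lambda>d e. c * \<phi>2 d e) = c * avg2 n \<phi>2"
  "avg3 n (\<lambda>d e g. c * \<phi>3 d e g) = c * avg3 n \<phi>3"
  by (simp_all add: avg1_def avg2_def avg3_def sum_distrib_left mult.left_commute)

lemma avg_diff:
  "avg1 n (\<lambda>d. \<phi>1 d - \<psi>1 d) = avg1 n \<phi>1 - avg1 n \<psi>1"
  "avg2 n (\<lambda>d e. \<phi>2 d e - \<psi>2 d e) = avg2 n \<phi>2 - avg2 n \<psi>2"
  "avg3 n (\<lambda>d e g. \<phi>3 d e g - \<psi>3 d e g) = avg3 n \<phi>3 - avg3 n \<psi>3"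
  by (simp_all add: avg1_def avg2_def avg3_def right_diff_distrib sum_subtractf)

lemma avg_sum:
  "avg1 n (\<lambda>d. \<Sum>i\<in>I. \<phi>1 i d) = (\<Sum>i\<in>I. avg1 n (\<phi>1 i))"
  "avg2 n (\<lambda>d e. \<Sum>i\<in>I. \<phi>2 i d e) = (\<Sum>i\<in>I. avg2 n (\<phi>2 i))"
  "avg3 n (\<lambda>d e g. \<Sum>i\<in>I. \<phi>3 i d e g) = (\<Sum>i\<in>I. avg3 n (\<phi>3 i))"
proof -
  show 1: "avg1 n (\<lambda>d. \<Sum>i\<in>I. \<phi>1 i d) = (\<Sum>i\<in>I. avg1 n (\<phi>1 i))"
    unfolding avg1_def sum_distrib_left by (rule sum.swap)
  show "avg2 n (\<lambda>d e. \<Sum>i\<in>I. \<phi>2 i d e) = (\<Sum>i\<in>I. avg2 n (\<phi>2 i))"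
    by (induction I rule: infinite_finite_induct) (simp_all add: avg_add, simp_all add: avg2_def)
  show "avg3 n (\<lambda>d e g. \<Sum>i\<in>I. \<phi>3 i d e g) = (\<Sum>i\<in>I. avg3 n (\<phi>3 i))"
    by (induction I rule: infinite_finite_induct) (simp_all add: avg_add, simp_all add: avg3_def)
qed

lemma avg1_const: "avg1 n (\<lambda>_. c) = c"
proof -
  have "avg1 n (\<lambda>_. c) = (\<Sum>d\<in>diagrams n. dim d ^ 2) / fact n * c"
    by (simp add: avg1_def power2_eq_square flip: sum_distrib_right sum_divide_distrib)
  then show ?thesis by (simp add: sum_diagrams_dim_sq)
qed

lemma avg2_const: "avg2 n (\<lambda>_ _. c) = c"
  using avg2_fst[of n "\<lambda>_. c"] avg1_const by simp

text \<open>
  The Cauchy--Schwarz inequality bounds the probability of every event that picks at most one pair for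
  each diagram at the earlier time and at most one for each at the later time, since the squared
  dimensions of the diagrams with \<open>n\<close> boxes add up to \<open>n!\<close>.
\<close>

lemma sum_dim_mult_dim_le:
  assumes "finite X" "\<And>x. x \<in> X \<Longrightarrow> a x \<in> diagrams m" "\<And>x. x \<in> X \<Longrightarrow> b x \<in> diagrams n"
    "inj_on a X" "inj_on b X"
  shows "(\<Sum>x\<in>X. dim (a x) * dim (b x)) \<le> sqrt (fact m * fact n)"
proof (rule real_le_rsqrt)
  have *: "(\<Sum>x\<in>X. dim (c x) ^ 2) \<le> fact k"
    if "\<And>x. x \<in> X \<Longrightarrow> c x \<in> diagrams k" "inj_on c X" for c k
  proof -
    have "(\<Sum>x\<in>X. dim (c x) ^ 2) = (\<Sum>d\<in>c ` X. dim d ^ 2)" using that by (simp add: sum.reindex)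
    also have "\<dots> \<le> (\<Sum>d\<in>diagrams k. dim d ^ 2)"
      using that finite_diagrams by (intro sum_mono2) auto
    finally show ?thesis by (simp add: sum_diagrams_dim_sq)
  qed
  have "(\<Sum>x\<in>X. dim (a x) * dim (b x))\<^sup>2 \<le> (\<Sum>x\<in>X. dim (a x) ^ 2) * (\<Sum>x\<in>X. dim (b x) ^ 2)"
    by (rule Cauchy_Schwarz_ineq_sum)
  also have "\<dots> \<le> fact m * fact n"
    using assms by (intro mult_mono * sum_nonneg) auto
  finally show "(\<Sum>x\<in>X. dim (a x) * dim (b x))\<^sup>2 \<le> fact m * fact n" .
qed

lemma addable_unique:
  assumes "d \<hookrightarrow> e" "d \<hookrightarrow> e'" "c (new_box d e) = c (new_box d e')" "c \<in> {fst, snd}"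
  shows "e = e'"
proof -
  note b = new_box[OF assms(1)] new_box[OF assms(2)]
  have "yd (insert (new_box d e) d)" "yd (insert (new_box d e') d)"
    using assms(1,2) b(2,4) unfolding add_box_def by metis+
  then have "new_box d e = new_box d e'"
    using addable_row_unique[OF _ _ b(1,3)] addable_col_unique[OF _ _ b(1,3)] assms(3,4) by auto
  then show ?thesis using b by metis
qed

lemma removable_unique:
  assumes "d \<hookrightarrow> e" "d' \<hookrightarrow> e" "c (new_box d e) = c (new_box d' e)" "c \<in> {fst, snd}"
  shows "d = d'"
proof -
  define p q where "p = new_box d e" and "q = new_box d' e"
  have b: "p \<notin> d" "e = insert p d" "q \<notin> d'" "e = insert q d'"
    using new_box[OF assms(1)] new_box[OF assms(2)] by (simp_all add: p_def q_def)
  have y: "yd d" "yd d'" using assms(1,2) by (auto simp: add_box_def)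
  obtain i j k l where pq: "p = (i, j)" "q = (k, l)" by fastforce
  have c: "i = k \<or> j = l" using assms(3,4) pq by (auto simp: p_def[symmetric] q_def[symmetric])
  have "p = q"
  proof (rule ccontr)
    assume ne: "p \<noteq> q"
    then have "(i, j) \<in> d'" "(k, l) \<in> d" using b pq by auto
    then have "\<not> (k \<le> i \<and> l \<le> j)" "\<not> (i \<le> k \<and> j \<le> l)"
      using young_diagramD(2)[OF y(2), of i j k l] young_diagramD(2)[OF y(1), of k l i j] b pq by auto
    then show False using c by auto
  qed
  then show ?thesis using b by (metis Diff_insert_absorb)
qed

lemma sqrt_ratio:
  fixes a q :: real
  assumes "a > 0" "q > 0"
  shows "sqrt (a * (q * a)) / (q * a) = 1 / sqrt q"
proof -
  have "a * (q * a) = a\<^sup>2 * q" by (simp add: power2_eq_square)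
  then have "sqrt (a * (q * a)) = a * sqrt q" using assms by (simp add: real_sqrt_mult)
  moreover have "q * a = sqrt q * sqrt q * a" using assms by simp
  ultimately show ?thesis using assms by (simp add: field_simps)
qed

lemma avg2_coord_le:
  assumes c: "c \<in> {fst, snd}"
  shows "avg2 n (\<lambda>d e. of_bool (c (new_box d e) = j)) \<le> 1 / sqrt (real n + 1)"
proof -
  let ?X = "{(d, e). d \<in> diagrams n \<and> e \<in> up d \<and> c (new_box d e) = j}"
  have sub: "?X \<subseteq> (SIGMA d:diagrams n. up d)" by auto
  have fin: "finite (SIGMA d:diagrams n. up d)"
    using finite_diagrams finite_up yd_of by (intro finite_SigmaI) auto
  have "avg2 n (\<lambda>d e. of_bool (c (new_box d e) = j)) =
      (\<Sum>(d, e)\<in>(SIGMA d:diagrams n. up d). dim d * dim e / fact (Suc n) * of_bool (c (new_box d e) = j))"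
    unfolding avg2_def using finite_diagrams finite_up yd_of by (subst sum.Sigma) auto
  also have "\<dots> = (\<Sum>(d, e)\<in>?X. dim d * dim e / fact (Suc n))"
    using fin sub by (intro sum.mono_neutral_cong_right) auto
  also have "\<dots> = (\<Sum>x\<in>?X. dim (fst x) * dim (snd x)) / fact (Suc n)"
    by (simp add: sum_divide_distrib case_prod_unfold)
  also have "(\<Sum>x\<in>?X. dim (fst x) * dim (snd x)) \<le> sqrt (fact n * fact (Suc n))"
  proof (rule sum_dim_mult_dim_le)
    show "finite ?X" using sub fin by (rule finite_subset)
    show "inj_on fst ?X"
    proof (rule inj_onI)
      fix x y assume "x \<in> ?X" "y \<in> ?X" "fst x = fst y"
      then show "x = y" using addable_unique[OF _ _ _ c, of "fst x" "snd x" "snd y"] by (cases x; cases y) simp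
    qed
    show "inj_on snd ?X"
    proof (rule inj_onI)
      fix x y assume "x \<in> ?X" "y \<in> ?X" "snd x = snd y"
      then show "x = y" using removable_unique[OF _ _ _ c, of "fst x" "snd x" "fst y"] by (cases x; cases y) simp
    qed
  qed (auto simp: up_diagrams)
  also have "sqrt (fact n * fact (Suc n)) / fact (Suc n) = 1 / sqrt (real n + 1)"
    using sqrt_ratio[of "fact n" "real n + 1"] by (simp add: add.commute)
  finally show ?thesis by (simp add: divide_right_mono)
qed

lemma avg3_coord_le:
  assumes c: "c \<in> {fst, snd}"
  shows "avg3 n (\<lambda>d e g. of_bool (c (new_box d e) = i \<and> c (new_box e g) = j)) \<le> 1 / (real n + 1)"
proof -
  let ?Y = "SIGMA d:diagrams n. SIGMA e:up d. up e"
  let ?P = "\<lambda>d e g. c (new_box d e) = i \<and> c (new_box e g) = j"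
  let ?X = "{(d, e, g). d \<in> diagrams n \<and> e \<in> up d \<and> g \<in> up e \<and> ?P d e g}"
  have sub: "?X \<subseteq> ?Y" by auto
  have fin: "finite ?Y"
    using finite_diagrams finite_up yd_of by (intro finite_SigmaI) auto
  have "avg3 n (\<lambda>d e g. of_bool (?P d e g)) =
      (\<Sum>d\<in>diagrams n. \<Sum>(e, g)\<in>(SIGMA e:up d. up e). dim d * dim g / fact (Suc (Suc n)) * of_bool (?P d e g))"
    unfolding avg3_def
    by (intro sum.cong refl, subst sum.Sigma) (use finite_up yd_of in auto)
  also have "\<dots> = (\<Sum>(d, e, g)\<in>?Y. dim d * dim g / fact (Suc (Suc n)) * of_bool (?P d e g))"
    using finite_diagrams finite_up yd_of by (subst sum.Sigma) (auto intro!: finite_SigmaI)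
  also have "\<dots> = (\<Sum>(d, e, g)\<in>?X. dim d * dim g / fact (Suc (Suc n)))"
    using fin sub by (intro sum.mono_neutral_cong_right) auto
  also have "\<dots> = (\<Sum>x\<in>?X. dim (fst x) * dim (snd (snd x))) / fact (Suc (Suc n))"
    by (simp add: sum_divide_distrib case_prod_unfold)
  also have "(\<Sum>x\<in>?X. dim (fst x) * dim (snd (snd x))) \<le> sqrt (fact n * fact (Suc (Suc n)))"
  proof (rule sum_dim_mult_dim_le)
    show "finite ?X" using sub fin by (rule finite_subset)
    show "inj_on fst ?X"
    proof (rule inj_onI)
      fix x y assume xy: "x \<in> ?X" "y \<in> ?X" "fst x = fst y"
      obtain d e g e' g' where eq: "x = (d, e, g)" "y = (d, e', g')"
        using xy(3) by (cases x; cases y) auto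
      have "e = e'" using xy eq addable_unique[OF _ _ _ c, of d e e'] by simp
      moreover have "g = g'" using xy eq addable_unique[OF _ _ _ c, of e g g'] \<open>e = e'\<close> by simp
      ultimately show "x = y" using eq by simp
    qed
    show "inj_on (\<lambda>x. snd (snd x)) ?X"
    proof (rule inj_onI)
      fix x y assume xy: "x \<in> ?X" "y \<in> ?X" "snd (snd x) = snd (snd y)"
      obtain d e g d' e' where eq: "x = (d, e, g)" "y = (d', e', g)"
        using xy(3) by (cases x; cases y) auto
      have "e = e'" using xy eq removable_unique[OF _ _ _ c, of e g e'] by simp
      moreover have "d = d'" using xy eq removable_unique[OF _ _ _ c, of d e d'] \<open>e = e'\<close> by simp
      ultimately show "x = y" using eq by simp
    qed
  qed (auto intro: diagrams_add_box)
  also have "sqrt (fact n * fact (Suc (Suc n))) / fact (Suc (Suc n)) = 1 / sqrt ((real n + 1) * (real n + 2))"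
  proof -
    have f: "fact (Suc (Suc n)) = ((real n + 1) * (real n + 2)) * fact n" by (simp add: algebra_simps)
    show ?thesis unfolding f by (rule sqrt_ratio) simp_all
  qed
  also have "\<dots> \<le> 1 / (real n + 1)"
  proof -
    have "real n + 1 \<le> sqrt ((real n + 1) * (real n + 2))"
      by (intro real_le_rsqrt) (simp add: power2_eq_square algebra_simps)
    then show ?thesis by (simp add: frac_le)
  qed
  finally show ?thesis by (simp add: divide_right_mono)
qed

definition swappable :: "diagram \<Rightarrow> diagram \<Rightarrow> diagram \<Rightarrow> bool" where
  "swappable d e g \<longleftrightarrow> yd (insert (new_box e g) d)"

text \<open>
  If the second box cannot be added first, it needs the first box, so it lies weakly to the right of and
  below it.  It is a neighbour, since any box further away needs a neighbour that is not there yet.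
\<close>

lemma not_swappable_next_box:
  assumes "d \<hookrightarrow> e" "e \<hookrightarrow> g" "\<not> swappable d e g"
  shows "next_box (new_box d e) (new_box e g)"
proof -
  obtain i j k l where pq: "new_box d e = (i, j)" "new_box e g = (k, l)" by fastforce
  have e: "e = insert (i, j) d" "(i, j) \<notin> d" and g: "g = insert (k, l) e" "(k, l) \<notin> e"
    using new_box[OF assms(1)] new_box[OF assms(2)] pq by simp_all
  have y: "yd d" "yd e" "yd g" using assms by (auto simp: add_box_def)
  have "\<not> yd (insert (k, l) d)" using assms(3) pq by (simp add: swappable_def)
  then obtain a b a' b' where ab: "(a, b) \<in> insert (k, l) d" "a' \<le> a" "b' \<le> b" "(a', b') \<notin> insert (k, l) d"
    using young_diagramD(1)[OF y(1)] by (auto simp: young_diagram_iff[of "insert (k, l) d"])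
  have "(a, b) = (k, l)" using ab young_diagramD(2)[OF y(1), of a b a' b'] by auto
  moreover have "(a', b') \<in> g" using young_diagramD(2)[OF y(3), of a b a' b'] ab e g by auto
  ultimately have le: "i \<le> k" "j \<le> l" using ab e g by auto
  have ne: "(i, j) \<noteq> (k, l)" using e g by auto
  show ?thesis
  proof (cases "i < k")
    case True
    then have "(Suc i, j) \<in> g" using young_diagramD(2)[OF y(3), of k l "Suc i" j] g le by auto
    moreover have "(Suc i, j) \<notin> d" using young_diagramD(2)[OF y(1), of "Suc i" j i j] e by auto
    ultimately show ?thesis using e g pq by (auto simp: next_box_def)
  next
    case False
    then have "j < l" using le ne by auto
    then have "(i, Suc j) \<in> g" using young_diagramD(2)[OF y(3), of k l i "Suc j"] g le by auto
    moreover have "(i, Suc j) \<notin> d" using young_diagramD(2)[OF y(1), of i "Suc j" i j] e by auto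
    ultimately show ?thesis using e g pq by (auto simp: next_box_def)
  qed
qed

lemma swappable_swap:
  assumes "d \<hookrightarrow> e" "e \<hookrightarrow> g" "swappable d e g"
  defines "e' \<equiv> insert (new_box e g) d"
  shows "d \<hookrightarrow> e'" "e' \<hookrightarrow> g" "swappable d e' g" "new_box d e' = new_box e g" "new_box e' g = new_box d e"
proof -
  note 1 = new_box[OF assms(1)] and 2 = new_box[OF assms(2)]
  have y: "yd d" "yd e" "yd g" "yd e'" using assms by (auto simp: add_box_def swappable_def)
  have q: "new_box e g \<notin> d" "new_box d e \<noteq> new_box e g" using 1 2 by auto
  show "d \<hookrightarrow> e'" using y q(1) by (intro add_boxI[of _ _ "new_box e g"]) (simp_all add: e'_def)
  have g: "g = insert (new_box d e) e'" using 1 2 unfolding e'_def by (metis insert_commute)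
  have p: "new_box d e \<notin> e'" using 1 q by (simp add: e'_def)
  show "e' \<hookrightarrow> g" using y p g by (intro add_boxI[of _ _ "new_box d e"]) simp_all
  show "new_box d e' = new_box e g" unfolding e'_def using q(1) by (rule new_box_insert)
  show *: "new_box e' g = new_box d e" using new_box_insert[OF p] g by simp
  show "swappable d e' g" unfolding swappable_def * using y 1 by simp
qed

text \<open>
  The weight of a pair of growth steps depends only on the first and the last diagram, so two boxes that
  can be added in either order are exchangeable.
\<close>

lemma avg3_swap:
  "avg3 n (\<lambda>d e g. h d * of_bool (swappable d e g) * F (new_box d e) (new_box e g)) =
   avg3 n (\<lambda>d e g. h d * of_bool (swappable d e g) * F (new_box e g) (new_box d e))"
  unfolding avg3_def
proof (rule sum.cong[OF refl])
  fix d assume d: "d \<in> diagrams n"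
  let ?S = "SIGMA e:up d. up e"
  let ?A = "{(e, g). d \<hookrightarrow> e \<and> e \<hookrightarrow> g \<and> swappable d e g}"
  have fin: "finite ?S" using finite_up yd_of d by (intro finite_SigmaI) auto
  have *: "(\<Sum>e\<in>up d. \<Sum>g\<in>up e. dim d * dim g / fact (Suc (Suc n)) * (h d * of_bool (swappable d e g) * \<phi> e g)) =
      (\<Sum>(e, g)\<in>?A. dim d * dim g / fact (Suc (Suc n)) * (h d * \<phi> e g))" for \<phi>
  proof -
    have "(\<Sum>e\<in>up d. \<Sum>g\<in>up e. dim d * dim g / fact (Suc (Suc n)) * (h d * of_bool (swappable d e g) * \<phi> e g)) =
      (\<Sum>(e, g)\<in>?S. dim d * dim g / fact (Suc (Suc n)) * (h d * of_bool (swappable d e g) * \<phi> e g))"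
      using finite_up yd_of d by (subst sum.Sigma) auto
    also have "\<dots> = (\<Sum>(e, g)\<in>?A. dim d * dim g / fact (Suc (Suc n)) * (h d * \<phi> e g))"
      using fin by (intro sum.mono_neutral_cong_right) auto
    finally show ?thesis .
  qed
  let ?s = "\<lambda>(e, g). (insert (new_box e g) d, g)"
  have "(\<Sum>(e, g)\<in>?A. dim d * dim g / fact (Suc (Suc n)) * (h d * F (new_box d e) (new_box e g))) =
      (\<Sum>(e, g)\<in>?A. dim d * dim g / fact (Suc (Suc n)) * (h d * F (new_box e g) (new_box d e)))"
  proof (rule sum.reindex_bij_witness[where i="?s" and j="?s"])
    fix x assume x: "x \<in> ?A"
    then obtain e g where eg: "x = (e, g)" "d \<hookrightarrow> e" "e \<hookrightarrow> g" "swappable d e g" by auto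
    note s = swappable_swap[OF eg(2-4)]
    show "?s x \<in> ?A" using s by (simp add: eg)
    show "?s (?s x) = x" using s new_box(2)[OF eg(2)] by (simp add: eg)
    show "?s x \<in> ?A" using s by (simp add: eg)
    show "?s (?s x) = x" using s new_box(2)[OF eg(2)] by (simp add: eg)
    show "(case ?s x of (e, g) \<Rightarrow> dim d * dim g / fact (Suc (Suc n)) * (h d * F (new_box e g) (new_box d e))) =
        (case x of (e, g) \<Rightarrow> dim d * dim g / fact (Suc (Suc n)) * (h d * F (new_box d e) (new_box e g)))"
      using s by (simp add: eg)
  qed
  then show "(\<Sum>e\<in>up d. \<Sum>g\<in>up e. dim d * dim g / fact (Suc (Suc n)) *
        (h d * of_bool (swappable d e g) * F (new_box d e) (new_box e g))) =
      (\<Sum>e\<in>up d. \<Sum>g\<in>up e. dim d * dim g / fact (Suc (Suc n)) *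
        (h d * of_bool (swappable d e g) * F (new_box e g) (new_box d e)))"
    unfolding * .
qed

section \<open>The probability that the next box lies in the first columns\<close>

definition left_prob :: "nat \<Rightarrow> diagram \<Rightarrow> real" where
  "left_prob r d = (\<Sum>e\<in>up d. plancherel_transition d e * of_bool (fst (new_box d e) < r))"

lemma left_prob_bounds: "0 \<le> left_prob r d" "left_prob r d \<le> 1" "r \<le> s \<Longrightarrow> left_prob r d \<le> left_prob s d"
proof -
  have nn: "plancherel_transition d e \<ge> 0" for e by (simp add: plancherel_transition_def)
  show "0 \<le> left_prob r d" unfolding left_prob_def using nn by (intro sum_nonneg) simp
  show "left_prob r d \<le> 1"
  proof (cases "yd d")
    case True
    have "left_prob r d \<le> (\<Sum>e\<in>up d. plancherel_transition d e)"
      unfolding left_prob_def using nn by (intro sum_mono) (simp add: mult_left_le)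
    then show ?thesis using sum_plancherel_transition[OF True] by simp
  next
    case False
    then have "up d = {}" by (auto simp: add_box_def)
    then show ?thesis by (simp add: left_prob_def)
  qed
  show "left_prob r d \<le> left_prob s d" if "r \<le> s"
    unfolding left_prob_def using nn that by (intro sum_mono mult_left_mono) auto
qed

lemma avg2_left: "avg2 n (\<lambda>d e. h d * of_bool (fst (new_box d e) < r)) = avg1 n (\<lambda>d. h d * left_prob r d)"
  unfolding avg2_eq_avg1 left_prob_def sum_distrib_left by (simp add: mult.left_commute)

lemma avg3_left:
  "avg3 n (\<lambda>d e g. h d e * of_bool (fst (new_box e g) < r)) = avg2 n (\<lambda>d e. h d e * left_prob r e)"
  unfolding avg3_eq_avg2 left_prob_def sum_distrib_left by (simp add: mult.left_commute)

text \<open>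
  The key estimate: along the growth process \<^const>\<open>left_prob\<close> is almost a martingale, because only the
  pairs of boxes that cannot be exchanged contribute to its drift.  Hence its quadratic variation is
  bounded by the telescoping sum of its second moments.
\<close>

lemma left_prob_increment:
  "avg2 n (\<lambda>d e. (left_prob r e - left_prob r d)\<^sup>2) \<le>
    avg1 (Suc n) (\<lambda>d. (left_prob r d)\<^sup>2) - avg1 n (\<lambda>d. (left_prob r d)\<^sup>2) + 2 / (real n + 1)"
proof -
  let ?G = "left_prob r"
  let ?b1 = "\<lambda>d e g :: diagram. of_bool (fst (new_box d e) < r) :: real"
  let ?b2 = "\<lambda>d e g :: diagram. of_bool (fst (new_box e g) < r) :: real"
  let ?sw = "\<lambda>d e g. of_bool (swappable d e g) :: real"
  \<comment> \<open>Boxes that cannot be exchanged only matter if the first one lies in the last of the \<open>r\<close> columns and the second one does not.\<close>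
  let ?adj = "\<lambda>d e g. of_bool (fst (new_box d e) = r - 1 \<and> fst (new_box e g) = r) :: real"
  have "avg3 n (\<lambda>d e g. ?G d * ?sw d e g * (?b2 d e g - ?b1 d e g)) = 0"
  proof -
    have "avg3 n (\<lambda>d e g. ?G d * ?sw d e g * (?b2 d e g - ?b1 d e g)) =
        avg3 n (\<lambda>d e g. ?G d * ?sw d e g * (?b1 d e g - ?b2 d e g))"
      by (rule avg3_swap[where F="\<lambda>p q. of_bool (fst q < r) - of_bool (fst p < r)"])
    also have "\<dots> = avg3 n (\<lambda>d e g. (-1) * (?G d * ?sw d e g * (?b2 d e g - ?b1 d e g)))"
      by (simp add: algebra_simps)
    also have "\<dots> = - avg3 n (\<lambda>d e g. ?G d * ?sw d e g * (?b2 d e g - ?b1 d e g))"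
      unfolding avg_cmult by simp
    finally show ?thesis by simp
  qed
  moreover have "avg3 n (\<lambda>d e g. ?G d * ?sw d e g * (?b2 d e g - ?b1 d e g) - ?adj d e g) \<le>
      avg3 n (\<lambda>d e g. ?G d * ?b2 d e g - ?G d * ?b1 d e g)"
  proof (rule avg3_mono)
    fix d e g assume d: "d \<in> diagrams n" "d \<hookrightarrow> e" "e \<hookrightarrow> g"
    show "?G d * ?sw d e g * (?b2 d e g - ?b1 d e g) - ?adj d e g \<le> ?G d * ?b2 d e g - ?G d * ?b1 d e g"
    proof (cases "swappable d e g")
      case True
      then show ?thesis by (simp add: right_diff_distrib)
    next
      case False
      then have "next_box (new_box d e) (new_box e g)" by (rule not_swappable_next_box[OF d(2,3)])
      then have "?b1 d e g - ?b2 d e g \<le> ?adj d e g"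
        by (auto simp: next_box_def)
      moreover have "0 \<le> ?G d" "?G d \<le> 1" using left_prob_bounds by auto
      ultimately have "?G d * (?b1 d e g - ?b2 d e g) \<le> ?G d * ?adj d e g"
        by (intro mult_left_mono)
      also have "\<dots> \<le> 1 * ?adj d e g"
        using \<open>?G d \<le> 1\<close> by (intro mult_right_mono) simp_all
      finally have "?G d * (?b1 d e g - ?b2 d e g) \<le> ?adj d e g" by simp
      then show ?thesis using False by (simp add: right_diff_distrib)
    qed
  qed
  moreover have "avg3 n ?adj \<le> 1 / (real n + 1)"
    by (rule avg3_coord_le) simp
  ultimately have drift: "avg3 n (\<lambda>d e g. ?G d * ?b2 d e g) - avg3 n (\<lambda>d e g. ?G d * ?b1 d e g) \<ge> - 1 / (real n + 1)"
    unfolding avg_diff by linarith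
  have 1: "avg3 n (\<lambda>d e g. ?G d * ?b2 d e g) = avg2 n (\<lambda>d e. ?G d * ?G e)"
    by (rule avg3_left)
  have 2: "avg3 n (\<lambda>d e g. ?G d * ?b1 d e g) = avg1 n (\<lambda>d. ?G d * ?G d)"
    unfolding avg3_fst by (rule avg2_left)
  have "avg2 n (\<lambda>d e. (?G e - ?G d)\<^sup>2) =
      avg2 n (\<lambda>d e. (?G e)\<^sup>2 + ((?G d)\<^sup>2 - 2 * (?G d * ?G e)))"
    by (simp add: power2_eq_square algebra_simps)
  also have "\<dots> = avg1 (Suc n) (\<lambda>d. (?G d)\<^sup>2) + (avg1 n (\<lambda>d. (?G d)\<^sup>2) - 2 * avg2 n (\<lambda>d e. ?G d * ?G e))"
    unfolding avg_add avg_diff avg_cmult avg2_snd avg2_fst ..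
  finally show ?thesis using drift unfolding 1 2 by (simp add: power2_eq_square)
qed

text \<open>
  The drift terms add up to at most 2 over \<open>n\<close> steps, and the second moments lie between 0 and 1.
\<close>

lemma left_prob_variation:
  assumes "n \<ge> 1"
  shows "(\<Sum>m=n..<2*n. avg2 m (\<lambda>d e. (left_prob r e - left_prob r d)\<^sup>2)) \<le> 3"
proof -
  let ?s = "\<lambda>m. avg1 m (\<lambda>d. (left_prob r d)\<^sup>2)"
  have "(\<Sum>m=n..<2*n. avg2 m (\<lambda>d e. (left_prob r e - left_prob r d)\<^sup>2)) \<le>
      (\<Sum>m=n..<2*n. (?s (Suc m) - ?s m) + 2 / real n)"
  proof (rule sum_mono)
    fix m assume "m \<in> {n..<2*n}"
    then have "2 / (real m + 1) \<le> 2 / real n" using assms by (intro divide_left_mono) auto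
    then show "avg2 m (\<lambda>d e. (left_prob r e - left_prob r d)\<^sup>2) \<le> ?s (Suc m) - ?s m + 2 / real n"
      using left_prob_increment[of m r] by linarith
  qed
  also have "\<dots> = ?s (2 * n) - ?s n + 2"
    using assms sum_Suc_diff'[of n "2 * n" ?s] by (simp add: sum.distrib)
  also have "?s (2 * n) \<le> avg1 (2 * n) (\<lambda>_. 1)"
    by (intro avg1_mono power_le_one left_prob_bounds)
  also have "avg1 (2 * n) (\<lambda>_. 1) = 1" by (rule avg1_const)
  finally have "(\<Sum>m=n..<2*n. avg2 m (\<lambda>d e. (left_prob r e - left_prob r d)\<^sup>2)) \<le> 1 - ?s n + 2" by simp
  moreover have "?s n \<ge> 0" unfolding avg1_def by (intro sum_nonneg) auto
  ultimately show ?thesis by linarith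
qed

lemma avg2_le_sqrt:
  assumes "\<And>d e. \<phi> d e \<ge> 0"
  shows "avg2 n \<phi> \<le> sqrt (avg2 n (\<lambda>d e. (\<phi> d e)\<^sup>2))"
proof (rule real_le_rsqrt)
  let ?m = "avg2 n \<phi>"
  have "0 \<le> avg2 n (\<lambda>d e. (\<phi> d e - ?m)\<^sup>2)"
    unfolding avg2_def by (intro sum_nonneg) auto
  also have "\<dots> = avg2 n (\<lambda>d e. (\<phi> d e)\<^sup>2 + (?m\<^sup>2 - 2 * ?m * \<phi> d e))"
    by (simp add: power2_eq_square algebra_simps)
  also have "\<dots> = avg2 n (\<lambda>d e. (\<phi> d e)\<^sup>2) - ?m\<^sup>2"
    unfolding avg_add avg_diff avg_cmult avg2_const by (simp add: power2_eq_square)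
  finally show "?m\<^sup>2 \<le> avg2 n (\<lambda>d e. (\<phi> d e)\<^sup>2)" by simp
qed

text \<open>
  If a first box in the first \<open>r\<close> columns is followed by a box in a lower row and the two can be exchanged,
  then the second box lies further left.  So both orders of such a pair lie in the first \<open>r\<close> columns, and
  only one of them goes down.  Hence twice the probability of a pair that goes down is essentially at most
  that of all pairs in the first \<open>r\<close> columns, and the latter is the second moment of
  \<^const>\<open>left_prob\<close> up to the effect of its change in one step.
\<close>

lemma descent_prob_le:
  "2 * avg3 n (\<lambda>d e g. of_bool (fst (new_box d e) < r \<and> snd (new_box d e) < snd (new_box e g))) \<le>
    avg1 n (\<lambda>d. (left_prob r d)\<^sup>2) + sqrt (avg2 n (\<lambda>d e. (left_prob r e - left_prob r d)\<^sup>2))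
    + real r / (real n + 1)"
proof -
  let ?G = "left_prob r"
  let ?P = "\<lambda>p q :: box. of_bool (fst p < r \<and> fst q < r \<and> snd p < snd q) :: real"
  let ?both = "\<lambda>d e g. of_bool (fst (new_box d e) < r) * of_bool (fst (new_box e g) < r) :: real"
  let ?sw = "\<lambda>d e g. of_bool (swappable d e g) :: real"
  \<comment> \<open>Boxes that cannot be exchanged form a descent only if the second one lies directly below the first one.\<close>
  let ?vert = "\<lambda>d e g. \<Sum>j<r. of_bool (fst (new_box d e) = j \<and> fst (new_box e g) = j) :: real"
  let ?desc = "\<lambda>d e g. of_bool (fst (new_box d e) < r \<and> snd (new_box d e) < snd (new_box e g)) :: real"
  have vert: "avg3 n ?vert \<le> real r / (real n + 1)"
  proof -
    have "avg3 n ?vert \<le> (\<Sum>j<r. 1 / (real n + 1))"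
      unfolding avg_sum by (intro sum_mono avg3_coord_le) simp
    then show ?thesis by simp
  qed
  have swap: "avg3 n (\<lambda>d e g. 1 * ?sw d e g * ?P (new_box d e) (new_box e g)) =
      avg3 n (\<lambda>d e g. 1 * ?sw d e g * ?P (new_box e g) (new_box d e))"
    by (rule avg3_swap)
  have "2 * avg3 n ?desc = avg3 n (\<lambda>d e g. 2 * ?desc d e g)" by (simp add: avg_cmult)
  also have "\<dots> \<le> avg3 n (\<lambda>d e g. ?both d e g + (?vert d e g +
      (1 * ?sw d e g * ?P (new_box d e) (new_box e g) - 1 * ?sw d e g * ?P (new_box e g) (new_box d e))))"
  proof (rule avg3_mono)
    fix d e g assume d: "d \<in> diagrams n" "d \<hookrightarrow> e" "e \<hookrightarrow> g"
    note b = new_box[OF d(2)] new_box[OF d(3)]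
    show "2 * ?desc d e g \<le> ?both d e g + (?vert d e g +
      (1 * ?sw d e g * ?P (new_box d e) (new_box e g) - 1 * ?sw d e g * ?P (new_box e g) (new_box d e)))"
    proof (cases "swappable d e g")
      case True
      have "fst (new_box d e) < fst (new_box e g) \<and> snd (new_box e g) < snd (new_box d e) \<or>
          fst (new_box e g) < fst (new_box d e) \<and> snd (new_box d e) < snd (new_box e g)"
      proof (rule addable_antichain)
        show "yd (insert (new_box d e) d)" using d b by (auto simp: add_box_def)
        show "yd (insert (new_box e g) d)" using True by (simp add: swappable_def)
        show "new_box d e \<notin> d" "new_box e g \<notin> d" "new_box d e \<noteq> new_box e g" using b by auto
      qed
      moreover have "?vert d e g \<ge> 0" by (intro sum_nonneg) auto
      ultimately show ?thesis using True by auto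
    next
      case False
      then have nb: "next_box (new_box d e) (new_box e g)" by (rule not_swappable_next_box[OF d(2,3)])
      show ?thesis
      proof (cases "?desc d e g = 0")
        case True
        moreover have "?vert d e g \<ge> 0" by (intro sum_nonneg) auto
        moreover have "?both d e g \<ge> 0" "?sw d e g = 0" using False by simp_all
        ultimately show ?thesis
          by (simp only: mult_zero_right mult_zero_left diff_self)
      next
        case desc: False
        then have eq: "fst (new_box e g) = fst (new_box d e)" "fst (new_box d e) < r"
          using nb by (auto simp: next_box_def split: if_splits)
        have "?vert d e g = (\<Sum>j<r. if j = fst (new_box d e) then 1 else 0)"
          unfolding eq(1) by (intro sum.cong) auto
        then have "?vert d e g = 1" using eq(2) by simp
        then show ?thesis using False eq desc by simp
      qed
    qed
  qed
  also have "\<dots> = avg3 n ?both + avg3 n ?vert"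
    unfolding avg_add avg_diff swap by simp
  also have "avg3 n ?both = avg2 n (\<lambda>d e. of_bool (fst (new_box d e) < r) * ?G e)"
    by (rule avg3_left)
  also have "\<dots> = avg2 n (\<lambda>d e. ?G d * of_bool (fst (new_box d e) < r) +
      of_bool (fst (new_box d e) < r) * (?G e - ?G d))"
    by (simp add: algebra_simps)
  also have "\<dots> = avg1 n (\<lambda>d. ?G d * ?G d) + avg2 n (\<lambda>d e. of_bool (fst (new_box d e) < r) * (?G e - ?G d))"
    unfolding avg_add avg2_left ..
  also have "avg2 n (\<lambda>d e. of_bool (fst (new_box d e) < r) * (?G e - ?G d)) \<le> avg2 n (\<lambda>d e. \<bar>?G e - ?G d\<bar>)"
    by (intro avg2_mono) auto
  also have "\<dots> \<le> sqrt (avg2 n (\<lambda>d e. (?G e - ?G d)\<^sup>2))"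
    using avg2_le_sqrt[of "\<lambda>d e. \<bar>?G e - ?G d\<bar>" n] by simp
  finally show ?thesis using vert by (simp add: power2_eq_square)
qed

text \<open>
  At most one box can be added in column \<open>j\<close>, so the square of its probability has weight \<open>(dim e)\<^sup>2\<close> for the
  larger diagram \<open>e\<close>, which determines the smaller one.
\<close>

lemma col_prob_sq_le:
  "avg1 n (\<lambda>d. (\<Sum>e\<in>up d. plancherel_transition d e * of_bool (fst (new_box d e) = j))\<^sup>2)
    \<le> 1 / (real n + 1)"
proof -
  let ?X = "{(d, e). d \<in> diagrams n \<and> e \<in> up d \<and> fst (new_box d e) = j}"
  let ?T = "\<lambda>d. \<Sum>e\<in>up d. plancherel_transition d e * of_bool (fst (new_box d e) = j)"
  have sub: "?X \<subseteq> (SIGMA d:diagrams n. up d)" by auto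
  have fin: "finite (SIGMA d:diagrams n. up d)"
    using finite_diagrams finite_up yd_of by (intro finite_SigmaI) auto
  have T: "(?T d)\<^sup>2 = (\<Sum>e\<in>up d. (plancherel_transition d e)\<^sup>2 * of_bool (fst (new_box d e) = j))"
    if d: "d \<in> diagrams n" for d
  proof (cases "\<exists>e. d \<hookrightarrow> e \<and> fst (new_box d e) = j")
    case True
    then obtain e0 where e0: "d \<hookrightarrow> e0" "fst (new_box d e0) = j" by blast
    have iff: "e \<in> up d \<Longrightarrow> fst (new_box d e) = j \<longleftrightarrow> e = e0" for e
      using addable_unique[of d e e0 fst] e0 by auto
    have *: "(\<Sum>e\<in>up d. F e * of_bool (fst (new_box d e) = j)) = F e0" for F :: "diagram \<Rightarrow> real"
    proof -
      have "(\<Sum>e\<in>up d. F e * of_bool (fst (new_box d e) = j)) = (\<Sum>e\<in>up d. if e = e0 then F e else 0)"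
        using iff by (intro sum.cong) auto
      then show ?thesis using e0 finite_up[OF yd_of(1)[OF d]] by simp
    qed
    show ?thesis unfolding * ..
  next
    case False
    then show ?thesis by (auto intro!: sum.neutral)
  qed
  have "avg1 n (\<lambda>d. (?T d)\<^sup>2) =
      (\<Sum>d\<in>diagrams n. \<Sum>e\<in>up d. dim d * dim d / fact n * ((plancherel_transition d e)\<^sup>2 * of_bool (fst (new_box d e) = j)))"
    unfolding avg1_def by (intro sum.cong refl) (simp add: T sum_distrib_left)
  also have "\<dots> = (\<Sum>(d, e)\<in>(SIGMA d:diagrams n. up d). dim d * dim d / fact n *
      ((plancherel_transition d e)\<^sup>2 * of_bool (fst (new_box d e) = j)))"
    using finite_diagrams finite_up yd_of by (subst sum.Sigma) auto
  also have "\<dots> = (\<Sum>(d, e)\<in>?X. dim d * dim d / fact n * (plancherel_transition d e)\<^sup>2)"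
    using fin sub by (intro sum.mono_neutral_cong_right) auto
  also have "\<dots> = (\<Sum>x\<in>?X. (dim (snd x))\<^sup>2 / (fact n * (real n + 1)\<^sup>2))"
  proof (rule sum.cong[OF refl], clarify)
    fix d e assume d: "d \<in> diagrams n" "d \<hookrightarrow> e"
    have nz: "dim d \<noteq> 0" using dim_pos[OF yd_of(1)[OF d(1)]] by simp
    have *: "x * x / k * (y / (m * x))\<^sup>2 = y\<^sup>2 / (k * m\<^sup>2)" if "x \<noteq> 0" for x y k m :: real
      using that by (simp add: power2_eq_square mult_ac)
    have "plancherel_transition d e = dim e / ((real n + 1) * dim d)"
      using d by (intro plancherel_transition_up) simp_all
    then show "dim d * dim d / fact n * (plancherel_transition d e)\<^sup>2 =
        (dim (snd (d, e)))\<^sup>2 / (fact n * (real n + 1)\<^sup>2)"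
      using *[OF nz] by simp
  qed
  also have "\<dots> = (\<Sum>e\<in>snd ` ?X. (dim e)\<^sup>2) / (fact n * (real n + 1)\<^sup>2)"
  proof -
    have "inj_on snd ?X"
    proof (rule inj_onI)
      fix x y assume "x \<in> ?X" "y \<in> ?X" "snd x = snd y"
      then show "x = y" using removable_unique[of "fst x" "snd x" "fst y" fst] by (cases x; cases y) simp
    qed
    then show ?thesis by (simp add: sum.reindex sum_divide_distrib)
  qed
  also have "(\<Sum>e\<in>snd ` ?X. (dim e)\<^sup>2) \<le> (\<Sum>e\<in>diagrams (Suc n). (dim e)\<^sup>2)"
    using finite_diagrams by (intro sum_mono2) (auto intro: diagrams_add_box)
  also have "\<dots> = fact n * (real n + 1)" by (simp add: sum_diagrams_dim_sq algebra_simps)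
  also have "fact n * (real n + 1) / (fact n * (real n + 1)\<^sup>2) = 1 / (real n + 1)"
    by (simp add: power2_eq_square)
  finally show ?thesis by (simp add: divide_right_mono)
qed

lemma left_prob_gap:
  assumes "r \<le> s"
  shows "avg1 n (\<lambda>d. (left_prob s d - left_prob r d)\<^sup>2) \<le> (real (s - r))\<^sup>2 / (real n + 1)"
proof -
  let ?T = "\<lambda>j d. \<Sum>e\<in>up d. plancherel_transition d e * of_bool (fst (new_box d e) = j)"
  have eq: "left_prob s d - left_prob r d = (\<Sum>j=r..<s. ?T j d)" for d
  proof -
    have "(\<Sum>j=r..<s. ?T j d) = (\<Sum>e\<in>up d. \<Sum>j=r..<s. plancherel_transition d e * of_bool (fst (new_box d e) = j))"
      by (rule sum.swap)
    also have "\<dots> = (\<Sum>e\<in>up d. plancherel_transition d e * (of_bool (fst (new_box d e) < s) - of_bool (fst (new_box d e) < r)))"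
    proof (rule sum.cong[OF refl])
      fix e
      have "(\<Sum>j=r..<s. of_bool (fst (new_box d e) = j) :: real) =
          of_bool (fst (new_box d e) < s) - of_bool (fst (new_box d e) < r)"
        using assms by (simp add: of_bool_def sum.delta') 
      then show "(\<Sum>j=r..<s. plancherel_transition d e * of_bool (fst (new_box d e) = j)) =
          plancherel_transition d e * (of_bool (fst (new_box d e) < s) - of_bool (fst (new_box d e) < r))"
        by (metis sum_distrib_left)
    qed
    finally show ?thesis by (simp add: left_prob_def right_diff_distrib sum_subtractf)
  qed
  have "avg1 n (\<lambda>d. (left_prob s d - left_prob r d)\<^sup>2) \<le> avg1 n (\<lambda>d. real (s - r) * (\<Sum>j=r..<s. (?T j d)\<^sup>2))"
  proof (rule avg1_mono)
    fix d
    have "(\<Sum>j=r..<s. 1 * ?T j d)\<^sup>2 \<le> (\<Sum>j=r..<s. 1\<^sup>2) * (\<Sum>j=r..<s. (?T j d)\<^sup>2)"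
      by (rule Cauchy_Schwarz_ineq_sum)
    then show "(left_prob s d - left_prob r d)\<^sup>2 \<le> real (s - r) * (\<Sum>j=r..<s. (?T j d)\<^sup>2)"
      unfolding eq by simp
  qed
  also have "\<dots> = real (s - r) * (\<Sum>j=r..<s. avg1 n (\<lambda>d. (?T j d)\<^sup>2))"
    unfolding avg_cmult avg_sum ..
  also have "\<dots> \<le> real (s - r) * (\<Sum>j=r..<s. 1 / (real n + 1))"
    by (intro mult_left_mono sum_mono col_prob_sq_le) simp
  finally show ?thesis by (simp add: power2_eq_square)
qed

text \<open>
  A given row or column receives the next box with probability at most \<open>1 / sqrt (n + 1)\<close>, and these bounds
  add up to at most \<open>2 sqrt n\<close>.
\<close>

lemma avg1_card_coord_le:
  assumes c: "c \<in> {fst, snd}"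
  shows "avg1 n (\<lambda>d. real (card {b \<in> d. c b < k})) \<le> 2 * real k * sqrt (real n)"
proof (induction n)
  case 0
  then show ?case by (simp add: avg1_def diagrams_0)
next
  case (Suc n)
  let ?R = "\<lambda>d. real (card {b \<in> d. c b < k})"
  have "avg1 (Suc n) ?R = avg2 n (\<lambda>d e. ?R e)" by (rule avg2_snd[symmetric])
  also have "\<dots> \<le> avg2 n (\<lambda>d e. ?R d + (\<Sum>j<k. of_bool (c (new_box d e) = j)))"
  proof (rule avg2_mono)
    fix d e assume d: "d \<in> diagrams n" "d \<hookrightarrow> e"
    let ?b = "new_box d e"
    have e: "e = insert ?b d" "?b \<notin> d" using new_box[OF d(2)] by auto
    have fin: "finite d" using d by (auto simp: diagrams_def young_diagramD(1))
    have "{b \<in> e. c b < k} = (if c ?b < k then insert ?b {b \<in> d. c b < k} else {b \<in> d. c b < k})"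
      using e by (auto simp del: split_paired_All) (metis insertE insertI1 insertI2 e(1))+
    then have "?R e = ?R d + of_bool (c ?b < k)" using fin e by simp
    also have "of_bool (c ?b < k) = (\<Sum>j<k. of_bool (c ?b = j) :: real)"
      by (simp add: of_bool_def sum.delta')
    finally show "?R e \<le> ?R d + (\<Sum>j<k. of_bool (c ?b = j))" by simp
  qed
  also have "\<dots> = avg1 n ?R + (\<Sum>j<k. avg2 n (\<lambda>d e. of_bool (c (new_box d e) = j)))"
    unfolding avg_add avg_sum avg2_fst ..
  also have "\<dots> \<le> 2 * real k * sqrt (real n) + (\<Sum>j<k. 1 / sqrt (real n + 1))"
    by (intro add_mono Suc.IH sum_mono avg2_coord_le c)
  also have "\<dots> = real k * (2 * sqrt (real n) + 1 / sqrt (real n + 1))" by (simp add: algebra_simps)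
  also have "\<dots> \<le> real k * (2 * sqrt (real n + 1))"
  proof (rule mult_left_mono)
    let ?a = "sqrt (real n)" and ?b = "sqrt (real n + 1)"
    have b: "?b > 0" "?a * ?a = real n" "?b * ?b = real n + 1" by simp_all
    have "0 \<le> (?b - ?a) * (?b - ?a)" by simp
    then have "2 * ?a * ?b + 1 \<le> 2 * ?b * ?b" using b by (simp add: algebra_simps)
    then show "2 * ?a + 1 / ?b \<le> 2 * ?b" using b(1) by (simp add: field_simps)
  qed simp
  finally show ?case by (simp add: algebra_simps)
qed

text \<open>
  A diagram with a box outside the first \<open>r\<close> columns has at least \<open>r\<close> boxes in its first row, so Markov's
  inequality applies.
\<close>

lemma left_prob_tail:
  assumes "r > 0"
  shows "avg1 n (\<lambda>d. 1 - left_prob r d) \<le> 2 * sqrt (real n + 1) / real r"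
proof -
  let ?R = "\<lambda>e. real (card {b \<in> e. snd b < 1})"
  have "avg1 n (\<lambda>d. 1 - left_prob r d) = avg2 n (\<lambda>d e. 1 - of_bool (fst (new_box d e) < r))"
    using avg2_left[of n "\<lambda>_. 1" r] by (simp add: avg_diff avg1_const avg2_const)
  also have "\<dots> \<le> avg2 n (\<lambda>d e. 1 / real r * ?R e)"
  proof (rule avg2_mono)
    fix d e assume d: "d \<in> diagrams n" "d \<hookrightarrow> e"
    show "1 - of_bool (fst (new_box d e) < r) \<le> 1 / real r * ?R e"
    proof (cases "fst (new_box d e) < r")
      case False
      obtain i j where ij: "new_box d e = (i, j)" by fastforce
      have e: "yd e" "(i, j) \<in> e" using new_box[OF d(2)] ij d by (auto simp: add_box_def)
      have "(\<lambda>i. (i, 0)) ` {..<r} \<subseteq> {b \<in> e. snd b < 1}"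
        using young_diagramD(2)[OF e, of _ 0] False ij by auto
      then have "card ((\<lambda>i. (i, 0::nat)) ` {..<r}) \<le> card {b \<in> e. snd b < 1}"
        using young_diagramD(1)[OF e(1)] by (intro card_mono) auto
      moreover have "card ((\<lambda>i. (i, 0::nat)) ` {..<r}) = r" by (simp add: card_image inj_on_def)
      ultimately show ?thesis using assms False by simp
    qed simp
  qed
  also have "\<dots> = 1 / real r * avg1 (Suc n) ?R" unfolding avg_cmult avg2_snd ..
  also have "\<dots> \<le> 1 / real r * (2 * real 1 * sqrt (real (Suc n)))"
    by (intro mult_left_mono avg1_card_coord_le) auto
  finally show ?thesis by (simp add: algebra_simps)
qed

text \<open>A diagram without the box \<open>(i, j)\<close> is covered by its first \<open>i\<close> columns and its first \<open>j\<close> rows.\<close>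

lemma avg1_missing_box:
  assumes "n > 0"
  shows "avg1 n (\<lambda>d. of_bool ((i, j) \<notin> d)) \<le> 2 * (real i + real j) / sqrt (real n)"
proof -
  have "avg1 n (\<lambda>d. of_bool ((i, j) \<notin> d)) \<le>
      avg1 n (\<lambda>d. 1 / real n * (real (card {b \<in> d. fst b < i}) + real (card {b \<in> d. snd b < j})))"
  proof (rule avg1_mono)
    fix d assume "d \<in> diagrams n"
    then have d: "yd d" "card d = n" by (auto simp: diagrams_def)
    show "of_bool ((i, j) \<notin> d) \<le> 1 / real n * (real (card {b \<in> d. fst b < i}) + real (card {b \<in> d. snd b < j}))"
    proof (cases "(i, j) \<in> d")
      case False
      have "d \<subseteq> {b \<in> d. fst b < i} \<union> {b \<in> d. snd b < j}"
      proof
        fix b assume b: "b \<in> d"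
        obtain k l where "b = (k, l)" by fastforce
        then show "b \<in> {b \<in> d. fst b < i} \<union> {b \<in> d. snd b < j}"
          using young_diagramD(2)[OF d(1), of k l i j] False b by (cases "k < i"; cases "l < j") auto
      qed
      then have "n \<le> card ({b \<in> d. fst b < i} \<union> {b \<in> d. snd b < j})"
        unfolding d(2)[symmetric] using young_diagramD(1)[OF d(1)] by (intro card_mono) auto
      also have "\<dots> \<le> card {b \<in> d. fst b < i} + card {b \<in> d. snd b < j}" by (rule card_Un_le)
      finally show ?thesis using assms False by (simp add: field_simps flip: of_nat_add)
    qed simp
  qed
  also have "\<dots> = 1 / real n * (avg1 n (\<lambda>d. real (card {b \<in> d. fst b < i})) + avg1 n (\<lambda>d. real (card {b \<in> d. snd b < j})))"
    unfolding avg_cmult avg_add ..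
  also have "\<dots> \<le> 1 / real n * (2 * real i * sqrt (real n) + 2 * real j * sqrt (real n))"
    by (intro mult_left_mono add_mono avg1_card_coord_le) auto
  also have "\<dots> = 2 * (real i + real j) * sqrt (real n) / real n" by (simp add: algebra_simps add_divide_distrib)
  also have "\<dots> = 2 * (real i + real j) * (sqrt (real n) / real n)" by simp
  also have "sqrt (real n) / real n = 1 / sqrt (real n)"
    using assms real_div_sqrt[of "real n"] by (simp add: field_simps)
  finally show ?thesis by simp
qed

section \<open>Random growth with the law of the Plancherel process\<close>

lemma sum_growth_paths_Suc:
  "(\<Sum>l\<in>growth_paths (Suc n). h l) = (\<Sum>l\<in>growth_paths n. \<Sum>e\<in>up (last l). h (l @ [e]))"
proof -
  have "growth_paths (Suc n) = (\<lambda>(l, e). l @ [e]) ` (SIGMA l:growth_paths n. up (last l))"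
    by auto
  moreover have "inj_on (\<lambda>(l, e). l @ [e]) (SIGMA l:growth_paths n. up (last l))"
    by (auto intro!: inj_onI)
  ultimately have "(\<Sum>l\<in>growth_paths (Suc n). h l) =
      (\<Sum>(l, e)\<in>(SIGMA l:growth_paths n. up (last l)). h (l @ [e]))"
    by (simp only: sum.reindex) (simp add: case_prod_unfold)
  also have "\<dots> = (\<Sum>l\<in>growth_paths n. \<Sum>e\<in>up (last l). h (l @ [e]))"
    using finite_growth_paths growth_paths_last finite_up by (subst sum.Sigma) auto
  finally show ?thesis .
qed

lemma sum_growth_paths_last:
  fixes h :: "diagram \<Rightarrow> real"
  shows "(\<Sum>l\<in>growth_paths n. h (last l)) = (\<Sum>d\<in>diagrams n. dim d * h d)"
proof -
  have "(\<Sum>l\<in>growth_paths n. h (last l)) = (\<Sum>d\<in>diagrams n. \<Sum>l | l \<in> growth_paths n \<and> last l = d. h (last l))"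
    using growth_paths_last finite_growth_paths finite_diagrams
    by (intro sum.group[symmetric]) (auto simp: diagrams_def)
  also have "\<dots> = (\<Sum>d\<in>diagrams n. dim d * h d)"
    by (intro sum.cong refl) (auto simp: card_growth_paths_to diagrams_def)
  finally show ?thesis .
qed

lemma sum_growth_paths_dim: "(\<Sum>l\<in>growth_paths n. dim (last l) / fact n) = 1"
  using avg1_const[of n 1] sum_growth_paths_last[of "\<lambda>d. dim d / fact n" n]
  by (simp add: avg1_def)

text \<open>
  Both the shapes of a random sequence of letters and the Plancherel growth process are of this kind.
\<close>

locale plancherel_process = prob_space M for M :: "'a measure" +
  fixes Z :: "'a \<Rightarrow> nat \<Rightarrow> diagram"
  assumes measurable_Z [measurable]: "\<And>n. (\<lambda>x. Z x n) \<in> M \<rightarrow>\<^sub>M count_space UNIV"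
    and prob_path: "\<And>n l. l \<in> growth_paths n \<Longrightarrow>
      prob {x \<in> space M. map (Z x) [0..<Suc n] = l} = dim (last l) / fact n"
begin

lemma path_event: "{x \<in> space M. map (Z x) [0..<n] = l} \<in> events"
proof -
  have "map (Z x) [0..<n] = l \<longleftrightarrow> length l = n \<and> (\<forall>i<n. Z x i = l ! i)" for x
    by (auto simp: list_eq_iff_nth_eq)
  moreover have "{x \<in> space M. length l = n \<and> (\<forall>i<n. Z x i = l ! i)} \<in> events" by measurable
  ultimately show ?thesis by simp
qed

lemma AE_growth_paths: "AE x in M. map (Z x) [0..<Suc n] \<in> growth_paths n"
proof -
  let ?A = "\<lambda>l. {x \<in> space M. map (Z x) [0..<Suc n] = l}"
  have "prob (\<Union>l\<in>growth_paths n. ?A l) = (\<Sum>l\<in>growth_paths n. prob (?A l))"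
    using path_event finite_growth_paths
    by (intro finite_measure_finite_Union) (auto simp: disjoint_family_on_def simp del: upt_Suc)
  also have "\<dots> = 1"
    using prob_path sum_growth_paths_dim by (simp del: upt_Suc)
  also have "(\<Union>l\<in>growth_paths n. ?A l) = {x \<in> space M. map (Z x) [0..<Suc n] \<in> growth_paths n}"
    by (auto simp del: upt_Suc)
  finally have "prob {x \<in> space M. map (Z x) [0..<Suc n] \<in> growth_paths n} = 1" .
  then show ?thesis by (auto dest: AE_prob_1)
qed

lemma AE_all_growth_paths: "AE x in M. \<forall>n. map (Z x) [0..<Suc n] \<in> growth_paths n"
  using AE_growth_paths by (simp add: AE_all_countable del: upt_Suc)

lemma growth_paths_Z:
  assumes "\<forall>n. map z [0..<Suc n] \<in> growth_paths n"
  shows "z 0 = {}" "z n \<hookrightarrow> z (Suc n)" "z n \<in> diagrams n"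
proof -
  show "z 0 = {}" using assms[rule_format, of 0] by simp
  have "map z [0..<Suc (Suc n)] \<in> growth_paths (Suc n)" using assms by blast
  then show "z n \<hookrightarrow> z (Suc n)" by auto
  show "z n \<in> diagrams n"
    using growth_paths_last[OF assms[rule_format, of n]] by (simp add: diagrams_def)
qed

lemma integral_path:
  assumes F: "(\<lambda>x. F (map (Z x) [0..<Suc n])) \<in> borel_measurable M"
  shows "(\<integral>x. F (map (Z x) [0..<Suc n]) \<partial>M) = (\<Sum>l\<in>growth_paths n. dim (last l) / fact n * (F l :: real))"
proof -
  let ?A = "\<lambda>l. {x \<in> space M. map (Z x) [0..<Suc n] = l}"
  have "(\<integral>x. F (map (Z x) [0..<Suc n]) \<partial>M) = (\<integral>x. (\<Sum>l\<in>growth_paths n. F l * indicator (?A l) x) \<partial>M)"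
  proof (rule integral_cong_AE)
    show "AE x in M. F (map (Z x) [0..<Suc n]) = (\<Sum>l\<in>growth_paths n. F l * indicator (?A l) x)"
      using AE_growth_paths[of n] AE_space
    proof eventually_elim
      case (elim x)
      have "(\<Sum>l\<in>growth_paths n. F l * indicator (?A l) x) =
          (\<Sum>l\<in>growth_paths n. if map (Z x) [0..<Suc n] = l then F l else 0)"
        using elim by (intro sum.cong) (auto simp: indicator_def)
      then show ?case using elim finite_growth_paths by (simp del: upt_Suc)
    qed
    show "(\<lambda>x. \<Sum>l\<in>growth_paths n. F l * indicator (?A l) x) \<in> borel_measurable M"
      using path_event[of "Suc n"] by (intro borel_measurable_sum borel_measurable_times) auto
  qed (rule F)
  also have "\<dots> = (\<Sum>l\<in>growth_paths n. F l * prob (?A l))"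
    using path_event[of "Suc n"]
    by (subst Bochner_Integration.integral_sum) (auto simp: emeasure_eq_measure simp del: upt_Suc)
  finally show ?thesis using prob_path by (simp add: mult.commute del: upt_Suc)
qed

lemma integral_avg1: "(\<integral>x. \<phi> (Z x n) \<partial>M) = avg1 n \<phi>"
proof -
  have "(\<integral>x. \<phi> (last (map (Z x) [0..<Suc n])) \<partial>M) = (\<Sum>l\<in>growth_paths n. dim (last l) / fact n * \<phi> (last l))"
    by (rule integral_path) (simp add: measurable_compose[OF measurable_Z])
  also have "\<dots> = avg1 n \<phi>"
    using sum_growth_paths_last[of "\<lambda>d. dim d / fact n * \<phi> d" n] by (simp add: avg1_def mult.assoc)
  finally show ?thesis by simp
qed

lemma integral_avg3:
  assumes [measurable]: "(\<lambda>x. \<phi> (Z x n) (Z x (Suc n)) (Z x (Suc (Suc n)))) \<in> borel_measurable M"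
  shows "(\<integral>x. \<phi> (Z x n) (Z x (Suc n)) (Z x (Suc (Suc n))) \<partial>M) = avg3 n \<phi>"
proof -
  let ?F = "\<lambda>l. \<phi> (l ! n) (l ! Suc n) (l ! Suc (Suc n))"
  have nth: "map (Z x) [0..<Suc (Suc (Suc n))] ! k = Z x k" if "k < Suc (Suc (Suc n))" for x k
    using that by (simp del: upt_Suc)
  have "(\<integral>x. \<phi> (Z x n) (Z x (Suc n)) (Z x (Suc (Suc n))) \<partial>M) =
      (\<integral>x. ?F (map (Z x) [0..<Suc (Suc (Suc n))]) \<partial>M)"
    by (simp add: nth del: upt_Suc)
  also have "\<dots> = (\<Sum>l\<in>growth_paths (Suc (Suc n)). dim (last l) / fact (Suc (Suc n)) * ?F l)"
    by (rule integral_path) (simp add: nth assms del: upt_Suc)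
  also have "\<dots> = (\<Sum>l\<in>growth_paths n. \<Sum>e\<in>up (last l). \<Sum>g\<in>up e.
      dim g / fact (Suc (Suc n)) * \<phi> (last l) e g)"
    unfolding sum_growth_paths_Suc
  proof (intro sum.cong refl)
    fix l e g assume l: "l \<in> growth_paths n"
    have len: "length l = Suc n" "l ! n = last l"
      using growth_paths_last[OF l] by (auto simp: last_conv_nth)
    show "dim (last ((l @ [e]) @ [g])) / fact (Suc (Suc n)) * ?F ((l @ [e]) @ [g]) =
        dim g / fact (Suc (Suc n)) * \<phi> (last l) e g"
      using len by (simp add: nth_append)
  qed simp
  also have "\<dots> = avg3 n \<phi>"
    using sum_growth_paths_last[of "\<lambda>d. \<Sum>e\<in>up d. \<Sum>g\<in>up e. dim g / fact (Suc (Suc n)) * \<phi> d e g" n]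
    by (simp add: avg3_def sum_distrib_left mult.assoc)
  finally show ?thesis .
qed

lemma integral_avg2:
  assumes "(\<lambda>x. \<phi> (Z x n) (Z x (Suc n))) \<in> borel_measurable M"
  shows "(\<integral>x. \<phi> (Z x n) (Z x (Suc n)) \<partial>M) = avg2 n \<phi>"
  using integral_avg3[of "\<lambda>d e g. \<phi> d e" n] assms avg3_fst by simp

text \<open>Every box is eventually reached, because the probability that it is still missing tends to 0.\<close>

lemma AE_box: "AE x in M. \<exists>n. b \<in> Z x n"
proof -
  obtain i j where b: "b = (i, j)" by fastforce
  let ?N = "{x \<in> space M. \<forall>n. b \<notin> Z x n}"
  have [measurable]: "Measurable.pred M (\<lambda>x. b \<in> Z x n)" for n
    by (rule measurable_compose[OF measurable_Z]) simp
  have N: "?N \<in> events" by measurable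
  have le: "prob ?N \<le> 2 * (real i + real j) / sqrt (real n)" if "n > 0" for n
  proof -
    have "prob ?N \<le> prob {x \<in> space M. b \<notin> Z x n}"
      by (intro finite_measure_mono) auto
    also have "\<dots> = (\<integral>x. indicator {x \<in> space M. b \<notin> Z x n} x \<partial>M)" by simp
    also have "\<dots> = (\<integral>x. of_bool (b \<notin> Z x n) \<partial>M)"
      by (intro Bochner_Integration.integral_cong) (auto simp: indicator_def)
    also have "\<dots> = avg1 n (\<lambda>d. of_bool (b \<notin> d))" by (rule integral_avg1)
    also have "\<dots> \<le> 2 * (real i + real j) / sqrt (real n)" unfolding b by (rule avg1_missing_box[OF that])
    finally show ?thesis .
  qed
  have "(\<lambda>n. 2 * (real i + real j) / sqrt (real n)) \<longlonglongrightarrow> 0"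
    by (intro tendsto_divide_0[OF tendsto_const] filterlim_at_top_imp_at_infinity
        filterlim_compose[OF sqrt_at_top filterlim_real_sequentially])
  then have "prob ?N \<le> 0"
    using le by (intro LIMSEQ_le_const) (auto intro!: exI[of _ 1])
  then have "prob ?N = 0" using measure_nonneg[of M ?N] by linarith
  then have "AE x in M. x \<notin> ?N" using N by (simp add: prob_eq_0)
  then show ?thesis using AE_space by eventually_elim auto
qed

lemma AE_complete_paths: "AE x in M. Z x \<in> complete_paths"
proof -
  have "AE x in M. \<forall>b. \<exists>n. b \<in> Z x n" using AE_box by (simp add: AE_all_countable)
  with AE_all_growth_paths show ?thesis
  proof eventually_elim
    case (elim x)
    then show ?case using growth_paths_Z(1,2)[OF elim(1)] by (simp add: complete_paths_def)
  qed
qed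

end

section \<open>The unit cube\<close>

abbreviation unit_interval :: "real measure" where
  "unit_interval \<equiv> restrict_space lborel {0..1}"

lemma prob_space_unit_interval: "prob_space unit_interval"
  by (intro prob_spaceI) (simp add: emeasure_restrict_space space_restrict_space)

interpretation cube: prob_space unit_cube
  unfolding unit_cube_def by (intro prob_space_PiM prob_space_unit_interval)

lemma space_unit_cube: "space unit_cube = {x. range x \<subseteq> {0..1}}"
  by (auto simp: unit_cube_def space_PiM space_restrict_space PiE_def)

lemma measurable_coord [measurable]: "(\<lambda>x. x i) \<in> borel_measurable unit_cube"
proof -
  have "(\<lambda>x. x i) \<in> unit_cube \<rightarrow>\<^sub>M unit_interval"
    unfolding unit_cube_def by (rule measurable_component_singleton) simp
  moreover have "(\<lambda>u. u) \<in> unit_interval \<rightarrow>\<^sub>M borel"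
    by (rule measurable_restrict_space1) simp
  ultimately show ?thesis by (rule measurable_compose)
qed

lemma measurable_unit_interval_iff:
  "f \<in> M \<rightarrow>\<^sub>M unit_interval \<longleftrightarrow> f \<in> borel_measurable M \<and> (\<forall>x\<in>space M. f x \<in> {0..1})"
  by (auto simp: measurable_restrict_space2_iff measurable_lborel1 measurable_lborel2 simp del: atLeastAtMost_iff)

lemma measurable_into_unit_cube:
  assumes "\<And>i. (\<lambda>x. f x i) \<in> borel_measurable M" "\<And>x i. x \<in> space M \<Longrightarrow> f x i \<in> {0..1}"
  shows "f \<in> M \<rightarrow>\<^sub>M unit_cube"
proof -
  have "(\<lambda>x. \<lambda>i\<in>UNIV. f x i) \<in> M \<rightarrow>\<^sub>M unit_cube"
    unfolding unit_cube_def using assms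
    by (intro measurable_restrict) (auto simp: measurable_unit_interval_iff)
  then show ?thesis by (simp add: restrict_def)
qed

lemma distr_unit_cube_reindex:
  assumes "inj f"
  shows "distr unit_cube unit_cube (\<lambda>x n. x (f n)) = unit_cube"
  using distr_PiM_reindex[of UNIV "\<lambda>_. unit_interval" f UNIV] assms prob_space_unit_interval
  by (simp add: unit_cube_def restrict_def)

lemma unit_cube_coord: "x \<in> space unit_cube \<Longrightarrow> x i \<in> {0..1}"
  by (auto simp: space_unit_cube simp del: atLeastAtMost_iff)

lemma measurable_reindex [measurable]: "(\<lambda>x n. x (f n)) \<in> unit_cube \<rightarrow>\<^sub>M unit_cube"
  by (rule measurable_into_unit_cube) (auto dest: unit_cube_coord)

lemma measurable_update:
  "(\<lambda>(u, x). x(m := u)) \<in> unit_interval \<Otimes>\<^sub>M unit_cube \<rightarrow>\<^sub>M unit_cube"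
proof (rule measurable_into_unit_cube)
  have 1: "(\<lambda>p. fst p) \<in> borel_measurable (unit_interval \<Otimes>\<^sub>M unit_cube)"
    by (rule measurable_compose[OF measurable_fst]) (rule measurable_restrict_space1, simp)
  have 2: "(\<lambda>p. snd p i) \<in> borel_measurable (unit_interval \<Otimes>\<^sub>M unit_cube)" for i
    by (rule measurable_compose[OF measurable_snd measurable_coord])
  fix i
  show "(\<lambda>p. (case p of (u, x) \<Rightarrow> x(m := u)) i) \<in> borel_measurable (unit_interval \<Otimes>\<^sub>M unit_cube)"
    unfolding case_prod_unfold using 1 2 by (cases "i = m") (simp_all only: fun_upd_def if_True if_False simp_thms)
next
  fix p i assume p: "p \<in> space (unit_interval \<Otimes>\<^sub>M unit_cube)"
  obtain u x where ux: "p = (u, x)" by fastforce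
  then have "u \<in> {0..1}" "x i \<in> {0..1}"
    using p unit_cube_coord[of x i] by (simp_all add: space_pair_measure space_restrict_space)
  then show "(case p of (u, x) \<Rightarrow> x(m := u)) i \<in> {0..1}" by (simp add: ux)
qed

text \<open>
  Fubini's theorem, with the coordinate \<open>m\<close> split off.
\<close>

lemma integral_resample:
  fixes f :: "(nat \<Rightarrow> real) \<Rightarrow> real"
  assumes f: "f \<in> borel_measurable unit_cube" and b: "\<And>x. x \<in> space unit_cube \<Longrightarrow> \<bar>f x\<bar> \<le> B"
  shows "(\<integral>x. f x \<partial>unit_cube) = (\<integral>x. (\<integral>u. f (x(m := u)) \<partial>unit_interval) \<partial>unit_cube)"
    "(\<lambda>x. \<integral>u. f (x(m := u)) \<partial>unit_interval) \<in> borel_measurable unit_cube"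
proof -
  interpret U: prob_space unit_interval by (rule prob_space_unit_interval)
  interpret pair_prob_space unit_interval unit_cube ..
  have d: "distr (unit_interval \<Otimes>\<^sub>M unit_cube) unit_cube (\<lambda>(u, x). x(m := u)) = unit_cube"
    using distr_pair_PiM_eq_PiM[of UNIV "\<lambda>_. unit_interval" m] prob_space_unit_interval
    by (simp add: unit_cube_def)
  have m: "(\<lambda>(u, x). f (x(m := u))) \<in> borel_measurable (unit_interval \<Otimes>\<^sub>M unit_cube)"
    using measurable_compose[OF measurable_update f, of m] unfolding case_prod_unfold .
  have int0: "integrable (unit_interval \<Otimes>\<^sub>M unit_cube) (\<lambda>(u, x). f (x(m := u)))"
  proof (rule P.integrable_const_bound[OF _ m, of B])
    show "AE p in unit_interval \<Otimes>\<^sub>M unit_cube. norm (case p of (u, x) \<Rightarrow> f (x(m := u))) \<le> B"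
    proof (rule AE_I2)
      fix p assume "p \<in> space (unit_interval \<Otimes>\<^sub>M unit_cube)"
      then have *: "(case p of (u, x) \<Rightarrow> x(m := u)) \<in> space unit_cube"
        by (rule measurable_space[OF measurable_update])
      obtain u x where ux: "p = (u, x)" by fastforce
      show "norm (case p of (u, x) \<Rightarrow> f (x(m := u))) \<le> B"
        using b[of "x(m := u)"] * unfolding ux by simp
    qed
  qed
  then have int: "integrable (unit_cube \<Otimes>\<^sub>M unit_interval) (\<lambda>(x, u). f (x(m := u)))"
    using integrable_product_swap[OF int0] by (simp only: case_prod_conv)
  have "(\<integral>x. f x \<partial>unit_cube) = (\<integral>p. (case p of (u, x) \<Rightarrow> f (x(m := u))) \<partial>(unit_interval \<Otimes>\<^sub>M unit_cube))"
    by (subst d[symmetric], subst integral_distr[OF measurable_update f]) (simp add: case_prod_unfold)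
  also have "\<dots> = (\<integral>x. (\<integral>u. f (x(m := u)) \<partial>unit_interval) \<partial>unit_cube)"
    using integral_snd[of "\<lambda>u x. f (x(m := u))"] int0 by (simp only:)
  finally show "(\<integral>x. f x \<partial>unit_cube) = (\<integral>x. (\<integral>u. f (x(m := u)) \<partial>unit_interval) \<partial>unit_cube)" .
  have "(\<lambda>(x, u). f (x(m := u))) \<in> borel_measurable (unit_cube \<Otimes>\<^sub>M unit_interval)"
    using int by (rule borel_measurable_integrable)
  then show "(\<lambda>x. \<integral>u. f (x(m := u)) \<partial>unit_interval) \<in> borel_measurable unit_cube"
    by (rule U.borel_measurable_lebesgue_integral)
qed

lemma AE_unit_interval_neq: "AE u in unit_interval. u \<noteq> a"
proof -
  have "AE u in lborel. u \<noteq> a" by (rule AE_lborel_singleton)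
  then show ?thesis by (subst AE_restrict_space_iff) auto
qed

lemma AE_unit_cube_inj: "AE x in unit_cube. inj x"
proof -
  have "AE x in unit_cube. x i \<noteq> x j" if ij: "i \<noteq> j" for i j
  proof -
    have m: "{x \<in> space unit_cube. x i = x j} \<in> sets unit_cube" by measurable
    have "cube.prob {x \<in> space unit_cube. x i = x j} =
        (\<integral>x. of_bool (x i = x j) \<partial>unit_cube)"
      by (subst Bochner_Integration.integral_cong[of unit_cube unit_cube _ "indicator {x \<in> space unit_cube. x i = x j}"])
         (auto simp: indicator_def)
    also have "\<dots> = (\<integral>x. (\<integral>u. of_bool ((x(i := u)) i = (x(i := u)) j) \<partial>unit_interval) \<partial>unit_cube)"
    proof (rule integral_resample(1)[of "\<lambda>x. of_bool (x i = x j)" 1 i])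
      show "(\<lambda>x. of_bool (x i = x j) :: real) \<in> borel_measurable unit_cube"
        unfolding of_bool_def by measurable
    qed simp
    also have "\<dots> = (\<integral>x. 0 \<partial>unit_cube)"
    proof (rule Bochner_Integration.integral_cong[OF refl])
      fix x
      show "(\<integral>u. of_bool ((x(i := u)) i = (x(i := u)) j) \<partial>unit_interval) = (0::real)"
      proof (rule integral_eq_zero_AE)
        show "AE u in unit_interval. of_bool ((x(i := u)) i = (x(i := u)) j) = (0::real)"
          using AE_unit_interval_neq[of "x j"] by eventually_elim (use ij in simp)
      qed
    qed
    finally show ?thesis using m by (simp add: cube.prob_eq_0)
  qed
  then have "AE x in unit_cube. \<forall>i j. i \<noteq> j \<longrightarrow> x i \<noteq> x j"
    by (simp add: AE_all_countable)
  then show ?thesis by eventually_elim (auto intro: injI)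
qed

section \<open>The law of the shapes\<close>

lemma row_insert_map:
  assumes "strict_mono_on S f" "insert y (set r) \<subseteq> S"
  shows "row_insert (f y) (map f r) = (case row_insert y r of (r', z) \<Rightarrow> (map f r', map_option f z))"
  using assms(2)
proof (induction y r rule: row_insert.induct)
  case (2 y a r)
  have "f y < f a \<longleftrightarrow> y < a"
    using strict_mono_on_less[OF assms(1)] 2(2) by simp
  then show ?case using 2 by (auto split: prod.splits)
qed simp

lemma rs_insert_map:
  assumes "strict_mono_on S f" "insert y (entries P) \<subseteq> S"
  shows "rs_insert (f y) (map (map f) P) = map (map f) (rs_insert y P)"
  using assms(2)
proof (induction P arbitrary: y)
  case (Cons r P)
  obtain r' z where r: "row_insert y r = (r', z)" by fastforce
  have "row_insert (f y) (map f r) = (map f r', map_option f z)"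
    using row_insert_map[OF assms(1), of y r] Cons.prems r by auto
  moreover have "set_option z \<subseteq> S" using set_row_insert[OF r] Cons.prems by auto
  ultimately show ?case using Cons r by (cases z) auto
qed simp

text \<open>
  Insertion only compares letters.  So the shape of \<open>n\<close> letters depends on their ranks only, which makes it
  measurable.
\<close>

lemma sh_map:
  assumes "strict_mono_on S f" "set w \<subseteq> S"
  shows "sh (map f w) = sh w"
proof -
  have "ins (map f w) = map (map f) (ins w)"
    using assms(2)
  proof (induction w rule: rev_induct)
    case (snoc y w)
    then show ?case using rs_insert_map[OF assms(1), of y "ins w"] by simp
  qed simp
  then show ?thesis by (simp add: sh_def comp_def)
qed

lemma rsk_shape_ranks:
  "rsk_shape x n = sh (map real (map (\<lambda>i. card {j \<in> {..<n}. x j < x i}) [0..<n]))"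
proof -
  let ?f = "\<lambda>a. real (card {j \<in> {..<n}. x j < a})"
  have "strict_mono_on (x ` {..<n}) ?f"
  proof (rule strict_mono_onI)
    fix a b assume ab: "a \<in> x ` {..<n}" "a < b"
    then have "{j \<in> {..<n}. x j < a} \<subset> {j \<in> {..<n}. x j < b}" by auto
    then show "?f a < ?f b" by (simp add: psubset_card_mono)
  qed
  then have "sh (map ?f (map x [0..<n])) = sh (map x [0..<n])"
    by (rule sh_map) auto
  then show ?thesis by (simp add: rsk_shape_eq_sh comp_def)
qed

lemma measurable_rsk_shape [measurable]: "(\<lambda>x. rsk_shape x n) \<in> unit_cube \<rightarrow>\<^sub>M count_space UNIV"
proof -
  let ?g = "\<lambda>x :: nat \<Rightarrow> real. map (\<lambda>i. card {j \<in> {..<n}. x j < x i}) [0..<n]"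
  have card: "card {j \<in> {..<n}. x j < x i} = k \<longleftrightarrow>
      (\<exists>A\<in>Pow {..<n}. card A = k \<and> (\<forall>j\<in>{..<n}. x j < x i \<longleftrightarrow> j \<in> A))" for x :: "nat \<Rightarrow> real" and i k
  proof
    assume "card {j \<in> {..<n}. x j < x i} = k"
    then show "\<exists>A\<in>Pow {..<n}. card A = k \<and> (\<forall>j\<in>{..<n}. x j < x i \<longleftrightarrow> j \<in> A)"
      by (intro bexI[of _ "{j \<in> {..<n}. x j < x i}"]) auto
  next
    assume "\<exists>A\<in>Pow {..<n}. card A = k \<and> (\<forall>j\<in>{..<n}. x j < x i \<longleftrightarrow> j \<in> A)"
    then obtain A where A: "A \<subseteq> {..<n}" "card A = k" "\<forall>j\<in>{..<n}. x j < x i \<longleftrightarrow> j \<in> A" by blast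
    then have "{j \<in> {..<n}. x j < x i} = A" by blast
    then show "card {j \<in> {..<n}. x j < x i} = k" using A by simp
  qed
  have "?g \<in> unit_cube \<rightarrow>\<^sub>M count_space UNIV"
  proof (rule measurable_count_space_eq2_countable[THEN iffD2], intro conjI ballI)
    fix l :: "nat list"
    have "?g x = l \<longleftrightarrow> length l = n \<and> (\<forall>i\<in>{..<n}. card {j \<in> {..<n}. x j < x i} = l ! i)" for x
      by (auto simp: list_eq_iff_nth_eq)
    moreover have "{x \<in> space unit_cube. length l = n \<and> (\<forall>i\<in>{..<n}. \<exists>A\<in>Pow {..<n}. card A = l ! i \<and>
        (\<forall>j\<in>{..<n}. x j < x i \<longleftrightarrow> j \<in> A))} \<in> sets unit_cube"
      by measurable
    ultimately have "{x \<in> space unit_cube. ?g x = l} \<in> sets unit_cube" unfolding card by simp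
    moreover have "?g -` {l} \<inter> space unit_cube = {x \<in> space unit_cube. ?g x = l}" by blast
    ultimately show "?g -` {l} \<inter> space unit_cube \<in> sets unit_cube" by simp
  qed auto
  from measurable_compose[OF this, of "\<lambda>l. sh (map real l)" "count_space UNIV"]
  show ?thesis unfolding rsk_shape_ranks by simp
qed

lemma shape_path_eq_time_path: "map (rsk_shape x) [0..<Suc n] = time_path (map x [0..<n])"
  by (auto simp: time_path_def rsk_shape_eq_sh take_map simp del: upt_Suc)

lemma shape_path_growth:
  assumes "inj x"
  shows "map (rsk_shape x) [0..<Suc n] \<in> growth_paths n"
proof (induction n)
  case 0
  then show ?case by (simp add: rsk_shape_eq_sh)
next
  case (Suc n)
  have "distinct (map x [0..<Suc n])" using assms by (simp add: distinct_map inj_on_subset[OF assms] del: upt_Suc)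
  then have "rsk_shape x n \<hookrightarrow> rsk_shape x (Suc n)"
    unfolding rsk_shape_eq_sh using sh_snoc_add_box[of "map x [0..<n]" "x n"] by simp
  then show ?case using Suc by (auto intro!: bexI[of _ "map (rsk_shape x) [0..<Suc n]"])
qed

text \<open>
  All rearrangements of the first \<open>n\<close> coordinates have the same law, and by the injectivity of the
  Robinson--Schensted correspondence at most \<open>dim (last l)\<close> of them produce the path \<open>l\<close>.
\<close>

lemma shape_path_prob_le:
  "cube.prob {x \<in> space unit_cube. map (rsk_shape x) [0..<Suc n] = l} \<le> dim (last l) / fact n"
proof -
  let ?A = "{x \<in> space unit_cube. map (rsk_shape x) [0..<Suc n] = l}"
  let ?S = "{p. p permutes {..<n}}"
  let ?B = "\<lambda>p. {x \<in> space unit_cube. map (rsk_shape (\<lambda>i. x (p i))) [0..<Suc n] = l}"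
  have eq: "map (rsk_shape x) [0..<Suc n] = l \<longleftrightarrow> length l = Suc n \<and> (\<forall>i\<in>{..<Suc n}. rsk_shape x i = l ! i)" for x
    by (auto simp: list_eq_iff_nth_eq simp del: upt_Suc)
  have A: "?A \<in> sets unit_cube" unfolding eq by measurable
  have fin: "finite ?S" by (simp add: finite_permutations)
  have B: "?B p = (\<lambda>x n. x (p n)) -` ?A \<inter> space unit_cube" for p
    using measurable_space[OF measurable_reindex[of p]] by auto
  have BM: "?B p \<in> sets unit_cube" for p
    by (rule ssubst[OF B[of p]]) (rule measurable_sets[OF measurable_reindex A])
  have "cube.prob (?B p) = cube.prob ?A" if "p \<in> ?S" for p
  proof -
    have "inj p" using that permutes_inj by blast
    then have "cube.prob ?A = measure (distr unit_cube unit_cube (\<lambda>x n. x (p n))) ?A"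
      by (simp add: distr_unit_cube_reindex)
    also have "\<dots> = cube.prob ((\<lambda>x n. x (p n)) -` ?A \<inter> space unit_cube)"
      by (rule measure_distr[OF measurable_reindex A])
    also have "\<dots> = cube.prob (?B p)" by (rule arg_cong[OF B[of p, symmetric], of cube.prob])
    finally show ?thesis by simp
  qed
  then have "fact n * cube.prob ?A = (\<Sum>p\<in>?S. cube.prob (?B p))"
    using card_permutations[of "{..<n}" n] by simp
  also have "\<dots> = (\<Sum>p\<in>?S. \<integral>x. indicator (?B p) x \<partial>unit_cube)"
  proof (rule sum.cong[OF refl])
    fix p
    have "?B p \<inter> space unit_cube = ?B p" by blast
    then show "cube.prob (?B p) = (\<integral>x. indicator (?B p) x \<partial>unit_cube)" by (simp del: upt_Suc)
  qed
  also have "\<dots> = (\<integral>x. (\<Sum>p\<in>?S. indicator (?B p) x) \<partial>unit_cube)"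
    by (rule Bochner_Integration.integral_sum[symmetric])
       (rule integrable_real_indicator[OF BM], simp add: cube.emeasure_eq_measure)
  also have "\<dots> \<le> (\<integral>x. dim (last l) \<partial>unit_cube)"
  proof (rule integral_mono_AE)
    show "integrable unit_cube (\<lambda>x. \<Sum>p\<in>?S. indicator (?B p) x :: real)"
      by (intro Bochner_Integration.integrable_sum integrable_real_indicator[OF BM])
         (simp add: cube.emeasure_eq_measure)
    show "AE x in unit_cube. (\<Sum>p\<in>?S. indicator (?B p) x) \<le> dim (last l)"
      using AE_unit_cube_inj
    proof eventually_elim
      case (elim x)
      let ?w = "\<lambda>p. map (\<lambda>i. x (p i)) [0..<n]"
      have "(\<Sum>p\<in>?S. indicator (?B p) x :: real) \<le> real (card {p \<in> ?S. time_path (?w p) = l})"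
      proof -
        have "(\<Sum>p\<in>?S. indicator (?B p) x :: real) \<le> (\<Sum>p\<in>?S. of_bool (time_path (?w p) = l))"
          by (intro sum_mono) (auto simp: indicator_def shape_path_eq_time_path simp del: upt_Suc)
        also have "\<dots> = real (card {p \<in> ?S. time_path (?w p) = l})"
          using fin by (simp add: Collect_conj_eq of_bool_def sum.If_cases)
        finally show ?thesis .
      qed
      also have "card {p \<in> ?S. time_path (?w p) = l} \<le>
          card {w \<in> permutations_of_set (x ` {..<n}). time_path w = l}"
      proof (rule card_inj_on_le[where f="?w"])
        show "inj_on ?w {p \<in> ?S. time_path (?w p) = l}"
        proof (rule inj_onI)
          fix p q assume "p \<in> {p \<in> ?S. time_path (?w p) = l}" "q \<in> {p \<in> ?S. time_path (?w p) = l}"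
            and "?w p = ?w q"
          then have pq: "p permutes {..<n}" "q permutes {..<n}" "\<forall>i<n. x (p i) = x (q i)" by auto
          show "p = q"
          proof (rule ext)
            fix i
            show "p i = q i"
              using pq injD[OF elim, of "p i" "q i"] permutes_not_in[OF pq(1), of i]
                permutes_not_in[OF pq(2), of i] by (cases "i < n") auto
          qed
        qed
        show "?w ` {p \<in> ?S. time_path (?w p) = l} \<subseteq> {w \<in> permutations_of_set (x ` {..<n}). time_path w = l}"
        proof (rule image_subsetI)
          fix p assume "p \<in> {p \<in> ?S. time_path (?w p) = l}"
          then have p: "p permutes {..<n}" "time_path (?w p) = l" by auto
          have "set (?w p) = x ` p ` {..<n}" by (auto simp: image_image)
          then have "set (?w p) = x ` {..<n}" using permutes_image[OF p(1)] by simp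
          moreover have "distinct (?w p)"
            using elim permutes_inj[OF p(1)] by (auto simp: distinct_map inj_on_def dest: injD)
          ultimately show "?w p \<in> {w \<in> permutations_of_set (x ` {..<n}). time_path w = l}"
            using p(2) by (auto simp: permutations_of_set_def)
        qed
      qed simp
      also have "\<dots> \<le> num_syt (last l)" by (rule card_words_time_path) simp
      finally show ?case by simp
    qed
  qed simp
  finally show ?thesis by (simp add: field_simps cube.prob_space del: upt_Suc)
qed

text \<open>
  The upper bounds of \<open>shape_path_prob_le\<close> add up to the total probability 1.
\<close>

lemma shape_path_prob:
  assumes "l \<in> growth_paths n"
  shows "cube.prob {x \<in> space unit_cube. map (rsk_shape x) [0..<Suc n] = l} = dim (last l) / fact n"
proof -
  let ?A = "\<lambda>l. {x \<in> space unit_cube. map (rsk_shape x) [0..<Suc n] = l}"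
  have eq: "map (rsk_shape x) [0..<Suc n] = l \<longleftrightarrow> length l = Suc n \<and> (\<forall>i\<in>{..<Suc n}. rsk_shape x i = l ! i)" for x l
    by (auto simp: list_eq_iff_nth_eq simp del: upt_Suc)
  have A: "?A l \<in> sets unit_cube" for l unfolding eq by measurable
  have "(\<Sum>l\<in>growth_paths n. cube.prob (?A l)) = cube.prob (\<Union>l\<in>growth_paths n. ?A l)"
    using A finite_growth_paths
    by (intro cube.finite_measure_finite_Union[symmetric]) (auto simp: disjoint_family_on_def simp del: upt_Suc)
  also have "\<dots> = 1"
  proof (rule cube.prob_eq_1[THEN iffD2])
    show "(\<Union>l\<in>growth_paths n. ?A l) \<in> cube.events" using A finite_growth_paths by (intro sets.finite_UN) auto
    show "AE x in unit_cube. x \<in> (\<Union>l\<in>growth_paths n. ?A l)"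
      using AE_unit_cube_inj AE_space by eventually_elim (use shape_path_growth in \<open>auto simp del: upt_Suc\<close>)
  qed
  finally have "(\<Sum>l\<in>growth_paths n. dim (last l) / fact n - cube.prob (?A l)) = 0"
    using sum_growth_paths_dim by (simp add: sum_subtractf del: upt_Suc)
  then show ?thesis
    using shape_path_prob_le assms finite_growth_paths
    by (subst (asm) sum_nonneg_eq_0_iff) (auto simp del: upt_Suc)
qed

interpretation shapes: plancherel_process unit_cube rsk_shape
  by unfold_locales (rule measurable_rsk_shape, rule shape_path_prob)

lemma growth_path_prob:
  assumes "l \<in> growth_paths n"
  shows "measure plancherel_growth {d \<in> space plancherel_growth. map d [0..<Suc n] = l} = dim (last l) / fact n"
proof -
  have trans: "l \<in> growth_paths n \<Longrightarrow> l ! 0 = {} \<and> (\<forall>i<n. yd (l ! i)) \<and>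
      (\<Prod>i<n. plancherel_transition (l ! i) (l ! Suc i)) = dim (last l) / fact n" for l
  proof (induction n arbitrary: l)
    case 0
    then show ?case by (simp add: num_syt_empty)
  next
    case (Suc n)
    then obtain k e where k: "l = k @ [e]" "k \<in> growth_paths n" "last k \<hookrightarrow> e" by auto
    have len: "length k = Suc n" "yd (last k)" "last k \<in> diagrams n" "k \<noteq> []"
      using growth_paths_last[OF k(2)] by (simp_all add: diagrams_def)
    have last: "last k = k ! n" using last_conv_nth[OF len(4)] len(1) by simp
    have "(\<Prod>i<Suc n. plancherel_transition (l ! i) (l ! Suc i)) =
        (\<Prod>i<n. plancherel_transition (k ! i) (k ! Suc i)) * plancherel_transition (last k) e"
      using len(1) last k(1) by (simp add: nth_append)
    also have "\<dots> = dim (last k) / fact n * (dim e / ((real n + 1) * dim (last k)))"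
      using Suc.IH[OF k(2)] plancherel_transition_up[OF len(3)] k(3) by simp
    also have "\<dots> = dim e / fact (Suc n)" using dim_pos[OF len(2)] by (simp add: add.commute)
    finally show ?case
      using Suc.IH[OF k(2)] len(1,2) last k(1) by (auto simp: nth_append less_Suc_eq)
  qed
  have sp: "space plancherel_growth = UNIV" by (simp add: space_PiM)
  have iff: "map d [0..<Suc n] = l \<longleftrightarrow> (\<forall>i\<le>n. d i = l ! i)" for d
  proof -
    have "length l = Suc n" using growth_paths_last[OF assms] by blast
    then show ?thesis by (auto simp: list_eq_iff_nth_eq less_Suc_eq_le simp del: upt_Suc)
  qed
  have event: "{d \<in> space plancherel_growth. map d [0..<Suc n] = l} = {d. \<forall>i\<le>n. d i = l ! i}"
    unfolding sp iff by (simp only: UNIV_I simp_thms)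
  have l: "l ! 0 = {}" "\<And>i. i < n \<Longrightarrow> yd (l ! i)"
    "(\<Prod>i<n. plancherel_transition (l ! i) (l ! Suc i)) = dim (last l) / fact n"
    using trans[OF assms] by blast+
  have "emeasure plancherel_growth {d. \<forall>i\<le>n. d i = l ! i} = ennreal (dim (last l) / fact n)"
    unfolding l(3)[symmetric] by (rule plancherel_growth_cylinder[of "(!) l" n, OF l(1,2)])
  moreover have "0 \<le> dim (last l) / fact n" by simp
  ultimately show ?thesis unfolding event measure_def by (simp only: enn2real_ennreal)
qed

lemma sets_plancherel_growth:
  "sets plancherel_growth = sets (\<Pi>\<^sub>M i\<in>UNIV. count_space (UNIV :: diagram set))"
  by simp

interpretation growth: plancherel_process plancherel_growth "\<lambda>d. d"
proof (intro plancherel_process.intro plancherel_process_axioms.intro prob_space_plancherel_growth)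
  show "(\<lambda>d. d n) \<in> plancherel_growth \<rightarrow>\<^sub>M count_space UNIV" for n
    using measurable_component_singleton[of n UNIV "\<lambda>_. count_space (UNIV :: diagram set)"]
    unfolding measurable_cong_sets[OF sets_plancherel_growth refl] by simp
qed (rule growth_path_prob)

section \<open>The column of the new box determines the inserted letter asymptotically\<close>

lemma finite_rsk_shape: "finite (rsk_shape x n)"
proof -
  have "diagram_of l \<subseteq> (\<Union>j<length l. {..<l ! j} \<times> {j})" for l by auto
  then show ?thesis unfolding rsk_shape_def by (rule finite_subset) auto
qed

lemma measurable_rsk_shape_finite:
  "(\<lambda>x. rsk_shape x n) \<in> unit_cube \<rightarrow>\<^sub>M count_space {d. finite d}"
proof (rule measurableI)
  fix A :: "diagram set" 
  have "(\<lambda>x. rsk_shape x n) -` A \<inter> space unit_cube \<in> sets unit_cube"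
    by (rule measurable_sets[OF measurable_rsk_shape]) simp
  then show "(\<lambda>x. rsk_shape x n) -` A \<inter> space unit_cube \<in> sets unit_cube" .
qed (simp add: finite_rsk_shape)

lemma measurable_shapes:
  assumes "\<And>d. finite d \<Longrightarrow> f d \<in> unit_cube \<rightarrow>\<^sub>M N"
  shows "(\<lambda>x. f (rsk_shape x n) x) \<in> unit_cube \<rightarrow>\<^sub>M N"
  by (rule measurable_compose_countable'[OF _ measurable_rsk_shape_finite])
     (use assms countable_Collect_finite in auto)

lemma measurable_shapes2:
  assumes "\<And>d e. f d e \<in> space N"
  shows "(\<lambda>x. f (rsk_shape x m) (rsk_shape x n)) \<in> unit_cube \<rightarrow>\<^sub>M N"
proof (rule measurable_shapes[where f="\<lambda>d x. f d (rsk_shape x n)"])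
  fix d
  show "(\<lambda>x. f d (rsk_shape x n)) \<in> unit_cube \<rightarrow>\<^sub>M N"
    by (rule measurable_compose[OF measurable_rsk_shape]) (simp add: assms)
qed

lemma measurable_shapes2_borel:
  fixes f :: "diagram \<Rightarrow> diagram \<Rightarrow> real"
  shows "(\<lambda>x. f (rsk_shape x m) (rsk_shape x n)) \<in> borel_measurable unit_cube"
  by (rule measurable_shapes2) simp

lemma measurable_shapes3_borel:
  fixes f :: "diagram \<Rightarrow> diagram \<Rightarrow> diagram \<Rightarrow> real"
  shows "(\<lambda>x. f (rsk_shape x k) (rsk_shape x m) (rsk_shape x n)) \<in> borel_measurable unit_cube"
  by (rule measurable_shapes[where f="\<lambda>d x. f d (rsk_shape x m) (rsk_shape x n)"])
     (rule measurable_shapes2_borel)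

lemma rsk_shape_cong: "(\<And>i. i < n \<Longrightarrow> x i = y i) \<Longrightarrow> rsk_shape x n = rsk_shape y n"
  unfolding rsk_shape_eq_sh by (intro arg_cong[of _ _ sh]) simp

lemma measurable_of_bool_less: "(\<lambda>u. of_bool (u < h) :: real) \<in> borel_measurable borel" for h :: real
proof -
  have "(\<lambda>u. of_bool (u < h) :: real) = indicator {..<h}" by (auto simp: indicator_def fun_eq_iff)
  then show ?thesis by simp
qed

lemma integral_unit_interval_less:
  assumes "0 \<le> h" "h \<le> 1"
  shows "(\<integral>u. of_bool (u < h) \<partial>unit_interval) = h"
    "(\<integral>u. u * of_bool (u < h) \<partial>unit_interval) = h\<^sup>2 / 2"
proof -
  have AE: "AE u in lborel. u \<noteq> h" by (rule AE_lborel_singleton)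
  have "(\<integral>u. (of_bool (u < h) :: real) \<partial>unit_interval) = (\<integral>u. indicator {0..1} u *\<^sub>R of_bool (u < h) \<partial>lborel)"
    by (rule Bochner_Integration.integral_restrict_space) simp
  also have "\<dots> = (\<integral>u. u ^ 0 * indicator {0..h} u \<partial>lborel)"
  proof (rule integral_cong_AE)
    show "(\<lambda>u. indicator {0..1} u *\<^sub>R of_bool (u < h) :: real) \<in> borel_measurable lborel"
      using measurable_of_bool_less[of h] by (intro borel_measurable_scaleR) simp_all
    show "AE u in lborel. indicator {0..1} u *\<^sub>R of_bool (u < h) = (u ^ 0 * indicator {0..h} u :: real)"
      using AE by eventually_elim (use assms in \<open>auto simp: indicator_def\<close>)
  qed simp
  also have "\<dots> = h" using assms by (subst integral_power) simp_all
  finally show "(\<integral>u. of_bool (u < h) \<partial>unit_interval) = h" .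
  have "(\<integral>u. u * of_bool (u < h) \<partial>unit_interval) = (\<integral>u. indicator {0..1} u *\<^sub>R (u * of_bool (u < h)) \<partial>lborel)"
    by (rule Bochner_Integration.integral_restrict_space) simp
  also have "\<dots> = (\<integral>u. u ^ 1 * indicator {0..h} u \<partial>lborel)"
  proof (rule integral_cong_AE)
    show "(\<lambda>u. indicator {0..1} u *\<^sub>R (u * of_bool (u < h)) :: real) \<in> borel_measurable lborel"
      using measurable_of_bool_less[of h]
      by (intro borel_measurable_scaleR borel_measurable_times) simp_all
    show "AE u in lborel. indicator {0..1} u *\<^sub>R (u * of_bool (u < h)) = (u ^ 1 * indicator {0..h} u :: real)"
      using AE by eventually_elim (use assms in \<open>auto simp: indicator_def\<close>)
  qed simp
  also have "\<dots> = h\<^sup>2 / 2" using assms by (subst integral_power) (simp_all add: power2_eq_square)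
  finally show "(\<integral>u. u * of_bool (u < h) \<partial>unit_interval) = h\<^sup>2 / 2" .
qed

definition in_left :: "nat \<Rightarrow> nat \<Rightarrow> (nat \<Rightarrow> real) \<Rightarrow> bool" where
  "in_left m r x \<longleftrightarrow> fst (new_box (rsk_shape x m) (rsk_shape x (Suc m))) < r"

text \<open>
  Given the first \<open>m\<close> letters, the letters whose insertion adds a box in the first \<open>r\<close> columns
  form an initial segment of the unit interval; this is its length.
\<close>

definition threshold :: "nat \<Rightarrow> nat \<Rightarrow> (nat \<Rightarrow> real) \<Rightarrow> real" where
  "threshold m r x = (\<integral>u. of_bool (in_left m r (x(m := u))) \<partial>unit_interval)"

lemma measurable_in_left [measurable]: "Measurable.pred unit_cube (in_left m r)"
  unfolding in_left_def[abs_def] by (rule measurable_shapes2) simp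

lemma measurable_in_left_borel [measurable]:
  "(\<lambda>x. of_bool (in_left m r x) :: real) \<in> borel_measurable unit_cube"
  unfolding of_bool_def by measurable

lemma measurable_in_left_update:
  assumes "x \<in> space unit_cube"
  shows "(\<lambda>u. of_bool (in_left m r (x(m := u))) :: real) \<in> borel_measurable unit_interval"
proof -
  have "(\<lambda>u. (u, x)) \<in> unit_interval \<rightarrow>\<^sub>M unit_interval \<Otimes>\<^sub>M unit_cube"
    using assms by (intro measurable_Pair) simp_all
  from measurable_compose[OF measurable_compose[OF this measurable_update] measurable_in_left_borel]
  show ?thesis by (simp only: case_prod_conv)
qed

lemma measurable_threshold [measurable]: "threshold m r \<in> borel_measurable unit_cube"
  unfolding threshold_def[abs_def]
  by (rule integral_resample(2)[where B=1]) simp_all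

lemma AE_unit_interval_notin: "finite A \<Longrightarrow> AE u in unit_interval. u \<notin> A"
proof -
  assume "finite A"
  then have "AE u in unit_interval. \<forall>a\<in>A. u \<noteq> a"
    using AE_unit_interval_neq by (simp add: AE_finite_all)
  then show ?thesis by eventually_elim blast
qed

lemma AE_unit_interval: "AE u in unit_interval. u \<in> {0..1}"
  using AE_space[of unit_interval] by (simp add: space_restrict_space)

lemma in_left_mono:
  assumes x: "inj x" and u: "u \<notin> x ` {..<m}" "v \<notin> x ` {..<m}" "u \<le> v" and v: "in_left m r (x(m := v))"
  shows "in_left m r (x(m := u))"
proof -
  have eq: "rsk_shape (x(m := a)) m = sh (map x [0..<m])"
      "rsk_shape (x(m := a)) (Suc m) = sh (map x [0..<m] @ [a])" for a
    unfolding rsk_shape_eq_sh by (auto intro!: arg_cong[of _ _ sh])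
  have "distinct (map x [0..<m] @ [a])" if "a \<notin> x ` {..<m}" for a
    using that x by (auto simp: distinct_map inj_on_def dest: injD)
  then show ?thesis
    using v new_col_mono[of "map x [0..<m]" u v] u unfolding in_left_def eq by fastforce
qed

lemma threshold_bounds: "0 \<le> threshold m r x" "x \<in> space unit_cube \<Longrightarrow> threshold m r x \<le> 1"
proof -
  interpret U: prob_space unit_interval by (rule prob_space_unit_interval)
  show "0 \<le> threshold m r x" unfolding threshold_def by (rule Bochner_Integration.integral_nonneg) simp
  assume x: "x \<in> space unit_cube"
  have "integrable unit_interval (\<lambda>u. of_bool (in_left m r (x(m := u))) :: real)"
    by (rule U.integrable_const_bound[OF _ measurable_in_left_update[OF x], where B=1]) simp
  then show "threshold m r x \<le> 1" unfolding threshold_def by (rule U.integral_le_const) simp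
qed

text \<open>
  An initial segment of the unit interval of length \<open>H\<close> contains the points below \<open>H\<close> and none above \<open>H\<close>.
\<close>

lemma threshold_cmp:
  assumes x: "inj x" "x \<in> space unit_cube" and u: "u \<notin> x ` {..<m}" "0 \<le> u" "u \<le> 1"
  shows "in_left m r (x(m := u)) \<Longrightarrow> u \<le> threshold m r x"
    "\<not> in_left m r (x(m := u)) \<Longrightarrow> threshold m r x \<le> u"
proof -
  interpret U: prob_space unit_interval by (rule prob_space_unit_interval)
  have AE: "AE w in unit_interval. w \<notin> x ` {..<m}" by (rule AE_unit_interval_notin) simp
  have int1: "integrable unit_interval (\<lambda>w. of_bool (in_left m r (x(m := w))) :: real)"
    by (rule U.integrable_const_bound[OF _ measurable_in_left_update[OF x(2)], where B=1]) simp
  have m2: "(\<lambda>w. of_bool (w < u) :: real) \<in> borel_measurable unit_interval"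
    by (rule measurable_restrict_space1) (simp add: measurable_of_bool_less)
  have int2: "integrable unit_interval (\<lambda>w. of_bool (w < u) :: real)"
    by (rule U.integrable_const_bound[OF _ m2, where B=1]) simp
  note h = integral_unit_interval_less(1)[OF u(2,3)]
  show "u \<le> threshold m r x" if "in_left m r (x(m := u))"
  proof -
    have "(\<integral>w. of_bool (w < u) \<partial>unit_interval) \<le> threshold m r x"
      unfolding threshold_def
    proof (rule integral_mono_AE[OF int2 int1])
      show "AE w in unit_interval. of_bool (w < u) \<le> (of_bool (in_left m r (x(m := w))) :: real)"
        using AE
      proof eventually_elim
        case (elim w)
        then show ?case using in_left_mono[OF x(1) elim u(1) _ that] by auto
      qed
    qed
    then show ?thesis using h by simp
  qed
  show "threshold m r x \<le> u" if "\<not> in_left m r (x(m := u))"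
  proof -
    have "threshold m r x \<le> (\<integral>w. of_bool (w < u) \<partial>unit_interval)"
      unfolding threshold_def
    proof (rule integral_mono_AE[OF int1 int2])
      show "AE w in unit_interval. (of_bool (in_left m r (x(m := w))) :: real) \<le> of_bool (w < u)"
        using AE
      proof eventually_elim
        case (elim w)
        then show ?case using in_left_mono[OF x(1) u(1) elim, of r] that by (auto simp: not_less)
      qed
    qed
    then show ?thesis using h by simp
  qed
qed

text \<open>
  Given the other letters, \<open>x m\<close> is uniformly distributed and \<^const>\<open>in_left\<close> means that it is below the
  threshold \<open>H\<close>, while \<open>x (Suc m)\<close> is independent and falls below \<open>x m\<close> with probability \<open>x m\<close>.  So the
  event on the right-hand side has the integral of \<open>u\<close> from 0 to \<open>H\<close> as its conditional probability.
\<close>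

lemma integral_threshold_sq:
  "(\<integral>x. (threshold m r x)\<^sup>2 \<partial>unit_cube) = 2 * (\<integral>x. of_bool (in_left m r x \<and> x (Suc m) < x m) \<partial>unit_cube)"
proof -
  have "(\<integral>x. (of_bool (in_left m r x \<and> x (Suc m) < x m) :: real) \<partial>unit_cube) =
      (\<integral>x. (\<integral>u. of_bool (in_left m r (x(Suc m := u)) \<and> (x(Suc m := u)) (Suc m) < (x(Suc m := u)) m) \<partial>unit_interval) \<partial>unit_cube)"
  proof (rule integral_resample(1)[of "\<lambda>x. of_bool (in_left m r x \<and> x (Suc m) < x m)" 1])
    show "(\<lambda>x. of_bool (in_left m r x \<and> x (Suc m) < x m) :: real) \<in> borel_measurable unit_cube"
      unfolding of_bool_def by measurable
  qed simp
  also have "\<dots> = (\<integral>x. of_bool (in_left m r x) * x m \<partial>unit_cube)"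
  proof (rule Bochner_Integration.integral_cong[OF refl])
    fix x assume x: "x \<in> space unit_cube"
    have "in_left m r (x(Suc m := u)) = in_left m r x" for u
      unfolding in_left_def using rsk_shape_cong[of m "x(Suc m := u)" x] rsk_shape_cong[of "Suc m" "x(Suc m := u)" x]
      by simp
    then have "(\<integral>u. (of_bool (in_left m r (x(Suc m := u)) \<and> (x(Suc m := u)) (Suc m) < (x(Suc m := u)) m) :: real) \<partial>unit_interval) =
        (\<integral>u. of_bool (in_left m r x) * of_bool (u < x m) \<partial>unit_interval)"
      by (simp add: of_bool_conj)
    also have "\<dots> = of_bool (in_left m r x) * (x m :: real)"
      using integral_unit_interval_less(1)[of "x m"] unit_cube_coord[OF x, of m] by simp
    finally show "(\<integral>u. of_bool (in_left m r (x(Suc m := u)) \<and> (x(Suc m := u)) (Suc m) < (x(Suc m := u)) m) \<partial>unit_interval) =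
        of_bool (in_left m r x) * (x m :: real)" .
  qed
  also have "\<dots> = (\<integral>x. (\<integral>u. of_bool (in_left m r (x(m := u))) * (x(m := u)) m \<partial>unit_interval) \<partial>unit_cube)"
  proof (rule integral_resample(1)[of "\<lambda>x. of_bool (in_left m r x) * x m" 1])
    fix x assume "x \<in> space unit_cube"
    then show "\<bar>of_bool (in_left m r x) * x m\<bar> \<le> 1" using unit_cube_coord[of x m] by auto
  qed (rule borel_measurable_times[OF measurable_in_left_borel measurable_coord])
  also have "\<dots> = (\<integral>x. (threshold m r x)\<^sup>2 / 2 \<partial>unit_cube)"
  proof (rule integral_cong_AE)
    show "(\<lambda>x. \<integral>u. of_bool (in_left m r (x(m := u))) * (x(m := u)) m \<partial>unit_interval) \<in> borel_measurable unit_cube"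
    proof (rule integral_resample(2)[of "\<lambda>x. of_bool (in_left m r x) * x m" 1])
      fix x assume "x \<in> space unit_cube"
      then show "\<bar>of_bool (in_left m r x) * x m\<bar> \<le> 1" using unit_cube_coord[of x m] by auto
    qed (rule borel_measurable_times[OF measurable_in_left_borel measurable_coord])
    show "AE x in unit_cube. (\<integral>u. of_bool (in_left m r (x(m := u))) * (x(m := u)) m \<partial>unit_interval) = (threshold m r x)\<^sup>2 / 2"
      using AE_unit_cube_inj AE_space
    proof eventually_elim
      case (elim x)
      let ?h = "threshold m r x"
      have h: "0 \<le> ?h" "?h \<le> 1" using threshold_bounds elim by auto
      have "(\<integral>u. of_bool (in_left m r (x(m := u))) * (x(m := u)) m \<partial>unit_interval) =
          (\<integral>u. u * of_bool (u < ?h) \<partial>unit_interval)"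
      proof (rule integral_cong_AE)
        have id: "(\<lambda>u. u) \<in> borel_measurable unit_interval" by (rule measurable_restrict_space1) simp
        have notin: "AE u in unit_interval. u \<notin> x ` {..<m}" by (rule AE_unit_interval_notin) simp
        show "(\<lambda>u. of_bool (in_left m r (x(m := u))) * (x(m := u)) m) \<in> borel_measurable unit_interval"
          using borel_measurable_times[OF measurable_in_left_update[OF elim(2), of m r] id]
          by (simp only: fun_upd_same)
        show "(\<lambda>u. u * of_bool (u < ?h) :: real) \<in> borel_measurable unit_interval"
          using measurable_of_bool_less[of ?h]
          by (intro measurable_restrict_space1 borel_measurable_times) simp_all
        show "AE u in unit_interval. of_bool (in_left m r (x(m := u))) * (x(m := u)) m = u * of_bool (u < ?h)"
          using AE_unit_interval AE_unit_interval_neq[of ?h] notin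
        proof eventually_elim
          case (elim u)
          then have u: "u \<notin> x ` {..<m}" "0 \<le> u" "u \<le> 1" "u \<noteq> ?h" by auto
          have "in_left m r (x(m := u)) \<longleftrightarrow> u < ?h"
            using threshold_cmp[OF \<open>inj x\<close> \<open>x \<in> space unit_cube\<close> u(1-3), of r] u(4) by linarith
          then show ?case by simp
        qed
      qed
      then show ?case using integral_unit_interval_less(2)[OF h] by simp
    qed
    show "(\<lambda>x. (threshold m r x)\<^sup>2 / 2) \<in> borel_measurable unit_cube"
      by (intro borel_measurable_divide borel_measurable_power measurable_threshold) simp
  qed
  finally show ?thesis by simp
qed

lemma integral_threshold_sq_le:
  "(\<integral>x. (threshold m r x)\<^sup>2 \<partial>unit_cube) \<le>
    2 * avg3 m (\<lambda>d e g. of_bool (fst (new_box d e) < r \<and> snd (new_box d e) < snd (new_box e g)))"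
proof -
  let ?f = "\<lambda>d e g. of_bool (fst (new_box d e) < r \<and> snd (new_box d e) < snd (new_box e g)) :: real"
  have "(\<integral>x. of_bool (in_left m r x \<and> x (Suc m) < x m) \<partial>unit_cube) \<le>
      (\<integral>x. ?f (rsk_shape x m) (rsk_shape x (Suc m)) (rsk_shape x (Suc (Suc m))) \<partial>unit_cube)"
  proof (rule integral_mono_AE)
    have "(\<lambda>x. of_bool (in_left m r x \<and> x (Suc m) < x m) :: real) \<in> borel_measurable unit_cube"
      unfolding of_bool_def by measurable
    then show "integrable unit_cube (\<lambda>x. of_bool (in_left m r x \<and> x (Suc m) < x m) :: real)"
      by (intro cube.integrable_const_bound[of _ 1]) auto
    show "integrable unit_cube (\<lambda>x. ?f (rsk_shape x m) (rsk_shape x (Suc m)) (rsk_shape x (Suc (Suc m))))"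
      by (intro cube.integrable_const_bound[of _ 1] measurable_shapes3_borel) auto
    show "AE x in unit_cube. of_bool (in_left m r x \<and> x (Suc m) < x m) \<le>
        ?f (rsk_shape x m) (rsk_shape x (Suc m)) (rsk_shape x (Suc (Suc m)))"
      using AE_unit_cube_inj
    proof eventually_elim
      case (elim x)
      have "distinct (map x [0..<Suc (Suc m)])" using elim by (simp add: distinct_map inj_on_subset[OF elim] del: upt_Suc)
      then have "distinct (map x [0..<m] @ [x m, x (Suc m)])" by simp
      then show ?case
        using new_row_descent[of "map x [0..<m]" "x m" "x (Suc m)"]
        by (auto simp: in_left_def rsk_shape_eq_sh)
    qed
  qed
  also have "\<dots> = avg3 m ?f" by (rule shapes.integral_avg3[OF measurable_shapes3_borel])
  finally show ?thesis unfolding integral_threshold_sq by simp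
qed

text \<open>
  \<^const>\<open>left_prob\<close> is the conditional expectation of the threshold given the shape, so their distance in
  \<open>L\<^sup>2\<close> is the difference of their second moments.
\<close>

lemma threshold_close:
  "(\<integral>x. (threshold m r x - left_prob r (rsk_shape x m))\<^sup>2 \<partial>unit_cube) \<le>
    sqrt (avg2 m (\<lambda>d e. (left_prob r e - left_prob r d)\<^sup>2)) + real r / (real m + 1)"
proof -
  let ?G = "\<lambda>x. left_prob r (rsk_shape x m)" and ?H = "threshold m r"
  have G: "?G \<in> borel_measurable unit_cube"
    using measurable_shapes2_borel[of "\<lambda>d e. left_prob r d"] .
  have bG: "AE x in unit_cube. 0 \<le> ?G x \<and> ?G x \<le> 1"
    using left_prob_bounds by simp
  have bH: "AE x in unit_cube. 0 \<le> ?H x \<and> ?H x \<le> 1"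
    using AE_space by eventually_elim (simp add: threshold_bounds)
  have iHH: "integrable unit_cube (\<lambda>x. (?H x)\<^sup>2)"
  proof (rule cube.integrable_const_bound)
    show "AE x in unit_cube. norm ((?H x)\<^sup>2) \<le> 1"
      using bH by eventually_elim (simp add: power_le_one)
  qed (rule borel_measurable_power[OF measurable_threshold])
  have iGG: "integrable unit_cube (\<lambda>x. (?G x)\<^sup>2)"
  proof (rule cube.integrable_const_bound)
    show "AE x in unit_cube. norm ((?G x)\<^sup>2) \<le> 1"
      using bG by eventually_elim (simp add: power_le_one)
  qed (rule borel_measurable_power[OF G])
  have iGH: "integrable unit_cube (\<lambda>x. ?G x * ?H x)"
  proof (rule cube.integrable_const_bound)
    show "AE x in unit_cube. norm (?G x * ?H x) \<le> 1"
      using bG bH by eventually_elim (simp add: abs_mult mult_le_one)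
  qed (rule borel_measurable_times[OF G measurable_threshold])
  have GH: "(\<integral>x. ?G x * ?H x \<partial>unit_cube) = avg1 m (\<lambda>d. (left_prob r d)\<^sup>2)"
  proof -
    have "avg1 m (\<lambda>d. (left_prob r d)\<^sup>2) = avg2 m (\<lambda>d e. left_prob r d * of_bool (fst (new_box d e) < r))"
      unfolding avg2_left by (simp add: power2_eq_square)
    also have "\<dots> = (\<integral>x. ?G x * of_bool (in_left m r x) \<partial>unit_cube)"
      unfolding in_left_def
      by (rule shapes.integral_avg2[symmetric]) (rule measurable_shapes2_borel)
    also have "\<dots> = (\<integral>x. (\<integral>u. ?G (x(m := u)) * of_bool (in_left m r (x(m := u))) \<partial>unit_interval) \<partial>unit_cube)"
    proof (rule integral_resample(1)[of "\<lambda>x. ?G x * of_bool (in_left m r x)" 1])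
      fix x :: "nat \<Rightarrow> real"
      show "\<bar>?G x * of_bool (in_left m r x)\<bar> \<le> 1"
        using left_prob_bounds(1,2)[of r "rsk_shape x m"] by simp
    qed (rule borel_measurable_times[OF G measurable_in_left_borel])
    also have "\<dots> = (\<integral>x. ?G x * ?H x \<partial>unit_cube)"
    proof (rule Bochner_Integration.integral_cong[OF refl])
      fix x
      have "?G (x(m := u)) = ?G x" for u using rsk_shape_cong[of m "x(m := u)" x] by simp
      then show "(\<integral>u. ?G (x(m := u)) * of_bool (in_left m r (x(m := u))) \<partial>unit_interval) = ?G x * ?H x"
        by (simp add: threshold_def)
    qed
    finally show ?thesis by simp
  qed
  have GG: "(\<integral>x. (?G x)\<^sup>2 \<partial>unit_cube) = avg1 m (\<lambda>d. (left_prob r d)\<^sup>2)"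
    by (rule shapes.integral_avg1)
  have "(\<integral>x. (?H x - ?G x)\<^sup>2 \<partial>unit_cube) = (\<integral>x. (?H x)\<^sup>2 + ((?G x)\<^sup>2 - 2 * (?G x * ?H x)) \<partial>unit_cube)"
    by (simp add: power2_eq_square algebra_simps)
  also have "\<dots> = (\<integral>x. (?H x)\<^sup>2 \<partial>unit_cube) - avg1 m (\<lambda>d. (left_prob r d)\<^sup>2)"
    using iHH iGG iGH GH GG by simp
  finally show ?thesis
    using integral_threshold_sq_le[of m r] descent_prob_le[of m r] by linarith
qed

lemma cube_abs_le_sqrt:
  fixes f :: "(nat \<Rightarrow> real) \<Rightarrow> real"
  assumes f: "f \<in> borel_measurable unit_cube" and b: "AE x in unit_cube. \<bar>f x\<bar> \<le> B"
  shows "(\<integral>x. \<bar>f x\<bar> \<partial>unit_cube) \<le> sqrt (\<integral>x. (f x)\<^sup>2 \<partial>unit_cube)"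
proof (rule real_le_rsqrt)
  let ?c = "\<integral>x. \<bar>f x\<bar> \<partial>unit_cube"
  have 1: "integrable unit_cube (\<lambda>x. \<bar>f x\<bar>)"
  proof (rule cube.integrable_const_bound)
    show "AE x in unit_cube. norm \<bar>f x\<bar> \<le> B" using b by (simp only: real_norm_def abs_abs)
  qed (rule borel_measurable_abs[OF f])
  have 2: "integrable unit_cube (\<lambda>x. (f x)\<^sup>2)"
  proof (rule cube.integrable_const_bound)
    show "AE x in unit_cube. norm ((f x)\<^sup>2) \<le> B\<^sup>2"
      using b by eventually_elim (metis abs_ge_zero norm_power power_mono real_norm_def)
  qed (rule borel_measurable_power[OF f])
  have "0 \<le> (\<integral>x. (\<bar>f x\<bar> - ?c)\<^sup>2 \<partial>unit_cube)" by simp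
  also have "\<dots> = (\<integral>x. (f x)\<^sup>2 + (?c\<^sup>2 - 2 * ?c * \<bar>f x\<bar>) \<partial>unit_cube)"
    by (simp add: power2_diff algebra_simps)
  also have "\<dots> = (\<integral>x. (f x)\<^sup>2 \<partial>unit_cube) + (?c\<^sup>2 - 2 * ?c * ?c)"
    using 1 2 by (simp add: cube.prob_space)
  finally show "?c\<^sup>2 \<le> (\<integral>x. (f x)\<^sup>2 \<partial>unit_cube)" by (simp add: power2_eq_square)
qed

text \<open>
  The estimate of a letter from the shapes before and after its insertion: the column of the new box is
  located in one of \<open>K + 1\<close> blocks of columns, and the estimate is the conditional probability of all
  columns to the left of this block.
\<close>

definition letter_estimate :: "nat \<Rightarrow> nat \<Rightarrow> diagram \<Rightarrow> diagram \<Rightarrow> real" where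
  "letter_estimate K q d e = left_prob (min K (fst (new_box d e) div q) * q) d"

text \<open>
  If the new box lies in block \<open>i < K\<close>, then the letter lies between \<open>H i\<close> and \<open>H (i + 1)\<close>, and the gap
  between \<open>G i\<close> and \<open>G (i + 1)\<close> is at most the Euclidean norm of all gaps, whose mean is easier to bound than
  that of their maximum.  In the last, unbounded block the letter lies between \<open>H K\<close> and 1.
\<close>

lemma letter_estimate_error:
  fixes m q K :: nat and x :: "nat \<Rightarrow> real"
  assumes x: "inj x" "x \<in> space unit_cube" and q: "q > 0"
  defines "G \<equiv> \<lambda>j. left_prob (j * q) (rsk_shape x m)" and "H \<equiv> \<lambda>j. threshold m (j * q) x"
  shows "\<bar>x m - letter_estimate K q (rsk_shape x m) (rsk_shape x (Suc m))\<bar> \<le>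
    (\<Sum>j\<le>K. \<bar>H j - G j\<bar>) + sqrt (\<Sum>j<K. (G (Suc j) - G j)\<^sup>2) + (1 - G K)"
proof -
  define c where "c = fst (new_box (rsk_shape x m) (rsk_shape x (Suc m)))"
  define i where "i = min K (c div q)"
  let ?S = "\<Sum>j\<le>K. \<bar>H j - G j\<bar>" and ?Q = "sqrt (\<Sum>j<K. (G (Suc j) - G j)\<^sup>2)"
  have xm: "x m \<notin> x ` {..<m}" "0 \<le> x m" "x m \<le> 1"
    using x(1) unit_cube_coord[OF x(2), of m] by (auto dest: injD)
  have cmp: "c < j * q \<Longrightarrow> x m \<le> H j" "\<not> c < j * q \<Longrightarrow> H j \<le> x m" for j
    using threshold_cmp[OF x xm, of "j * q"] by (simp_all add: in_left_def c_def H_def)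
  have S: "\<bar>H j - G j\<bar> \<le> ?S" if "j \<le> K" for j
    using that by (intro member_le_sum) auto
  have Q0: "0 \<le> ?Q" by (intro real_sqrt_ge_zero sum_nonneg) auto
  have GK: "0 \<le> 1 - G K" "G i \<le> G K"
    using left_prob_bounds unfolding G_def i_def by (simp_all add: mult_le_mono1)
  have i: "i \<le> K" by (simp add: i_def)
  have "i * q \<le> c"
  proof -
    have "i * q \<le> c div q * q" by (intro mult_le_mono1) (simp add: i_def)
    also have "\<dots> \<le> c" by (rule div_times_less_eq_dividend)
    finally show ?thesis .
  qed
  then have "H i \<le> x m" using cmp(2)[of i] by simp
  then have lower: "- ?S \<le> x m - G i" using S[OF i] by linarith
  have upper: "x m - G i \<le> ?S + ?Q + (1 - G K)"
  proof (cases "c div q < K")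
    case True
    then have "i = c div q" "Suc i \<le> K" by (simp_all add: i_def)
    have "c < Suc i * q"
      using div_mult_mod_eq[of c q] mod_less_divisor[OF q, of c] unfolding \<open>i = c div q\<close> mult_Suc by linarith
    then have "x m \<le> H (Suc i)" by (rule cmp(1))
    moreover have "G (Suc i) - G i \<le> ?Q"
    proof (rule real_le_rsqrt)
      show "(G (Suc i) - G i)\<^sup>2 \<le> (\<Sum>j<K. (G (Suc j) - G j)\<^sup>2)"
        using \<open>Suc i \<le> K\<close> by (intro member_le_sum[of i "{..<K}" "\<lambda>j. (G (Suc j) - G j)\<^sup>2"]) auto
    qed
    ultimately show ?thesis using S[OF \<open>Suc i \<le> K\<close>] GK(1) by linarith
  next
    case False
    then have "i = K" by (simp add: i_def)
    show ?thesis using xm(3) Q0 S[OF i] unfolding \<open>i = K\<close> by linarith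
  qed
  have "letter_estimate K q (rsk_shape x m) (rsk_shape x (Suc m)) = G i"
    by (simp add: letter_estimate_def G_def i_def c_def)
  then show ?thesis using lower upper Q0 GK(1) by linarith
qed

text \<open>
  The three terms of \<open>letter_estimate_error\<close> are controlled by \<open>threshold_close\<close>, \<open>left_prob_gap\<close> and
  \<open>left_prob_tail\<close>; Jensen's inequality turns the mean square bounds into bounds of means.
\<close>

lemma letter_estimate_mean_error:
  fixes m q K :: nat
  assumes q: "q > 0" and K: "K > 0"
  defines "V \<equiv> \<lambda>j. avg2 m (\<lambda>d e. (left_prob (j * q) e - left_prob (j * q) d)\<^sup>2)"
  shows "(\<integral>x. \<bar>x m - letter_estimate K q (rsk_shape x m) (rsk_shape x (Suc m))\<bar> \<partial>unit_cube) \<le>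
    (\<Sum>j\<le>K. sqrt (sqrt (V j) + real (j * q) / (real m + 1))) + sqrt (real K * (real q)\<^sup>2 / (real m + 1))
    + 2 * sqrt (real m + 1) / (real K * real q)"
proof -
  let ?G = "\<lambda>j x. left_prob (j * q) (rsk_shape x m)" and ?H = "\<lambda>j x. threshold m (j * q) x"
  let ?e = "\<lambda>x. letter_estimate K q (rsk_shape x m) (rsk_shape x (Suc m))"
  have G: "?G j \<in> borel_measurable unit_cube" for j
    using measurable_shapes2_borel[of "\<lambda>d e. left_prob (j * q) d"] .
  have e: "?e \<in> borel_measurable unit_cube"
    by (rule measurable_shapes2_borel)
  have bG: "0 \<le> ?G j x" "?G j x \<le> 1" for j x by (rule left_prob_bounds)+
  have be: "0 \<le> ?e x" "?e x \<le> 1" for x unfolding letter_estimate_def by (rule left_prob_bounds)+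
  have bHG: "AE x in unit_cube. \<bar>?H j x - ?G j x\<bar> \<le> 1" for j
    using AE_space
  proof eventually_elim
    case (elim x)
    then show ?case using threshold_bounds(1)[of m "j * q" x] threshold_bounds(2)[OF elim, of m "j * q"] bG[of j x]
      by (simp add: abs_le_iff)
  qed
  have bgap: "\<bar>sqrt (\<Sum>j<K. (?G (Suc j) x - ?G j x)\<^sup>2)\<bar> \<le> sqrt (real K)" for x
  proof -
    have "(\<Sum>j<K. (?G (Suc j) x - ?G j x)\<^sup>2) \<le> (\<Sum>j<K. 1)"
    proof (rule sum_mono)
      fix j
      have "\<bar>?G (Suc j) x - ?G j x\<bar> \<le> 1" using bG[of j x] bG[of "Suc j" x] by (simp add: abs_le_iff)
      then show "(?G (Suc j) x - ?G j x)\<^sup>2 \<le> 1" by (simp add: abs_square_le_1)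
    qed
    moreover have "0 \<le> (\<Sum>j<K. (?G (Suc j) x - ?G j x)\<^sup>2)" by (intro sum_nonneg) simp
    ultimately show ?thesis by simp
  qed
  have mgap: "(\<lambda>x. sqrt (\<Sum>j<K. (?G (Suc j) x - ?G j x)\<^sup>2)) \<in> borel_measurable unit_cube"
    by (rule measurable_compose[OF _ borel_measurable_sqrt])
       (intro borel_measurable_sum borel_measurable_power borel_measurable_diff G)
  have i1: "integrable unit_cube (\<lambda>x. \<bar>?H j x - ?G j x\<bar>)" for j
  proof (rule cube.integrable_const_bound)
    show "AE x in unit_cube. norm \<bar>?H j x - ?G j x\<bar> \<le> 1" using bHG[of j] by simp
  qed (intro borel_measurable_abs borel_measurable_diff G measurable_threshold)
  have i2: "integrable unit_cube (\<lambda>x. sqrt (\<Sum>j<K. (?G (Suc j) x - ?G j x)\<^sup>2))"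
  proof (rule cube.integrable_const_bound)
    show "AE x in unit_cube. norm (sqrt (\<Sum>j<K. (?G (Suc j) x - ?G j x)\<^sup>2)) \<le> sqrt (real K)"
      unfolding real_norm_def by (rule AE_I2[OF bgap])
  qed (rule mgap)
  have i3: "integrable unit_cube (\<lambda>x. 1 - ?G K x)"
  proof (rule cube.integrable_const_bound)
    show "AE x in unit_cube. norm (1 - ?G K x) \<le> 1" using bG by simp
  qed (intro borel_measurable_diff borel_measurable_const G)
  have i4: "integrable unit_cube (\<lambda>x. \<bar>x m - ?e x\<bar>)"
  proof (rule cube.integrable_const_bound)
    show "AE x in unit_cube. norm \<bar>x m - ?e x\<bar> \<le> 1"
      using AE_space
    proof eventually_elim
      case (elim x)
      then show ?case using unit_cube_coord[OF elim, of m] be[of x] by (simp add: abs_le_iff)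
    qed
  qed (intro borel_measurable_abs borel_measurable_diff measurable_coord e)
  have i5: "integrable unit_cube (\<lambda>x. (?G (Suc j) x - ?G j x)\<^sup>2)" for j
  proof (rule cube.integrable_const_bound)
    show "AE x in unit_cube. norm ((?G (Suc j) x - ?G j x)\<^sup>2) \<le> 1"
    proof (rule AE_I2)
      fix x
      have "\<bar>?G (Suc j) x - ?G j x\<bar> \<le> 1" using bG[of j x] bG[of "Suc j" x] by (simp add: abs_le_iff)
      then show "norm ((?G (Suc j) x - ?G j x)\<^sup>2) \<le> 1" by (simp add: abs_square_le_1)
    qed
  qed (intro borel_measurable_power borel_measurable_diff G)
  have "(\<integral>x. \<bar>x m - ?e x\<bar> \<partial>unit_cube) \<le>
      (\<integral>x. (\<Sum>j\<le>K. \<bar>?H j x - ?G j x\<bar>) + sqrt (\<Sum>j<K. (?G (Suc j) x - ?G j x)\<^sup>2) + (1 - ?G K x) \<partial>unit_cube)"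
  proof (rule integral_mono_AE[OF i4])
    show "integrable unit_cube (\<lambda>x. (\<Sum>j\<le>K. \<bar>?H j x - ?G j x\<bar>) +
        sqrt (\<Sum>j<K. (?G (Suc j) x - ?G j x)\<^sup>2) + (1 - ?G K x))"
      using i1 i2 i3 by (intro Bochner_Integration.integrable_add Bochner_Integration.integrable_sum)
    show "AE x in unit_cube. \<bar>x m - ?e x\<bar> \<le> (\<Sum>j\<le>K. \<bar>?H j x - ?G j x\<bar>) +
        sqrt (\<Sum>j<K. (?G (Suc j) x - ?G j x)\<^sup>2) + (1 - ?G K x)"
      using AE_unit_cube_inj AE_space by eventually_elim (rule letter_estimate_error[OF _ _ q])
  qed
  also have "\<dots> = (\<Sum>j\<le>K. \<integral>x. \<bar>?H j x - ?G j x\<bar> \<partial>unit_cube) +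
      (\<integral>x. sqrt (\<Sum>j<K. (?G (Suc j) x - ?G j x)\<^sup>2) \<partial>unit_cube) + (\<integral>x. 1 - ?G K x \<partial>unit_cube)"
  proof -
    note isum = Bochner_Integration.integrable_sum[of "{..K}" unit_cube "\<lambda>j x. \<bar>?H j x - ?G j x\<bar>", OF i1]
    show ?thesis
      unfolding Bochner_Integration.integral_add[OF Bochner_Integration.integrable_add[OF isum i2] i3]
        Bochner_Integration.integral_add[OF isum i2] Bochner_Integration.integral_sum[OF i1] ..
  qed
  also have "(\<Sum>j\<le>K. \<integral>x. \<bar>?H j x - ?G j x\<bar> \<partial>unit_cube) \<le>
      (\<Sum>j\<le>K. sqrt (sqrt (V j) + real (j * q) / (real m + 1)))"
  proof (rule sum_mono)
    fix j
    have "(\<integral>x. \<bar>?H j x - ?G j x\<bar> \<partial>unit_cube) \<le> sqrt (\<integral>x. (?H j x - ?G j x)\<^sup>2 \<partial>unit_cube)"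
      by (rule cube_abs_le_sqrt[OF _ bHG]) (intro borel_measurable_diff G measurable_threshold)
    also have "\<dots> \<le> sqrt (sqrt (V j) + real (j * q) / (real m + 1))"
      unfolding V_def by (intro real_sqrt_le_mono threshold_close)
    finally show "(\<integral>x. \<bar>?H j x - ?G j x\<bar> \<partial>unit_cube) \<le> sqrt (sqrt (V j) + real (j * q) / (real m + 1))" .
  qed
  also have "(\<integral>x. sqrt (\<Sum>j<K. (?G (Suc j) x - ?G j x)\<^sup>2) \<partial>unit_cube) \<le> sqrt (real K * (real q)\<^sup>2 / (real m + 1))"
  proof -
    have nn: "0 \<le> (\<Sum>j<K. (?G (Suc j) x - ?G j x)\<^sup>2)" for x by (intro sum_nonneg) simp
    have "(\<integral>x. sqrt (\<Sum>j<K. (?G (Suc j) x - ?G j x)\<^sup>2) \<partial>unit_cube) =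
        (\<integral>x. \<bar>sqrt (\<Sum>j<K. (?G (Suc j) x - ?G j x)\<^sup>2)\<bar> \<partial>unit_cube)"
      using nn by simp
    also have "\<dots> \<le> sqrt (\<integral>x. (sqrt (\<Sum>j<K. (?G (Suc j) x - ?G j x)\<^sup>2))\<^sup>2 \<partial>unit_cube)"
      by (rule cube_abs_le_sqrt[OF mgap AE_I2[OF bgap]])
    also have "(\<integral>x. (sqrt (\<Sum>j<K. (?G (Suc j) x - ?G j x)\<^sup>2))\<^sup>2 \<partial>unit_cube) =
        (\<Sum>j<K. \<integral>x. (?G (Suc j) x - ?G j x)\<^sup>2 \<partial>unit_cube)"
      using nn by (simp add: Bochner_Integration.integral_sum[OF i5] del: mult_Suc)
    also have "\<dots> \<le> (\<Sum>j<K. (real q)\<^sup>2 / (real m + 1))"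
    proof (rule sum_mono)
      fix j
      have "(\<integral>x. (?G (Suc j) x - ?G j x)\<^sup>2 \<partial>unit_cube) =
          avg1 m (\<lambda>d. (left_prob (Suc j * q) d - left_prob (j * q) d)\<^sup>2)"
        by (rule shapes.integral_avg1)
      also have "\<dots> \<le> (real (Suc j * q - j * q))\<^sup>2 / (real m + 1)"
        by (rule left_prob_gap) simp
      finally show "(\<integral>x. (?G (Suc j) x - ?G j x)\<^sup>2 \<partial>unit_cube) \<le> (real q)\<^sup>2 / (real m + 1)" by simp
    qed
    finally show ?thesis by simp
  qed
  also have "(\<integral>x. 1 - ?G K x \<partial>unit_cube) \<le> 2 * sqrt (real m + 1) / (real K * real q)"
  proof -
    have "(\<integral>x. 1 - ?G K x \<partial>unit_cube) = avg1 m (\<lambda>d. 1 - left_prob (K * q) d)"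
      by (rule shapes.integral_avg1)
    also have "\<dots> \<le> 2 * sqrt (real m + 1) / real (K * q)"
      using q K by (intro left_prob_tail) simp
    finally show ?thesis by simp
  qed
  finally show ?thesis by simp
qed

text \<open>
  The typical number of columns is of the order \<open>sqrt n = k^3 p\<close>.  Each of the \<open>K = k^4\<close> blocks has width \<open>p\<close>,
  so together they reach \<open>k sqrt n\<close> columns, far beyond the typical number, while the Euclidean norm of the
  gaps is of the order \<open>sqrt K p / sqrt n = 1 / k\<close>.  Since the quadratic variation between the times \<open>n\<close>
  and \<open>2 n\<close> is at most 3 for each of the \<open>K + 1\<close> block boundaries, at some time in between its increments
  add up to at most \<open>3 (K + 1) / n\<close>; the factor \<open>(K + 1)^3\<close> in \<open>p\<close> makes this small enough even
  after two square roots and a summation over all boundaries.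
\<close>

theorem letter_determined:
  assumes "\<epsilon> > 0"
  obtains m K q where
    "(\<integral>x. \<bar>x m - letter_estimate K q (rsk_shape x m) (rsk_shape x (Suc m))\<bar> \<partial>unit_cube) \<le> \<epsilon>"
proof -
  obtain k :: nat where k: "6 / \<epsilon> < real k" using reals_Archimedean2 by blast
  then have "0 < real k" using assms by (meson divide_pos_pos less_trans zero_less_numeral)
  then have k0: "k > 0" by simp
  define K where "K = k ^ 4"
  define p where "p = 4 * (K + 1) ^ 3 * k\<^sup>2"
  define n where "n = (k ^ 3 * p)\<^sup>2"
  have pos: "K > 0" "p > 0" "n > 0" using k0 by (simp_all add: K_def p_def n_def)
  let ?V = "\<lambda>m j. avg2 m (\<lambda>d e. (left_prob (j * p) e - left_prob (j * p) d)\<^sup>2)"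
  have V0: "?V m j \<ge> 0" for m j unfolding avg2_def by (intro sum_nonneg) auto
  have "\<exists>m\<in>{n..<2*n}. (\<Sum>j\<le>K. ?V m j) \<le> 3 * (real K + 1) / real n"
  proof (rule ccontr)
    assume "\<not> ?thesis"
    then have "3 * (real K + 1) / real n < (\<Sum>j\<le>K. ?V m j)" if "m \<in> {n..<2*n}" for m
      using that by (meson not_le)
    then have "(\<Sum>m=n..<2*n. 3 * (real K + 1) / real n) < (\<Sum>m=n..<2*n. \<Sum>j\<le>K. ?V m j)"
      using pos(3) by (intro sum_strict_mono) auto
    also have "\<dots> = (\<Sum>j\<le>K. \<Sum>m=n..<2*n. ?V m j)" by (rule sum.swap)
    also have "\<dots> \<le> (\<Sum>j\<le>K. 3)" using pos(3) by (intro sum_mono left_prob_variation) simp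
    finally show False using pos(3) by simp
  qed
  then obtain m where m: "n \<le> m" "m < 2 * n" "(\<Sum>j\<le>K. ?V m j) \<le> 3 * (real K + 1) / real n" by auto
  have mn: "real n \<le> real m + 1" "real m + 1 \<le> 2 * real n" using m(1,2) by linarith+
  have sn: "sqrt (real n) = real k ^ 3 * real p" by (simp add: n_def real_sqrt_abs)
  have nr: "real n = real k ^ 6 * (real p)\<^sup>2" by (simp add: n_def power_mult_distrib flip: power_mult)
  have A: "(\<Sum>j\<le>K. sqrt (sqrt (?V m j) + real (j * p) / (real m + 1))) \<le> 1 / real k"
  proof -
    have "sqrt (sqrt (?V m j) + real (j * p) / (real m + 1)) \<le> 1 / ((real K + 1) * real k)" if j: "j \<le> K" for j
    proof -
      have k1: "1 \<le> real k ^ i" for i using k0 by (simp add: one_le_power)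
      have "?V m j \<le> (\<Sum>j\<le>K. ?V m j)" using V0 j by (intro member_le_sum) auto
      also have "\<dots> \<le> 3 * (real K + 1) / real n" by (rule m(3))
      finally have "sqrt (?V m j) \<le> sqrt (3 * (real K + 1)) / (real k ^ 3 * real p)"
        using real_sqrt_le_mono by (fastforce simp: real_sqrt_divide sn)
      also have "\<dots> \<le> 3 * (real K + 1) / real p"
      proof (rule frac_le)
        have "3 * (real K + 1) \<le> (3 * (real K + 1))\<^sup>2" by (intro self_le_power) auto
        then show "sqrt (3 * (real K + 1)) \<le> 3 * (real K + 1)" by (intro real_le_lsqrt) auto
        show "real p \<le> real k ^ 3 * real p" using mult_right_mono[OF k1[of 3], of "real p"] by simp
      qed (use pos in auto)
      finally have 1: "sqrt (?V m j) \<le> 3 * (real K + 1) / real p" .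
      have "real (j * p) / (real m + 1) \<le> real K * real p / real n"
        using j mn(1) pos by (intro frac_le) (simp_all flip: of_nat_mult)
      also have "\<dots> \<le> real K * real p / (real p)\<^sup>2"
        using k1[of 6] pos k0 unfolding nr by (intro divide_left_mono) simp_all
      also have "\<dots> \<le> (real K + 1) / real p"
        using pos by (simp add: power2_eq_square divide_right_mono)
      finally have "sqrt (?V m j) + real (j * p) / (real m + 1) \<le> 4 * (real K + 1) / real p"
        using 1 by (simp add: add_divide_distrib)
      also have "\<dots> = (1 / ((real K + 1) * real k))\<^sup>2"
      proof -
        have rp: "real p = 4 * (real K + 1) ^ 3 * (real k)\<^sup>2" by (simp add: p_def add.commute)
        have cancel: "a \<noteq> 0 \<Longrightarrow> 4 * a / (4 * a ^ 3 * b\<^sup>2) = (1 / (a * b))\<^sup>2" for a b :: real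
          by (simp add: power2_eq_square power3_eq_cube)
        show ?thesis unfolding rp by (rule cancel) simp
      qed
      finally show ?thesis using k0 by (intro real_le_lsqrt) simp_all
    qed
    then have "(\<Sum>j\<le>K. sqrt (sqrt (?V m j) + real (j * p) / (real m + 1))) \<le> (\<Sum>j\<le>K. 1 / ((real K + 1) * real k))"
      by (intro sum_mono) simp
    also have "\<dots> = (real K + 1) * (1 / ((real K + 1) * real k))" by (simp add: add.commute)
    also have "\<dots> = 1 / real k"
    proof -
      have cancel: "a > 0 \<Longrightarrow> a * (1 / (a * b)) = 1 / b" for a b :: real by simp
      show ?thesis by (rule cancel) simp
    qed
    finally show ?thesis .
  qed
  have B: "sqrt (real K * (real p)\<^sup>2 / (real m + 1)) \<le> 1 / real k"
  proof (rule real_le_lsqrt)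
    have "real K * (real p)\<^sup>2 / (real m + 1) \<le> real K * (real p)\<^sup>2 / real n"
      using mn(1) pos by (intro divide_left_mono) auto
    also have "\<dots> = (1 / real k)\<^sup>2"
    proof -
      have "a > 0 \<Longrightarrow> b > 0 \<Longrightarrow> a ^ 4 * b\<^sup>2 / (a ^ 6 * b\<^sup>2) = (1 / a)\<^sup>2" for a b :: real
        by (simp add: field_simps flip: power_add)
      from this[of "real k" "real p"] show ?thesis unfolding nr K_def using k0 pos by simp
    qed
    finally show "real K * (real p)\<^sup>2 / (real m + 1) \<le> (1 / real k)\<^sup>2" .
  qed simp
  have C: "2 * sqrt (real m + 1) / (real K * real p) \<le> 4 / real k"
  proof -
    have "sqrt (real m + 1) \<le> sqrt (4 * real n)" using mn by (intro real_sqrt_le_mono) simp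
    also have "\<dots> = 2 * (real k ^ 3 * real p)" by (simp add: real_sqrt_mult sn)
    finally have "2 * sqrt (real m + 1) / (real K * real p) \<le> 4 * (real k ^ 3 * real p) / (real K * real p)"
      using pos by (intro divide_right_mono) (simp_all add: mult_ac)
    also have "\<dots> = 4 / real k"
      using k0 pos by (simp add: K_def field_simps power3_eq_cube power4_eq_xxxx)
    finally show ?thesis .
  qed
  have "(\<integral>x. \<bar>x m - letter_estimate K p (rsk_shape x m) (rsk_shape x (Suc m))\<bar> \<partial>unit_cube) \<le> 6 / real k"
    using letter_estimate_mean_error[OF pos(2,1), of m] A B C by simp
  also have "\<dots> \<le> \<epsilon>" using k k0 assms by (simp add: field_simps)
  finally show thesis by (rule that)
qed

lemma measurable_left_shift: "left_shift \<in> unit_cube \<rightarrow>\<^sub>M unit_cube"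
  unfolding left_shift_def[abs_def] by (rule measurable_reindex)

lemma measurable_first_letter_error:
  "(\<lambda>x. \<bar>x 0 - letter_estimate K q (transp (rsk_shape (left_shift x) m)) (transp (rsk_shape x (Suc m)))\<bar>)
    \<in> borel_measurable unit_cube"
proof -
  have "(\<lambda>x. letter_estimate K q (transp (rsk_shape (left_shift x) m)) (transp d)) \<in> borel_measurable unit_cube" for d
    using measurable_compose[OF measurable_left_shift measurable_shapes2_borel[of "\<lambda>a b. letter_estimate K q (transp a) (transp d)" m m]] .
  then have "(\<lambda>x. letter_estimate K q (transp (rsk_shape (left_shift x) m)) (transp (rsk_shape x (Suc m)))) \<in> borel_measurable unit_cube"
    by (intro measurable_shapes[where f="\<lambda>d x. letter_estimate K q (transp (rsk_shape (left_shift x) m)) (transp d)"])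
  then show ?thesis by (intro borel_measurable_abs borel_measurable_diff measurable_coord)
qed

text \<open>
  Reversing the first \<open>m + 1\<close> letters transposes all shapes and turns the letter inserted last into the
  first letter of the sequence.
\<close>

theorem first_letter_determined:
  assumes "\<epsilon> > 0"
  obtains m K q where
    "(\<integral>x. \<bar>x 0 - letter_estimate K q (transp (rsk_shape (left_shift x) m)) (transp (rsk_shape x (Suc m)))\<bar> \<partial>unit_cube) \<le> \<epsilon>"
proof -
  obtain m K q where *: "(\<integral>x. \<bar>x m - letter_estimate K q (rsk_shape x m) (rsk_shape x (Suc m))\<bar> \<partial>unit_cube) \<le> \<epsilon>"
    using letter_determined[OF assms] .
  let ?f = "\<lambda>i. if i \<le> m then m - i else i"
  let ?r = "\<lambda>x :: nat \<Rightarrow> real. \<lambda>i. x (?f i)"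
  let ?E = "\<lambda>x :: nat \<Rightarrow> real. \<bar>x m - letter_estimate K q (rsk_shape x m) (rsk_shape x (Suc m))\<bar>"
  have E: "?E \<in> borel_measurable unit_cube"
    by (intro borel_measurable_abs borel_measurable_diff measurable_coord
        measurable_shapes2_borel[of "letter_estimate K q" m "Suc m"])
  have f: "inj ?f" by (rule injI) (auto split: if_splits)
  have shapes: "rsk_shape (?r x) (Suc m) = transp (rsk_shape x (Suc m))"
    "rsk_shape (?r x) m = transp (rsk_shape (left_shift x) m)" if "inj x" for x
  proof -
    have d: "distinct (map x [0..<Suc m])" "distinct (map (left_shift x) [0..<m])"
      using that by (auto simp: distinct_map inj_on_def left_shift_def dest: injD simp del: upt_Suc)
    have "map (?r x) [0..<Suc m] = rev (map x [0..<Suc m])"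
      by (rule nth_equalityI) (auto simp: rev_nth simp del: upt_Suc)
    then show "rsk_shape (?r x) (Suc m) = transp (rsk_shape x (Suc m))"
      unfolding rsk_shape_eq_sh using sh_rev[OF d(1)] by (simp del: upt_Suc)
    have "map (?r x) [0..<m] = rev (map (left_shift x) [0..<m])"
      by (rule nth_equalityI) (auto simp: rev_nth left_shift_def Suc_diff_Suc)
    then show "rsk_shape (?r x) m = transp (rsk_shape (left_shift x) m)"
      unfolding rsk_shape_eq_sh using sh_rev[OF d(2)] by simp
  qed
  have "(\<integral>x. ?E x \<partial>unit_cube) = (\<integral>x. ?E (?r x) \<partial>unit_cube)"
    by (subst distr_unit_cube_reindex[OF f, symmetric], rule integral_distr[OF measurable_reindex E])
  also have "\<dots> = (\<integral>x. \<bar>x 0 - letter_estimate K q (transp (rsk_shape (left_shift x) m)) (transp (rsk_shape x (Suc m)))\<bar> \<partial>unit_cube)"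
  proof (rule integral_cong_AE)
    show "(\<lambda>x. ?E (?r x)) \<in> borel_measurable unit_cube"
      by (rule measurable_compose[OF measurable_reindex E])
    show "(\<lambda>x. \<bar>x 0 - letter_estimate K q (transp (rsk_shape (left_shift x) m)) (transp (rsk_shape x (Suc m)))\<bar>) \<in> borel_measurable unit_cube"
      by (rule measurable_first_letter_error)
    show "AE x in unit_cube. ?E (?r x) = \<bar>x 0 - letter_estimate K q (transp (rsk_shape (left_shift x) m)) (transp (rsk_shape x (Suc m)))\<bar>"
      using AE_unit_cube_inj by eventually_elim (simp only: shapes le_refl if_True diff_self_eq_0)
  qed
  finally show thesis using that * by simp
qed

section \<open>Measurability of recording tableaux and of jeu de taquin\<close>

lemma space_tableau_algebra: "space tableau_algebra = infinite_tableaux"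
  unfolding tableau_algebra_def by (rule space_measure_of) auto

lemma sets_tableau_algebra:
  "sets tableau_algebra = sigma_sets infinite_tableaux {{t \<in> infinite_tableaux. t b \<in> A} | b A. True}"
  unfolding tableau_algebra_def by (rule sets_measure_of) auto

lemma measurable_entry: "(\<lambda>t. t b) \<in> tableau_algebra \<rightarrow>\<^sub>M count_space UNIV"
proof (rule measurableI)
  fix A :: "nat set"
  have "(\<lambda>t. t b) -` A \<inter> space tableau_algebra = {t \<in> infinite_tableaux. t b \<in> A}"
    by (auto simp: space_tableau_algebra)
  then show "(\<lambda>t. t b) -` A \<inter> space tableau_algebra \<in> sets tableau_algebra"
    unfolding sets_tableau_algebra by (simp only:) (rule sigma_sets.Basic, blast)
qed simp

lemma measurable_into_tableau_algebra:
  assumes "\<And>x. x \<in> space M \<Longrightarrow> f x \<in> infinite_tableaux"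
    and "\<And>b. (\<lambda>x. f x b) \<in> M \<rightarrow>\<^sub>M count_space UNIV"
  shows "f \<in> M \<rightarrow>\<^sub>M tableau_algebra"
  unfolding tableau_algebra_def
proof (rule measurable_measure_of)
  fix B assume "B \<in> {{t \<in> infinite_tableaux. t b \<in> A} | b A. True}"
  then obtain b A where B: "B = {t \<in> infinite_tableaux. t b \<in> A}" by blast
  have "f -` B \<inter> space M = (\<lambda>x. f x b) -` A \<inter> space M" using assms(1) B by auto
  then show "f -` B \<inter> space M \<in> sets M" using measurable_sets[OF assms(2), of A b] by simp
qed (use assms(1) in auto)

lemma infinite_tableaux_mono:
  assumes "t \<in> infinite_tableaux"
  shows "inj t" "range t = {1..}" "t (i, j) < t (Suc i, j)" "t (i, j) < t (i, Suc j)"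
  using assms by (auto simp: infinite_tableaux_def bij_betw_def)

lemma infinite_tableau_first:
  assumes t: "t \<in> infinite_tableaux"
  shows "t (0, 0) = 1"
proof -
  have "(1 :: nat) \<in> range t" unfolding infinite_tableaux_mono(2)[OF t] by simp
  then obtain i j where ij: "t (i, j) = 1" by (metis (no_types) imageE prod.collapse)
  have pos: "t b \<ge> 1" for b using infinite_tableaux_mono(2)[OF t] by (metis atLeast_iff rangeI)
  have "i = 0"
  proof (rule ccontr)
    assume "i \<noteq> 0"
    then obtain k where "i = Suc k" by (cases i) auto
    then show False using infinite_tableaux_mono(3)[OF t, of k j] pos[of "(k, j)"] ij by simp
  qed
  moreover have "j = 0"
  proof (rule ccontr)
    assume "j \<noteq> 0"
    then obtain k where "j = Suc k" by (cases j) auto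
    then show False using infinite_tableaux_mono(4)[OF t, of i k] pos[of "(i, k)"] ij by simp
  qed
  ultimately show ?thesis using ij by simp
qed

text \<open>
  A slide replaces the entry of each path box by the next entry on the path, so it loses the entry 1 only.
\<close>

lemma jdt_infinite_tableaux:
  assumes t: "t \<in> infinite_tableaux"
  shows "jdt t \<in> infinite_tableaux"
proof -
  note inc = infinite_tableaux_mono(3,4)[OF t]
  have pos: "t b \<ge> 1" for b using infinite_tableaux_mono(2)[OF t] by (metis atLeast_iff rangeI)
  \<comment> \<open>The box whose entry, reduced by one, the slide puts into \<open>b\<close>.\<close>
  define src where "src b = (if jdt_path t (fst b + snd b) = b then jdt_path t (Suc (fst b + snd b)) else b)" for b
  have jdt: "jdt t b = t (src b) - 1" for b by (simp add: jdt_eq src_def del: jdt_path.simps)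
  have on: "jdt_path t (fst b + snd b) = b \<longleftrightarrow> (\<exists>k. b = jdt_path t k)" for b
    using jdt_path_sum by metis
  have src_path: "src (jdt_path t k) = jdt_path t (Suc k)" for k
    unfolding src_def jdt_path_sum by simp
  have src_off: "src b = b" if "\<nexists>k. b = jdt_path t k" for b
    using that on by (simp add: src_def)
  have path_inj: "jdt_path t k = jdt_path t l \<longleftrightarrow> k = l" for k l using jdt_path_sum by metis
  have inj_src: "inj src"
  proof (rule injI)
    fix a b assume ab: "src a = src b"
    show "a = b"
      by (cases "\<exists>k. a = jdt_path t k"; cases "\<exists>k. b = jdt_path t k")
         (use ab src_path src_off path_inj in \<open>metis nat.inject\<close>)+
  qed
  have range_src: "range src = UNIV - {(0, 0)}"
  proof (intro equalityI subsetI)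
    fix b assume "b \<in> range src"
    then obtain a where a: "b = src a" by blast
    have "b \<noteq> (0, 0)"
    proof (cases "\<exists>k. a = jdt_path t k")
      case True
      then obtain k where "b = jdt_path t (Suc k)" using a src_path by blast
      then have "fst b + snd b = Suc k" using jdt_path_sum by metis
      then show ?thesis by auto
    next
      case False
      moreover have "(0, 0) = jdt_path t 0" by simp
      ultimately show ?thesis using a src_off by metis
    qed
    then show "b \<in> UNIV - {(0, 0)}" by simp
  next
    fix b :: box assume b: "b \<in> UNIV - {(0, 0)}"
    show "b \<in> range src"
    proof (cases "\<exists>k. b = jdt_path t k")
      case True
      then obtain k where k: "b = jdt_path t k" by blast
      then obtain l where "k = Suc l" using b by (cases k) auto
      then show ?thesis using src_path k by (metis rangeI)
    next
      case False
      then show ?thesis using src_off by (metis rangeI)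
    qed
  qed
  have gt: "t (src b) > 1" for b
  proof -
    have "src b \<noteq> (0, 0)" using range_src by blast
    then have "t (src b) \<noteq> t (0, 0)" using infinite_tableaux_mono(1)[OF t] by (auto dest: injD)
    then show ?thesis using infinite_tableau_first[OF t] pos[of "src b"] by simp
  qed
  have "inj (jdt t)"
  proof (rule injI)
    fix a b assume "jdt t a = jdt t b"
    then have "t (src a) = t (src b)" using gt[of a] gt[of b] by (simp add: jdt)
    then show "a = b" using infinite_tableaux_mono(1)[OF t] inj_src by (auto dest!: injD)
  qed
  moreover have "range (jdt t) = {1..}"
  proof (intro equalityI subsetI)
    fix n assume "n \<in> range (jdt t)"
    then obtain b where "n = t (src b) - 1" using jdt by blast
    then show "n \<in> {1..}" using gt[of b] by simp
  next
    fix n :: nat assume n: "n \<in> {1..}"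
    have "Suc n \<in> range t" unfolding infinite_tableaux_mono(2)[OF t] by simp
    then obtain b where b: "Suc n = t b" by blast
    then have "b \<noteq> (0, 0)" using infinite_tableau_first[OF t] n by auto
    then obtain a where "b = src a" using range_src by blast
    then have "jdt t a = n" using b by (simp add: jdt flip: b)
    then show "n \<in> range (jdt t)" by blast
  qed
  moreover have "jdt t a < jdt t b"
    if ab: "b = (Suc (fst a), snd a) \<or> b = (fst a, Suc (snd a))" for a b
  proof -
    have le: "t b \<le> t (src b)"
      using on[of b] src_path src_off[of b] jdt_path_less[OF t] by (metis le_less)
    have "t (src a) < t (src b)"
    proof (cases "\<exists>k. a = jdt_path t k")
      case False
      then have "t (src a) < t b" using ab inc src_off[OF False] by (metis prod.collapse)
      then show ?thesis using le by simp
    next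
      case True
      then obtain k where k: "a = jdt_path t k" by blast
      obtain i j where ij: "jdt_path t k = (i, j)" by fastforce
      have "t (jdt_path t (Suc k)) \<le> t b"
        using ab k ij by (auto simp: le_less)
      moreover have "src b \<noteq> jdt_path t (Suc k)" 
        using inj_src src_path[of k] k ab by (metis injD prod.collapse prod.inject n_not_Suc_n)
      then have "t (src b) \<noteq> t (jdt_path t (Suc k))"
        using infinite_tableaux_mono(1)[OF t] by (auto dest: injD)
      ultimately show ?thesis using le src_path k by (metis le_neq_implies_less order_trans)
    qed
    then show ?thesis using gt[of a] by (simp add: jdt)
  qed
  ultimately show ?thesis by (auto simp: infinite_tableaux_def bij_betw_def)
qed

lemma measurable_entry_at:
  assumes "p \<in> tableau_algebra \<rightarrow>\<^sub>M count_space (UNIV :: box set)"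
  shows "(\<lambda>t. t (p t)) \<in> tableau_algebra \<rightarrow>\<^sub>M count_space UNIV"
  by (rule measurable_compose_countable[OF measurable_entry assms])

lemma measurable_jdt_path: "(\<lambda>t. jdt_path t k) \<in> tableau_algebra \<rightarrow>\<^sub>M count_space UNIV"
proof (induction k)
  case (Suc k)
  have "(\<lambda>t. case b of (i, j) \<Rightarrow> if t (Suc i, j) < t (i, Suc j) then (Suc i, j) else (i, Suc j))
      \<in> tableau_algebra \<rightarrow>\<^sub>M count_space UNIV" for b
  proof -
    obtain i j where b: "b = (i, j)" by fastforce
    have "(\<lambda>t. t (Suc i, j) < t (i, Suc j)) \<in> tableau_algebra \<rightarrow>\<^sub>M count_space UNIV"
      by (rule measurable_compose_countable[of "\<lambda>n t. n < t (i, Suc j)" _ _ "\<lambda>t. t (Suc i, j)"])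
         (rule measurable_compose[OF measurable_entry], simp, rule measurable_entry)
    then show ?thesis unfolding b case_prod_conv by (intro measurable_If) (simp_all add: pred_def)
  qed
  from measurable_compose_countable[OF this Suc.IH] show ?case by simp
qed simp

lemma measurable_jdt: "jdt \<in> tableau_algebra \<rightarrow>\<^sub>M tableau_algebra"
proof (rule measurable_into_tableau_algebra)
  fix b
  have 1: "(\<lambda>t. jdt_path t (fst b + snd b) = b) \<in> tableau_algebra \<rightarrow>\<^sub>M count_space UNIV"
    by (rule measurable_compose[OF measurable_jdt_path]) simp
  have 2: "(\<lambda>t. t (jdt_path t (Suc (fst b + snd b))) - 1) \<in> tableau_algebra \<rightarrow>\<^sub>M count_space UNIV"
    by (rule measurable_compose[OF measurable_entry_at[OF measurable_jdt_path]]) simp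
  have 3: "(\<lambda>t. t b - 1) \<in> tableau_algebra \<rightarrow>\<^sub>M count_space UNIV"
    by (rule measurable_compose[OF measurable_entry]) simp
  show "(\<lambda>t. jdt t b) \<in> tableau_algebra \<rightarrow>\<^sub>M count_space UNIV"
    unfolding jdt_eq using 1 by (intro measurable_If 2 3) (simp add: pred_def)
qed (simp add: space_tableau_algebra jdt_infinite_tableaux)

section \<open>The law of the recording tableau\<close>

definition path_cylinder :: "nat \<Rightarrow> diagram list \<Rightarrow> tableau set" where
  "path_cylinder n l = {t \<in> infinite_tableaux. map (\<lambda>i. {b. t b \<le> i}) [0..<Suc n] = l}"

lemma path_cylinder_iff:
  "t \<in> path_cylinder n l \<longleftrightarrow> t \<in> infinite_tableaux \<and> length l = Suc n \<and> (\<forall>i\<le>n. {b. t b \<le> i} = l ! i)"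
  unfolding path_cylinder_def by (auto simp: list_eq_iff_nth_eq less_Suc_eq_le simp del: upt_Suc)

lemma finite_initial_diagram:
  assumes "t \<in> infinite_tableaux"
  shows "finite {b. t b \<le> n}"
proof -
  have "finite (t -` {..n})" using infinite_tableaux_mono(1)[OF assms] by (intro finite_vimageI) auto
  moreover have "t -` {..n} = {b. t b \<le> n}" by auto
  ultimately show ?thesis by simp
qed

lemma Int_stable_path_cylinders: "Int_stable (insert {} {path_cylinder n l | n l. True})"
proof (rule Int_stableI)
  have *: "path_cylinder n l \<inter> path_cylinder m k \<in> insert {} {path_cylinder n l | n l. True}"
    if "n \<le> m" for n m l k
  proof (cases "path_cylinder n l \<inter> path_cylinder m k = {}")
    case False
    then obtain t0 where t0: "t0 \<in> path_cylinder n l" "t0 \<in> path_cylinder m k" by blast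
    have "path_cylinder m k \<subseteq> path_cylinder n l"
    proof
      fix t assume "t \<in> path_cylinder m k"
      then show "t \<in> path_cylinder n l" using t0 that by (auto simp: path_cylinder_iff)
    qed
    then have "path_cylinder n l \<inter> path_cylinder m k = path_cylinder m k" by blast
    then show ?thesis by auto
  qed simp
  fix A B assume AB: "A \<in> insert {} {path_cylinder n l | n l. True}" "B \<in> insert {} {path_cylinder n l | n l. True}"
  show "A \<inter> B \<in> insert {} {path_cylinder n l | n l. True}"
  proof (cases "A = {} \<or> B = {}")
    case False
    then obtain n l m k where "A = path_cylinder n l" "B = path_cylinder m k" using AB by blast
    then show ?thesis using *[of n m l k] *[of m n k l] by (metis Int_commute nle_le)
  qed auto
qed

lemma measurable_initial_diagram:
  "(\<lambda>t. {b. t b \<le> n}) \<in> tableau_algebra \<rightarrow>\<^sub>M count_space {d. finite d}"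
proof (rule measurable_count_space_eq_countable[OF countable_Collect_finite, THEN iffD2], intro conjI ballI)
  fix d :: diagram
  have pred: "Measurable.pred tableau_algebra (\<lambda>t. t b \<le> n)" for b
    by (rule measurable_compose[OF measurable_entry]) simp
  have "{t \<in> space tableau_algebra. \<forall>b. t b \<le> n \<longleftrightarrow> b \<in> d} \<in> sets tableau_algebra"
    using pred by measurable
  moreover have "(\<lambda>t. {b. t b \<le> n}) -` {d} \<inter> space tableau_algebra =
      {t \<in> space tableau_algebra. \<forall>b. t b \<le> n \<longleftrightarrow> b \<in> d}" by auto
  ultimately show "(\<lambda>t. {b. t b \<le> n}) -` {d} \<inter> space tableau_algebra \<in> sets tableau_algebra" by simp
next
  show "(\<lambda>t. {b. t b \<le> n}) \<in> space tableau_algebra \<rightarrow> {d. finite d}"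
    by (auto simp: space_tableau_algebra finite_initial_diagram)
qed

lemma sets_path_cylinder: "path_cylinder n l \<in> sets tableau_algebra"
proof -
  have "{t \<in> space tableau_algebra. length l = Suc n \<and> (\<forall>i\<in>{..n}. {b. t b \<le> i} = l ! i)} \<in> sets tableau_algebra"
  proof (intro sets.sets_Collect_conj sets.sets_Collect_const sets.sets_Collect_finite_All')
    fix i
    have "(\<lambda>t. {b. t b \<le> i}) -` {l ! i} \<inter> space tableau_algebra \<in> sets tableau_algebra"
    proof (cases "finite (l ! i)")
      case True
      then show ?thesis by (intro measurable_sets[OF measurable_initial_diagram]) simp
    next
      case False
      then have "(\<lambda>t. {b. t b \<le> i}) -` {l ! i} \<inter> space tableau_algebra = {}"
        unfolding space_tableau_algebra by (auto dest!: finite_initial_diagram[of _ i])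
      then show ?thesis by simp
    qed
    moreover have "(\<lambda>t. {b. t b \<le> i}) -` {l ! i} \<inter> space tableau_algebra =
        {t \<in> space tableau_algebra. {b. t b \<le> i} = l ! i}" by auto
    ultimately show "{t \<in> space tableau_algebra. {b. t b \<le> i} = l ! i} \<in> sets tableau_algebra" by simp
  qed auto
  moreover have "path_cylinder n l = {t \<in> space tableau_algebra. length l = Suc n \<and> (\<forall>i\<in>{..n}. {b. t b \<le> i} = l ! i)}"
    unfolding space_tableau_algebra path_cylinder_iff[abs_def] set_eq_iff mem_Collect_eq Ball_def atMost_iff by blast
  ultimately show ?thesis by (simp only:)
qed

text \<open>
  There are only countably many lists of finite diagrams, so each event about a single entry is obtained
  from cylinders by countable unions and differences.
\<close>

lemma sets_tableau_algebra_cylinders: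
  "sets tableau_algebra = sigma_sets infinite_tableaux (insert {} {path_cylinder n l | n l. True})"
    (is "_ = sigma_sets _ ?E")
proof
  show "sigma_sets infinite_tableaux ?E \<subseteq> sets tableau_algebra"
    using sets.sigma_sets_subset[of ?E tableau_algebra] sets_path_cylinder
    by (auto simp: space_tableau_algebra)
  interpret sigma_algebra infinite_tableaux "sigma_sets infinite_tableaux ?E"
    by (rule sigma_algebra_sigma_sets) (auto simp: path_cylinder_def)
  have cyl: "path_cylinder n l \<in> sigma_sets infinite_tableaux ?E" for n l by (rule sigma_sets.Basic) blast
  have le: "{t \<in> infinite_tableaux. t b \<le> n} \<in> sigma_sets infinite_tableaux ?E" for b n
  proof -
    let ?L = "{l \<in> lists {d :: diagram. finite d}. length l = Suc n \<and> b \<in> l ! n}"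
    have "{t \<in> infinite_tableaux. t b \<le> n} = (\<Union>l\<in>?L. path_cylinder n l)"
    proof (intro equalityI subsetI)
      fix t assume t: "t \<in> {t \<in> infinite_tableaux. t b \<le> n}"
      let ?l = "map (\<lambda>i. {b. t b \<le> i}) [0..<Suc n]"
      have "?l \<in> ?L"
        using t finite_initial_diagram[of t] by (auto simp: nth_append)
      moreover have "t \<in> path_cylinder n ?l" using t by (simp add: path_cylinder_def)
      ultimately show "t \<in> (\<Union>l\<in>?L. path_cylinder n l)" by blast
    next
      fix t assume "t \<in> (\<Union>l\<in>?L. path_cylinder n l)"
      then show "t \<in> {t \<in> infinite_tableaux. t b \<le> n}" by (auto simp: path_cylinder_iff)
    qed
    moreover have "countable ?L"
      by (rule countable_subset[OF _ countable_lists[OF countable_Collect_finite]]) auto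
    then have "(\<Union>l\<in>?L. path_cylinder n l) \<in> sigma_sets infinite_tableaux ?E"
      by (rule countable_UN'') (rule cyl)
    ultimately show ?thesis by simp
  qed
  have eq: "{t \<in> infinite_tableaux. t b = n} \<in> sigma_sets infinite_tableaux ?E" for b n
  proof (cases n)
    case 0
    then show ?thesis using le[of b 0] by simp
  next
    case (Suc m)
    have "{t \<in> infinite_tableaux. t b = n} = {t \<in> infinite_tableaux. t b \<le> n} - {t \<in> infinite_tableaux. t b \<le> m}"
      using Suc by auto
    then show ?thesis using Diff[OF le le, of b n b m] by (simp only:)
  qed
  have "{t \<in> infinite_tableaux. t b \<in> A} \<in> sigma_sets infinite_tableaux ?E" for b A
  proof -
    have "{t \<in> infinite_tableaux. t b \<in> A} = (\<Union>n\<in>A. {t \<in> infinite_tableaux. t b = n})" by auto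
    also have "\<dots> \<in> sigma_sets infinite_tableaux ?E" using eq by (intro countable_UN'') auto
    finally show ?thesis .
  qed
  then show "sets tableau_algebra \<subseteq> sigma_sets infinite_tableaux ?E"
    unfolding sets_tableau_algebra by (intro sigma_sets_subset) auto
qed

context plancherel_process
begin

lemma sets_complete_paths: "{x \<in> space M. Z x \<in> complete_paths} \<in> events"
proof -
  have step: "Measurable.pred M (\<lambda>x. Z x n \<hookrightarrow> Z x (Suc n))" for n
  proof -
    have "Z x n \<hookrightarrow> Z x (Suc n) \<longleftrightarrow>
        (\<exists>d\<in>{d. finite d}. \<exists>e\<in>{e. finite e}. d \<hookrightarrow> e \<and> Z x n = d \<and> Z x (Suc n) = e)" for x
      by (auto simp: add_box_def young_diagramD(1))
    moreover have eq: "Measurable.pred M (\<lambda>x. Z x k = d)" for k d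
      by (rule measurable_compose[OF measurable_Z]) simp
    have "Measurable.pred M (\<lambda>x. \<exists>d\<in>{d :: diagram. finite d}. \<exists>e\<in>{e :: diagram. finite e}.
        d \<hookrightarrow> e \<and> Z x n = d \<and> Z x (Suc n) = e)"
      unfolding pred_def
      by (intro sets.sets_Collect_countable_Ex' countable_Collect_finite sets.sets_Collect_conj
          sets.sets_Collect_const eq[unfolded pred_def])
    ultimately show ?thesis by simp
  qed
  have box: "Measurable.pred M (\<lambda>x. b \<in> Z x n)" for b n
    by (rule measurable_compose[OF measurable_Z]) simp
  have zero: "Measurable.pred M (\<lambda>x. Z x 0 = {})"
    by (rule measurable_compose[OF measurable_Z]) simp
  have "Measurable.pred M (\<lambda>x. Z x 0 = {} \<and> (\<forall>n. Z x n \<hookrightarrow> Z x (Suc n)) \<and> (\<forall>b. \<exists>n. b \<in> Z x n))"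
    by (intro pred_intros_logic pred_intros_countable step box zero)
  then show ?thesis by (simp add: complete_paths_def pred_def)
qed

lemma measurable_recording:
  assumes "D \<subseteq> {x \<in> space M. Z x \<in> complete_paths}"
  shows "(\<lambda>x. recording_tableau (Z x)) \<in> restrict_space M D \<rightarrow>\<^sub>M tableau_algebra"
proof (rule measurable_into_tableau_algebra)
  fix x assume "x \<in> space (restrict_space M D)"
  then have "Z x \<in> complete_paths" using assms by (auto simp: space_restrict_space)
  then show "recording_tableau (Z x) \<in> infinite_tableaux" by (rule recording_infinite)
next
  fix b
  have "Measurable.pred M (\<lambda>x. b \<in> Z x n)" for n
    by (rule measurable_compose[OF measurable_Z]) simp
  then have "(\<lambda>x. LEAST n. b \<in> Z x n) \<in> M \<rightarrow>\<^sub>M count_space UNIV"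
    by (rule measurable_Least)
  then show "(\<lambda>x. recording_tableau (Z x) b) \<in> restrict_space M D \<rightarrow>\<^sub>M count_space UNIV"
    unfolding recording_tableau_def by (rule measurable_restrict_space1)
qed

lemma recording_cylinder:
  assumes D: "D \<in> events" "D \<subseteq> {x \<in> space M. Z x \<in> complete_paths}" "AE x in M. x \<in> D"
  shows "emeasure (distr (restrict_space M D) tableau_algebra (\<lambda>x. recording_tableau (Z x))) (path_cylinder n l) =
    ennreal (if l \<in> growth_paths n then dim (last l) / fact n else 0)"
proof -
  let ?A = "{x \<in> space M. map (Z x) [0..<Suc n] = l}"
  have sub: "D \<subseteq> space M" using D(1) sets.sets_into_space by blast
  have cyl: "recording_tableau (Z x) \<in> path_cylinder n l \<longleftrightarrow> map (Z x) [0..<Suc n] = l" if "x \<in> D" for x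
  proof -
    have c: "Z x \<in> complete_paths" using that D(2) by auto
    have "{b. recording_tableau (Z x) b \<le> i} = Z x i" for i
      using recording_le_iff[OF c] by auto
    then show ?thesis using recording_infinite[OF c] by (simp add: path_cylinder_def)
  qed
  have "emeasure (distr (restrict_space M D) tableau_algebra (\<lambda>x. recording_tableau (Z x))) (path_cylinder n l) =
      emeasure (restrict_space M D) ((\<lambda>x. recording_tableau (Z x)) -` path_cylinder n l \<inter> space (restrict_space M D))"
    by (rule emeasure_distr[OF measurable_recording[OF D(2)] sets_path_cylinder])
  also have "(\<lambda>x. recording_tableau (Z x)) -` path_cylinder n l \<inter> space (restrict_space M D) = ?A \<inter> D"
    using cyl sub by (auto simp: space_restrict_space)
  also have "emeasure (restrict_space M D) (?A \<inter> D) = emeasure M (?A \<inter> D)"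
    using D(1) sub by (intro emeasure_restrict_space) auto
  also have "\<dots> = emeasure M ?A"
    using D(1,3) path_event[of "Suc n" l] by (intro emeasure_eq_AE) (auto simp del: upt_Suc)
  also have "\<dots> = ennreal (prob ?A)" by (rule emeasure_eq_measure)
  also have "prob ?A = (if l \<in> growth_paths n then dim (last l) / fact n else 0)"
  proof (cases "l \<in> growth_paths n")
    case True
    then show ?thesis using prob_path by simp
  next
    case False
    have "AE x in M. x \<notin> ?A" using AE_growth_paths[of n] by eventually_elim (use False in blast)
    then have "prob ?A = 0" using path_event by (simp add: prob_eq_0 del: upt_Suc)
    then show ?thesis using False by simp
  qed
  finally show ?thesis .
qed

end

lemma tableau_measure_eqI:
  assumes "sets M = sets tableau_algebra" "sets N = sets tableau_algebra"
    and "\<And>n l. emeasure M (path_cylinder n l) = emeasure N (path_cylinder n l)"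
    and "\<And>n l. emeasure M (path_cylinder n l) \<noteq> \<infinity>"
  shows "M = N"
proof (rule measure_eqI_generator_eq[OF Int_stable_path_cylinders, of infinite_tableaux M N "\<lambda>_. path_cylinder 0 [{}]"])
  show "insert {} {path_cylinder n l | n l. True} \<subseteq> Pow infinite_tableaux" by (auto simp: path_cylinder_def)
  have "t \<in> path_cylinder 0 [{}]" if "t \<in> infinite_tableaux" for t
  proof -
    have "t b \<noteq> 0" for b using infinite_tableaux_mono(2)[OF that] by (metis atLeast_iff not_one_le_zero rangeI)
    then show ?thesis using that by (auto simp: path_cylinder_iff)
  qed
  then show "(\<Union>i::nat. path_cylinder 0 [{}]) = infinite_tableaux" by (auto simp: path_cylinder_iff)
qed (use assms sets_tableau_algebra_cylinders in auto)

section \<open>The isomorphism\<close>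

lemma distr_left_shift: "distr unit_cube unit_cube left_shift = unit_cube"
  using distr_unit_cube_reindex[of Suc] by (simp add: left_shift_def[abs_def])

lemma measure_preserving_left_shift: "measure_preserving_system unit_cube left_shift"
  unfolding measure_preserving_system_def
  by (intro conjI cube.prob_space_axioms measurable_left_shift distr_left_shift)

lemma rsk_domain_eq: "rsk_domain = {x \<in> space unit_cube. inj x} \<inter> {x \<in> space unit_cube. rsk_shape x \<in> complete_paths}"
  by (auto simp: rsk_domain_def space_unit_cube)

lemma sets_rsk_domain: "rsk_domain \<in> sets unit_cube"
proof -
  have "{x \<in> space unit_cube. x i = x j} \<in> sets unit_cube" for i j
    by (rule borel_measurable_eq) (rule measurable_coord)+
  then have "{x \<in> space unit_cube. \<forall>i j. i \<noteq> j \<longrightarrow> x i \<noteq> x j} \<in> sets unit_cube"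
    by (intro sets.sets_Collect_countable_All sets.sets_Collect_imp sets.sets_Collect_neg sets.sets_Collect_const)
  moreover have "inj x \<longleftrightarrow> (\<forall>i j. i \<noteq> j \<longrightarrow> x i \<noteq> x j)" for x :: "nat \<Rightarrow> real"
    unfolding inj_def by blast
  ultimately have "{x \<in> space unit_cube. inj x} \<in> sets unit_cube" by (simp only:)
  then show ?thesis unfolding rsk_domain_eq using shapes.sets_complete_paths by (rule sets.Int)
qed

lemma rsk_domain_subset: "rsk_domain \<subseteq> space unit_cube"
  by (auto simp: rsk_domain_eq)

lemma AE_rsk_domain: "AE x in unit_cube. x \<in> rsk_domain"
  using AE_unit_cube_inj shapes.AE_complete_paths AE_space
  by eventually_elim (simp add: rsk_domain_eq)

definition rsk_space :: "(nat \<Rightarrow> real) measure" where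
  "rsk_space = restrict_space unit_cube rsk_domain"

lemma space_rsk_space: "space rsk_space = rsk_domain"
  using rsk_domain_subset by (auto simp: rsk_space_def space_restrict_space)

lemma sets_rsk_space_iff: "A \<in> sets rsk_space \<longleftrightarrow> A \<subseteq> rsk_domain \<and> A \<in> sets unit_cube"
  unfolding rsk_space_def using sets_rsk_domain rsk_domain_subset
  by (subst sets_restrict_space_iff) (auto simp: Int_absorb1)

lemma emeasure_rsk_space: "A \<in> sets rsk_space \<Longrightarrow> emeasure rsk_space A = emeasure unit_cube A"
  unfolding rsk_space_def using sets_rsk_domain rsk_domain_subset
  by (intro emeasure_restrict_space) (auto simp: sets_restrict_space space_restrict_space)

lemma prob_space_rsk_space: "prob_space rsk_space"
proof (rule prob_spaceI)
  have "emeasure unit_cube rsk_domain = emeasure unit_cube (space unit_cube)"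
    using AE_rsk_domain sets_rsk_domain AE_space by (intro emeasure_eq_AE) auto
  then show "emeasure rsk_space (space rsk_space) = 1"
    using emeasure_rsk_space[of rsk_domain] sets_rsk_domain cube.emeasure_space_1
    by (simp add: space_rsk_space sets_rsk_space_iff)
qed

lemma AE_rsk_space_iff: "(AE x in rsk_space. P x) \<longleftrightarrow> (AE x in unit_cube. P x)"
proof -
  have "(AE x in rsk_space. P x) \<longleftrightarrow> (AE x in unit_cube. x \<in> rsk_domain \<longrightarrow> P x)"
    unfolding rsk_space_def using sets_rsk_domain rsk_domain_subset
    by (intro AE_restrict_space_iff) (simp add: Int_absorb2)
  also have "\<dots> \<longleftrightarrow> (AE x in unit_cube. P x)"
    using AE_rsk_domain by (auto elim!: eventually_mono[rotated] AE_mp)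
  finally show ?thesis .
qed

lemma measurable_rsk: "rsk \<in> rsk_space \<rightarrow>\<^sub>M tableau_algebra"
  unfolding rsk_space_def rsk_def[abs_def]
  by (rule shapes.measurable_recording) (auto simp: rsk_domain_eq)

lemma sets_plancherel_measure: "sets plancherel_measure = sets tableau_algebra"
  by (simp add: plancherel_measure_def)

text \<open>Both measures give the cylinder of a growth path its Plancherel weight.\<close>

lemma distr_rsk: "distr rsk_space tableau_algebra rsk = plancherel_measure"
proof (rule tableau_measure_eqI)
  have 1: "emeasure (distr rsk_space tableau_algebra rsk) (path_cylinder n l) =
      ennreal (if l \<in> growth_paths n then dim (last l) / fact n else 0)" for n l
    unfolding rsk_space_def rsk_def[abs_def]
    by (rule shapes.recording_cylinder[OF sets_rsk_domain _ AE_rsk_domain]) (auto simp: rsk_domain_eq)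
  have "space plancherel_growth = UNIV"
    using sets_eq_imp_space_eq[OF sets_plancherel_growth] by (simp add: space_PiM)
  then have "complete_paths = {d \<in> space plancherel_growth. d \<in> complete_paths}" by simp
  then have "complete_paths \<in> sets plancherel_growth" using growth.sets_complete_paths by simp
  from growth.recording_cylinder[OF this _ growth.AE_complete_paths]
  have 2: "emeasure plancherel_measure (path_cylinder n l) =
      ennreal (if l \<in> growth_paths n then dim (last l) / fact n else 0)" for n l
    using \<open>space plancherel_growth = UNIV\<close> by (simp add: plancherel_measure_def)
  show "emeasure (distr rsk_space tableau_algebra rsk) (path_cylinder n l) =
      emeasure plancherel_measure (path_cylinder n l)" for n l
    unfolding 1 2 ..
  show "emeasure (distr rsk_space tableau_algebra rsk) (path_cylinder n l) \<noteq> \<infinity>" for n l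
    unfolding 1 by simp
qed (simp_all add: sets_plancherel_measure)

lemma prob_space_plancherel_measure: "prob_space plancherel_measure"
  unfolding distr_rsk[symmetric] using prob_space_rsk_space measurable_rsk by (rule prob_space.prob_space_distr)

lemma measurable_shift_rsk_space: "left_shift \<in> rsk_space \<rightarrow>\<^sub>M rsk_space"
  unfolding rsk_space_def using rsk_left_shift(1) rsk_domain_subset
  by (intro measurable_restrict_space2 measurable_restrict_space1 measurable_left_shift)
     (auto simp: space_restrict_space)

text \<open>
  The shift maps \<^const>\<open>rsk_domain\<close> into itself, and restricting to a set of full measure does not affect
  the invariance of the measure.
\<close>

lemma distr_shift_rsk_space: "distr rsk_space rsk_space left_shift = rsk_space"
proof (rule measure_eqI)
  fix A assume "A \<in> sets (distr rsk_space rsk_space left_shift)"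
  then have A: "A \<in> sets rsk_space" by simp
  then have A': "A \<in> sets unit_cube" by (simp add: sets_rsk_space_iff)
  have pre: "left_shift -` A \<inter> rsk_domain \<in> sets rsk_space"
    using measurable_sets[OF measurable_shift_rsk_space A] by (simp add: space_rsk_space)
  have "emeasure (distr rsk_space rsk_space left_shift) A = emeasure rsk_space (left_shift -` A \<inter> rsk_domain)"
    using emeasure_distr[OF measurable_shift_rsk_space A] by (simp add: space_rsk_space)
  also have "\<dots> = emeasure unit_cube (left_shift -` A \<inter> rsk_domain)" by (rule emeasure_rsk_space[OF pre])
  also have "\<dots> = emeasure unit_cube (left_shift -` A \<inter> space unit_cube)"
  proof (rule emeasure_eq_AE)
    show "AE x in unit_cube. x \<in> left_shift -` A \<inter> rsk_domain \<longleftrightarrow> x \<in> left_shift -` A \<inter> space unit_cube"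
      using AE_rsk_domain by eventually_elim (use rsk_domain_subset in blast)
    show "left_shift -` A \<inter> rsk_domain \<in> sets unit_cube" using pre by (simp only: sets_rsk_space_iff)
  qed (rule measurable_sets[OF measurable_left_shift A'])
  also have "\<dots> = emeasure (distr unit_cube unit_cube left_shift) A"
    by (rule emeasure_distr[OF measurable_left_shift A', symmetric])
  also have "\<dots> = emeasure rsk_space A"
    by (simp only: distr_left_shift emeasure_rsk_space[OF A])
  finally show "emeasure (distr rsk_space rsk_space left_shift) A = emeasure rsk_space A" .
qed simp

text \<open>
  Jeu de taquin inherits the invariance from the shift, of which it is a factor.
\<close>

lemma measure_preserving_jdt: "measure_preserving_system plancherel_measure jdt"
  unfolding measure_preserving_system_def
proof (intro conjI prob_space_plancherel_measure)
  show "jdt \<in> plancherel_measure \<rightarrow>\<^sub>M plancherel_measure"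
    using measurable_jdt measurable_cong_sets[OF sets_plancherel_measure sets_plancherel_measure] by blast
  have "distr plancherel_measure plancherel_measure jdt = distr plancherel_measure tableau_algebra jdt"
    by (rule distr_cong[OF refl sets_plancherel_measure refl])
  also have "\<dots> = distr rsk_space tableau_algebra (jdt \<circ> rsk)"
    unfolding distr_rsk[symmetric] by (rule distr_distr[OF measurable_jdt measurable_rsk])
  also have "\<dots> = distr rsk_space tableau_algebra (rsk \<circ> left_shift)"
    by (rule distr_cong[OF refl refl]) (simp add: space_rsk_space rsk_left_shift(2))
  also have "\<dots> = distr (distr rsk_space rsk_space left_shift) tableau_algebra rsk"
    by (rule distr_distr[OF measurable_rsk measurable_shift_rsk_space, symmetric])
  also have "\<dots> = plancherel_measure" unfolding distr_shift_rsk_space by (rule distr_rsk)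
  finally show "distr plancherel_measure plancherel_measure jdt = plancherel_measure" .
qed

text \<open>
  The estimates of the first letter are functions of the recording tableau, since the shapes of the
  shifted sequence are recorded by the slid tableau.  Along a sequence of estimates with summable mean
  errors they converge almost surely to the first letter.
\<close>

lemma first_letter_recovered:
  obtains g where "g \<in> borel_measurable tableau_algebra" "AE x in rsk_space. x 0 = g (rsk x)"
proof -
  have choice: "\<exists>m K q. \<forall>k. Q k (m k) (K k) (q k)" if "\<forall>k. \<exists>m K q. Q k m K q"
    for Q :: "nat \<Rightarrow> nat \<Rightarrow> nat \<Rightarrow> nat \<Rightarrow> bool" using that by metis
  have "\<forall>k. \<exists>m K q. (\<integral>x. \<bar>x 0 - letter_estimate K q (transp (rsk_shape (left_shift x) m))
      (transp (rsk_shape x (Suc m)))\<bar> \<partial>unit_cube) \<le> (1/2) ^ k"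
  proof
    fix k :: nat
    have "(0::real) < (1/2) ^ k" by simp
    from first_letter_determined[OF this] show "\<exists>m K q. (\<integral>x. \<bar>x 0 - letter_estimate K q (transp (rsk_shape (left_shift x) m))
      (transp (rsk_shape x (Suc m)))\<bar> \<partial>unit_cube) \<le> (1/2) ^ k" by blast
  qed
  from choice[OF this]
  obtain m K q where mKq: "\<And>k. (\<integral>x. \<bar>x 0 - letter_estimate (K k) (q k) (transp (rsk_shape (left_shift x) (m k)))
      (transp (rsk_shape x (Suc (m k))))\<bar> \<partial>unit_cube) \<le> (1/2) ^ k"
    by blast
  define e where "e k t = letter_estimate (K k) (q k) (transp {b. jdt t b \<le> m k}) (transp {b. t b \<le> Suc (m k)})" for k t
  have e: "e k \<in> borel_measurable tableau_algebra" for k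
  proof -
    have j: "(\<lambda>t. {b. jdt t b \<le> m k}) \<in> tableau_algebra \<rightarrow>\<^sub>M count_space {d. finite d}"
      by (rule measurable_compose[OF measurable_jdt measurable_initial_diagram])
    have "(\<lambda>t. letter_estimate (K k) (q k) (transp d) (transp {b. t b \<le> Suc (m k)})) \<in> borel_measurable tableau_algebra" for d
      by (rule measurable_compose[OF measurable_initial_diagram]) simp
    from measurable_compose_countable'[OF this j countable_Collect_finite]
    show ?thesis unfolding e_def[abs_def] .
  qed
  have e_rsk: "e k (rsk x) = letter_estimate (K k) (q k) (transp (rsk_shape (left_shift x) (m k)))
      (transp (rsk_shape x (Suc (m k))))" if x: "x \<in> rsk_domain" for x k
  proof -
    have c: "rsk_shape x \<in> complete_paths" "rsk_shape (left_shift x) \<in> complete_paths"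
      using x rsk_left_shift(1)[OF x] by (auto simp: rsk_domain_def)
    have "{b. rsk x b \<le> Suc (m k)} = rsk_shape x (Suc (m k))"
      using recording_le_iff[OF c(1)] by (simp add: rsk_def)
    moreover have "{b. jdt (rsk x) b \<le> m k} = rsk_shape (left_shift x) (m k)"
      using recording_le_iff[OF c(2)] rsk_left_shift(2)[OF x] by (simp add: rsk_def)
    ultimately show ?thesis by (simp add: e_def)
  qed
  interpret R: prob_space rsk_space by (rule prob_space_rsk_space)
  let ?d = "\<lambda>k x. \<bar>x 0 - e k (rsk x)\<bar>"
  have m0: "(\<lambda>x. x 0) \<in> borel_measurable rsk_space"
    unfolding rsk_space_def by (rule measurable_restrict_space1[OF measurable_coord])
  have md: "?d k \<in> borel_measurable rsk_space" for k
    using m0 measurable_compose[OF measurable_rsk e] by (intro borel_measurable_abs borel_measurable_diff)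
  have int_le: "(\<integral>\<^sup>+x. ennreal (?d k x) \<partial>rsk_space) \<le> ennreal ((1/2) ^ k)" for k
  proof -
    let ?f = "\<lambda>x. \<bar>x 0 - letter_estimate (K k) (q k) (transp (rsk_shape (left_shift x) (m k)))
      (transp (rsk_shape x (Suc (m k))))\<bar>"
    have bd: "?d k x \<le> 1" if "x \<in> space rsk_space" for x
    proof -
      have "x \<in> space unit_cube" using that rsk_domain_subset by (auto simp only: space_rsk_space)
      then have "x 0 \<in> {0..1}" by (rule unit_cube_coord)
      moreover have "0 \<le> e k (rsk x)" "e k (rsk x) \<le> 1"
        unfolding e_def letter_estimate_def by (rule left_prob_bounds)+
      ultimately show ?thesis by (simp add: abs_le_iff)
    qed
    have "integrable rsk_space (?d k)"
    proof (rule R.integrable_const_bound[OF AE_I2 md])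
      show "norm (?d k x) \<le> 1" if "x \<in> space rsk_space" for x using bd[OF that] by simp
    qed
    then have "(\<integral>\<^sup>+x. ennreal (?d k x) \<partial>rsk_space) = ennreal (\<integral>x. ?d k x \<partial>rsk_space)"
      by (rule nn_integral_eq_integral) simp
    also have "(\<integral>x. ?d k x \<partial>rsk_space) = (\<integral>x. indicator rsk_domain x *\<^sub>R ?d k x \<partial>unit_cube)"
      unfolding rsk_space_def using sets_rsk_domain rsk_domain_subset
      by (intro Bochner_Integration.integral_restrict_space) (simp add: Int_absorb2)
    also have "\<dots> \<le> (1/2) ^ k"
    proof -
      have "(\<integral>x. indicator rsk_domain x *\<^sub>R ?d k x \<partial>unit_cube) = (\<integral>x. indicator rsk_domain x *\<^sub>R ?f x \<partial>unit_cube)"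
        by (intro Bochner_Integration.integral_cong refl) (auto simp: indicator_def e_rsk)
      also have "\<dots> = (\<integral>x. ?f x \<partial>unit_cube)"
      proof (rule integral_cong_AE)
        show f: "?f \<in> borel_measurable unit_cube" by (rule measurable_first_letter_error)
        show "(\<lambda>x. indicator rsk_domain x *\<^sub>R ?f x) \<in> borel_measurable unit_cube"
          by (intro borel_measurable_scaleR borel_measurable_indicator sets_rsk_domain f)
        show "AE x in unit_cube. indicator rsk_domain x *\<^sub>R ?f x = ?f x"
          using AE_rsk_domain by eventually_elim simp
      qed
      also have "\<dots> \<le> (1/2) ^ k" by (rule mKq)
      finally show ?thesis .
    qed
    finally show ?thesis by (simp add: ennreal_leI)
  qed
  have "(\<integral>\<^sup>+x. (\<Sum>k. ennreal (?d k x)) \<partial>rsk_space) = (\<Sum>k. \<integral>\<^sup>+x. ennreal (?d k x) \<partial>rsk_space)"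
    by (intro nn_integral_suminf measurable_compose[OF md measurable_ennreal])
  also have "\<dots> \<le> (\<Sum>k. ennreal ((1/2) ^ k))" by (intro suminf_le int_le) auto
  also have "\<dots> = ennreal 2"
  proof (subst suminf_ennreal2)
    show "ennreal (\<Sum>k. (1/2) ^ k) = ennreal 2" using suminf_geometric[of "1/2::real"] by simp
    show "summable (\<lambda>k. (1/2::real) ^ k)" by (rule summable_geometric) simp
  qed simp
  finally have "(\<integral>\<^sup>+x. (\<Sum>k. ennreal (?d k x)) \<partial>rsk_space) < top"
    by (rule le_less_trans[OF _ ennreal_less_top])
  then have "(\<integral>\<^sup>+x. (\<Sum>k. ennreal (?d k x)) \<partial>rsk_space) \<noteq> \<infinity>"
    unfolding infinity_ennreal_def by (rule less_imp_neq)
  moreover have "(\<lambda>x. \<Sum>k. ennreal (?d k x)) \<in> borel_measurable rsk_space"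
    by (intro borel_measurable_suminf_order measurable_compose[OF md measurable_ennreal])
  ultimately have AE: "AE x in rsk_space. (\<Sum>k. ennreal (?d k x)) \<noteq> \<infinity>"
    by (intro nn_integral_PInf_AE)
  show thesis
  proof (rule that)
    show "(\<lambda>t. lim (\<lambda>k. e k t)) \<in> borel_measurable tableau_algebra"
      by (rule borel_measurable_lim_metric) (rule e)
    show "AE x in rsk_space. x 0 = lim (\<lambda>k. e k (rsk x))"
      using AE
    proof eventually_elim
      case (elim x)
      then have "summable (\<lambda>k. ?d k x)" by (intro summable_suminf_not_top) (auto simp: infinity_ennreal_def)
      then have "(\<lambda>k. ?d k x) \<longlonglongrightarrow> 0" by (rule summable_LIMSEQ_zero)
      then have "(\<lambda>k. x 0 - e k (rsk x)) \<longlonglongrightarrow> 0" by (simp add: tendsto_rabs_zero_iff)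
      from tendsto_diff[OF tendsto_const[of "x 0"] this]
      have "(\<lambda>k. e k (rsk x)) \<longlonglongrightarrow> x 0" by simp
      then show ?case by (simp add: limI)
    qed
  qed
qed

lemma funpow_left_shift: "(left_shift ^^ n) x = (\<lambda>i. x (i + n))"
  by (induction n arbitrary: x) (simp_all add: left_shift_def funpow_Suc_right del: funpow.simps)

lemma rsk_funpow_shift:
  assumes "x \<in> rsk_domain"
  shows "(left_shift ^^ n) x \<in> rsk_domain \<and> rsk ((left_shift ^^ n) x) = (jdt ^^ n) (rsk x)"
  by (induction n) (use assms rsk_left_shift in auto)

text \<open>
  The letter \<open>x n\<close> is the first letter of the sequence shifted \<open>n\<close> times, and the shift preserves the measure,
  so it is recovered from the tableau slid \<open>n\<close> times.  The values are cut off at 0 and 1 in order to get a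
  point of the cube for every tableau.
\<close>

lemma letters_recovered:
  obtains G where "G \<in> tableau_algebra \<rightarrow>\<^sub>M unit_cube" "AE x in rsk_space. G (rsk x) = x"
proof -
  obtain g where g: "g \<in> borel_measurable tableau_algebra" "AE x in rsk_space. x 0 = g (rsk x)"
    using first_letter_recovered .
  define G where "G t n = max 0 (min 1 (g ((jdt ^^ n) t)))" for t n
  have jdt_n: "jdt ^^ n \<in> tableau_algebra \<rightarrow>\<^sub>M tableau_algebra" for n
  proof (induction n)
    case (Suc n)
    then show ?case unfolding funpow.simps by (rule measurable_comp) (rule measurable_jdt)
  qed (simp add: measurable_ident id_def)
  have G: "G \<in> tableau_algebra \<rightarrow>\<^sub>M unit_cube"
  proof (rule measurable_into_unit_cube)
    fix n
    show "(\<lambda>t. G t n) \<in> borel_measurable tableau_algebra"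
      unfolding G_def
      by (intro borel_measurable_max borel_measurable_min borel_measurable_const measurable_compose[OF jdt_n g(1)])
  qed (auto simp: G_def)
  have "AE x in rsk_space. x n = g ((jdt ^^ n) (rsk x))" for n
  proof -
    have shift_n: "left_shift ^^ n \<in> rsk_space \<rightarrow>\<^sub>M rsk_space \<and> distr rsk_space rsk_space (left_shift ^^ n) = rsk_space"
    proof (induction n)
      case 0
      then show ?case using distr_id2[of rsk_space rsk_space] by (simp add: measurable_ident id_def[symmetric])
    next
      case (Suc n)
      have "distr rsk_space rsk_space (left_shift \<circ> left_shift ^^ n) = rsk_space"
        using distr_distr[OF measurable_shift_rsk_space conjunct1[OF Suc]]
        by (simp only: conjunct2[OF Suc] distr_shift_rsk_space)
      moreover have "left_shift \<circ> left_shift ^^ n \<in> rsk_space \<rightarrow>\<^sub>M rsk_space"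
        by (rule measurable_comp[OF conjunct1[OF Suc] measurable_shift_rsk_space])
      ultimately show ?case unfolding funpow.simps by (intro conjI)
    qed
    have "AE x in distr rsk_space rsk_space (left_shift ^^ n). x 0 = g (rsk x)"
      unfolding conjunct2[OF shift_n] by (rule g(2))
    then have "AE x in rsk_space. ((left_shift ^^ n) x) 0 = g (rsk ((left_shift ^^ n) x))"
      by (rule AE_distrD[OF conjunct1[OF shift_n]])
    then show ?thesis
      using AE_space
      by eventually_elim (simp add: space_rsk_space rsk_funpow_shift, simp add: funpow_left_shift)
  qed
  then have "AE x in rsk_space. \<forall>n. x n = g ((jdt ^^ n) (rsk x))" by (simp add: AE_all_countable)
  then have "AE x in rsk_space. G (rsk x) = x"
    using AE_space
  proof eventually_elim
    case (elim x)
    show ?case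
    proof (rule ext)
      fix n
      have "x \<in> space unit_cube" using elim(2) rsk_domain_subset by (auto simp only: space_rsk_space)
      then have "x n \<in> {0..1}" by (rule unit_cube_coord)
      moreover have "g ((jdt ^^ n) (rsk x)) = x n" by (rule elim(1)[rule_format, symmetric])
      ultimately show "G (rsk x) n = x n" unfolding G_def by simp
    qed
  qed
  then show thesis using G that by blast
qed

lemma sets_Collect_eq_count_space:
  fixes f g :: "'a \<Rightarrow> nat"
  assumes "f \<in> M \<rightarrow>\<^sub>M count_space UNIV" "g \<in> M \<rightarrow>\<^sub>M count_space UNIV"
  shows "{x \<in> space M. f x = g x} \<in> sets M"
proof -
  have "{x \<in> space M. f x = g x} = (\<Union>n. (f -` {n} \<inter> space M) \<inter> (g -` {n} \<inter> space M))" by auto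
  also have "\<dots> \<in> sets M"
  proof (intro sets.countable_UN image_subsetI)
    fix n
    have "f -` {n} \<inter> space M \<in> sets M" "g -` {n} \<inter> space M \<in> sets M"
      by (rule measurable_sets[OF assms(1)], simp, rule measurable_sets[OF assms(2)], simp)
    then show "(f -` {n} \<inter> space M) \<inter> (g -` {n} \<inter> space M) \<in> sets M" by (rule sets.Int)
  qed
  finally show ?thesis .
qed

theorem theorem1p4:
  shows "mps_isomorphism unit_cube left_shift plancherel_measure jdt rsk_domain rsk"
proof -
  obtain G where G: "G \<in> tableau_algebra \<rightarrow>\<^sub>M unit_cube" "AE x in rsk_space. G (rsk x) = x"
    using letters_recovered .
  \<comment> \<open>On \<open>X\<close> and \<open>Y\<close> the maps are inverse to each other by definition, and \<open>G\<close> decides the membership in \<open>Y\<close> measurably.\<close>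
  define X where "X = {x \<in> rsk_domain. G (rsk x) = x}"
  define Y where "Y = {t \<in> infinite_tableaux. G t \<in> rsk_domain \<and> rsk (G t) = t}"
  have G_space: "G t \<in> space unit_cube" if "t \<in> infinite_tableaux" for t
    using measurable_space[OF G(1)] that by (simp add: space_tableau_algebra)
  have rsk_space': "rsk x \<in> infinite_tableaux" if "x \<in> rsk_domain" for x
    using measurable_space[OF measurable_rsk] that by (simp add: space_tableau_algebra space_rsk_space)
  have X_rsk: "X \<in> sets rsk_space"
  proof -
    have 1: "(\<lambda>x. G (rsk x) n) \<in> borel_measurable rsk_space" for n
      by (rule measurable_compose[OF measurable_compose[OF measurable_rsk G(1)] measurable_coord])
    have 2: "(\<lambda>x. x n) \<in> borel_measurable rsk_space" for n
      unfolding rsk_space_def by (rule measurable_restrict_space1[OF measurable_coord])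
    have "{x \<in> space rsk_space. \<forall>n. G (rsk x) n = x n} \<in> sets rsk_space"
      by (intro sets.sets_Collect_countable_All borel_measurable_eq 1 2)
    moreover have "X = {x \<in> space rsk_space. \<forall>n. G (rsk x) n = x n}"
      by (auto simp: X_def space_rsk_space fun_eq_iff)
    ultimately show ?thesis by simp
  qed
  then have X: "X \<in> sets unit_cube" "X \<subseteq> rsk_domain" by (auto simp: sets_rsk_space_iff)
  have AE_X: "AE x in rsk_space. x \<in> X"
    using G(2) AE_space by eventually_elim (simp add: X_def space_rsk_space)
  have Y: "Y \<in> sets tableau_algebra"
  proof -
    let ?D = "{t \<in> infinite_tableaux. G t \<in> rsk_domain}"
    have D: "?D \<in> sets tableau_algebra"
    proof -
      have eq: "?D = G -` rsk_domain \<inter> space tableau_algebra" by (auto simp: space_tableau_algebra)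
      show ?thesis unfolding eq by (rule measurable_sets[OF G(1) sets_rsk_domain])
    qed
    have "G \<in> restrict_space tableau_algebra ?D \<rightarrow>\<^sub>M rsk_space"
      unfolding rsk_space_def
      by (intro measurable_restrict_space2 measurable_restrict_space1 G(1))
         (auto simp: space_restrict_space space_tableau_algebra)
    note m = measurable_compose[OF measurable_compose[OF this measurable_rsk] measurable_entry]
    have id: "(\<lambda>t. t b) \<in> restrict_space tableau_algebra ?D \<rightarrow>\<^sub>M count_space UNIV" for b
      by (rule measurable_restrict_space1[OF measurable_entry])
    have "{t \<in> space (restrict_space tableau_algebra ?D). \<forall>b. rsk (G t) b = t b} \<in> sets (restrict_space tableau_algebra ?D)"
      by (intro sets.sets_Collect_countable_All sets_Collect_eq_count_space m id)
    moreover have "Y = {t \<in> space (restrict_space tableau_algebra ?D). \<forall>b. rsk (G t) b = t b}"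
      by (auto simp: Y_def space_restrict_space space_tableau_algebra fun_eq_iff)
    ultimately have "Y \<in> sets (restrict_space tableau_algebra ?D)" by simp
    then show ?thesis
    proof (subst (asm) sets_restrict_space_iff)
      have "?D \<inter> space tableau_algebra = ?D" by (auto simp: space_tableau_algebra)
      then show "?D \<inter> space tableau_algebra \<in> sets tableau_algebra" using D by (simp only:)
    qed (rule conjunct2)
  qed
  have Y_rsk: "rsk x \<in> Y" if "x \<in> X" for x
    using that rsk_space' by (auto simp: X_def Y_def)
  have X_G: "G t \<in> X" "rsk (G t) = t" if "t \<in> Y" for t
    using that by (auto simp: X_def Y_def)
  have AE_Y: "AE t in plancherel_measure. t \<in> Y"
    unfolding distr_rsk[symmetric]
  proof (subst AE_distr_iff[OF measurable_rsk])
    show "{t \<in> space tableau_algebra. t \<in> Y} \<in> sets tableau_algebra"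
      using Y sets.sets_into_space[OF Y] by (simp add: Int_absorb1 flip: Int_def)
    show "AE x in rsk_space. rsk x \<in> Y" using AE_X by eventually_elim (rule Y_rsk)
  qed
  have bij: "bij_betw rsk X Y"
    by (rule bij_betw_byWitness[where f'=G]) (use Y_rsk X_G in \<open>auto simp: X_def\<close>)
  have inv: "the_inv_into X rsk t = G t" if "t \<in> Y" for t
    using bij_betw_imp_inj_on[OF bij] X_G[OF that] by (intro the_inv_into_f_eq) auto
  have "G \<in> restrict_space tableau_algebra Y \<rightarrow>\<^sub>M restrict_space unit_cube X"
    using X_G by (intro measurable_restrict_space3 G(1)) auto
  then have G': "G \<in> restrict_space plancherel_measure Y \<rightarrow>\<^sub>M restrict_space unit_cube X"
    using measurable_cong_sets[OF sets_restrict_space_cong[OF sets_plancherel_measure] refl] by blast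
  have "the_inv_into X rsk \<in> restrict_space plancherel_measure Y \<rightarrow>\<^sub>M restrict_space unit_cube X"
    using G' by (subst measurable_cong[where g=G]) (auto simp: space_restrict_space inv)
  moreover have "rsk \<in> restrict_space unit_cube rsk_domain \<rightarrow>\<^sub>M plancherel_measure"
    using measurable_rsk measurable_cong_sets[OF refl sets_plancherel_measure] unfolding rsk_space_def by blast
  moreover have "distr (restrict_space unit_cube rsk_domain) plancherel_measure rsk = plancherel_measure"
    using distr_rsk distr_cong[OF refl sets_plancherel_measure refl, of "restrict_space unit_cube rsk_domain" rsk]
    unfolding rsk_space_def by simp
  moreover have "AE x in unit_cube. x \<in> rsk_domain \<and> left_shift x \<in> rsk_domain \<and> rsk (left_shift x) = jdt (rsk x)"
    using AE_rsk_domain by eventually_elim (simp add: rsk_left_shift)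
  moreover have "AE x in unit_cube. x \<in> X" using AE_X by (simp add: AE_rsk_space_iff)
  moreover have "Y \<in> sets plancherel_measure" using Y by (simp add: sets_plancherel_measure)
  ultimately show ?thesis
    unfolding mps_isomorphism_def
    using measure_preserving_left_shift measure_preserving_jdt sets_rsk_domain AE_rsk_domain X AE_Y bij
    by blast
qed

end
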